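(* Let $\mathcal{M}_1$ and $\mathcal{M}_2$ be smooth manifolds of dimensions $m_1$ and $m_2$, respectively (possibly with boundaries). Suppose that $\mathcal{M}_1$ is compact and oriented. Let $\omega\in\Omega^{m_1}(\mathcal{M}_2)$ be a closed $m_1$-form on $\mathcal{M}_2$. Let $E:C^\infty(\mathcal{M}_1,\mathcal{M}_2)\to\mathbb{R}$ be given by $$E(f)=\int_{\mathcal{M}_1}f^*\omega .$$ Then $E$ is a null-Lagrangian.
   Context: A functional $E:C^\infty(\mathcal{M}_1,\mathcal{M}_2)\to\mathbb{R}$ is a null-Lagrangian if every smooth map $f$ is a critical point of $E$ with respect to smooth homotopies relative to the boundary: for every smooth variation $f_t:\mathcal{M}_1\to\mathcal{M}_2$ with $f_0=f$ and $f_t|_{\partial\mathcal{M}_1}=f|_{\partial\mathcal{M}_1}$ for all $t$, one has $\frac{d}{dt}E(f_t)|_{t=0}=0$. *)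

theory Defs
  imports "HOL-Analysis.Analysis"
begin

section \<open>Smooth functions on subsets of Euclidean space\<close>

text \<open>To be used on open sets \<open>S\<close> only.\<close>

primrec Ck_on :: "nat \<Rightarrow> 'a::euclidean_space set \<Rightarrow> ('a \<Rightarrow> 'b::real_normed_vector) \<Rightarrow> bool"
  where
    "Ck_on 0 S f \<longleftrightarrow> continuous_on S f"
  | "Ck_on (Suc k) S f \<longleftrightarrow> f differentiable_on S \<and>
       (\<forall>v. Ck_on k S (\<lambda>x. frechet_derivative f (at x) v))"

text \<open>On an arbitrary set, such as a relatively open subset of a half-space, smoothness means
  the existence of smooth extensions to ambient neighbourhoods.\<close>

definition smooth_on :: "'a::euclidean_space set \<Rightarrow> ('a \<Rightarrow> 'b::real_normed_vector) \<Rightarrow> bool"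
  where "smooth_on A f \<longleftrightarrow>
    (\<forall>x\<in>A. \<exists>W g. open W \<and> x \<in> W \<and> (\<forall>k. Ck_on k W g) \<and> (\<forall>y\<in>A \<inter> W. g y = f y))"


section \<open>Model spaces\<close>

text \<open>A manifold of dimension \<open>n \<ge> 1\<close> is modelled on \<open>real^'n\<close> with \<open>CARD('n) = n\<close>. Since there
  is no index type with \<open>0\<close> elements, dimension \<open>0\<close> is modelled on the subspace \<open>{0}\<close> of
  \<open>real^'n\<close>, for any \<open>'n\<close>. Other values of \<open>n\<close> are excluded in \<open>smooth_manifold\<close> below. The
  order on the index type provides the order of the coordinates.\<close>

type_synonym 'n rn = "real^'n"

definition coord_space :: "nat \<Rightarrow> ('n::{finite,wellorder} rn) set"
  where "coord_space n = (if n = 0 then {0} else UNIV)"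

definition half_space :: "nat \<Rightarrow> ('n::{finite,wellorder} rn) set"
  where "half_space n = {x \<in> coord_space n. 0 \<le> x $ Max UNIV}"

definition coord_vector :: "nat \<Rightarrow> 'n::{finite,wellorder} rn"
  where "coord_vector i = axis (sorted_list_of_set UNIV ! i) 1"

text \<open>Lebesgue measure on the model space; in dimension \<open>0\<close> it is counting measure, and
  the determinant of a linear map is \<open>1\<close>.\<close>

definition coord_measure :: "nat \<Rightarrow> ('n::{finite,wellorder} rn) measure"
  where "coord_measure n = (if n = 0 then count_space {0} else lborel)"

definition coord_det :: "nat \<Rightarrow> ('n::{finite,wellorder} rn \<Rightarrow> 'n rn) \<Rightarrow> real"
  where "coord_det n D = (if n = 0 then 1 else det (matrix D))"


section \<open>Smooth manifolds with (possibly empty) boundary\<close>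

text \<open>A chart is a pair of its domain and its coordinate map; the values of the map outside the
  domain are irrelevant.\<close>

type_synonym ('p, 'n) chart = "'p set \<times> ('p \<Rightarrow> 'n rn)"

record ('p, 'n::"{finite,wellorder}") manifold =
  mdim :: nat
  mtop :: "'p topology"
  atlas :: "('p, 'n) chart set"

definition chart_inv :: "('p, 'n::{finite,wellorder}) chart \<Rightarrow> 'n rn \<Rightarrow> 'p"
  where "chart_inv c = inv_into (fst c) (snd c)"

definition is_chart ::
    "nat \<Rightarrow> 'p topology \<Rightarrow> ('p, 'n::{finite,wellorder}) chart \<Rightarrow> bool"
  where "is_chart n X c \<longleftrightarrow> openin X (fst c) \<and>
    (openin (top_of_set (coord_space n)) (snd c ` fst c) \<or>
     openin (top_of_set (half_space n)) (snd c ` fst c)) \<and>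
    homeomorphic_map (subtopology X (fst c)) (top_of_set (snd c ` fst c)) (snd c)"

definition overlap ::
    "('p, 'n::{finite,wellorder}) chart \<Rightarrow> ('p, 'n) chart \<Rightarrow> ('n rn) set"
  where "overlap c d = snd c ` (fst c \<inter> fst d)"

definition transition ::
    "('p, 'n::{finite,wellorder}) chart \<Rightarrow> ('p, 'n) chart \<Rightarrow> 'n rn \<Rightarrow> 'n rn"
  where "transition c d = snd d \<circ> chart_inv c"

text \<open>At boundary points, derivatives are taken within the relatively open subset of the
  half-space on which the map is defined; they are still unique. In dimension \<open>0\<close> the derivative
  is an unspecified linear map, but it is only ever applied to the tangent vector \<open>0\<close>.\<close>

definition transition_deriv ::
    "('p, 'n::{finite,wellorder}) chart \<Rightarrow> ('p, 'n) chart \<Rightarrow> 'p \<Rightarrow> 'n rn \<Rightarrow> 'n rn"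
  where "transition_deriv c d p =
    frechet_derivative (transition c d) (at (snd c p) within overlap c d)"

definition smooth_manifold :: "('p, 'n::{finite,wellorder}) manifold \<Rightarrow> bool"
  where "smooth_manifold M \<longleftrightarrow>
    (mdim M = 0 \<or> mdim M = CARD('n)) \<and>
    Hausdorff_space (mtop M) \<and> second_countable (mtop M) \<and>
    (\<forall>c\<in>atlas M. is_chart (mdim M) (mtop M) c) \<and>
    (\<Union>c\<in>atlas M. fst c) = topspace (mtop M) \<and>
    (\<forall>c\<in>atlas M. \<forall>d\<in>atlas M. smooth_on (overlap c d) (transition c d))"

definition mboundary :: "('p, 'n::{finite,wellorder}) manifold \<Rightarrow> 'p set"
  where "mboundary M = {p. mdim M \<noteq> 0 \<and>
    (\<exists>c\<in>atlas M. p \<in> fst c \<and> openin (top_of_set (half_space (mdim M))) (snd c ` fst c) \<and>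
       snd c p $ Max UNIV = 0)}"


section \<open>Smooth maps and variations\<close>

definition local_rep :: "('p, 'm::{finite,wellorder}) chart \<Rightarrow> ('q, 'n::{finite,wellorder}) chart \<Rightarrow>
    ('p \<Rightarrow> 'q) \<Rightarrow> 'm rn \<Rightarrow> 'n rn"
  where "local_rep c d f = snd d \<circ> f \<circ> chart_inv c"

definition local_dom :: "('p, 'm::{finite,wellorder}) chart \<Rightarrow> ('q, 'n::{finite,wellorder}) chart \<Rightarrow>
    ('p \<Rightarrow> 'q) \<Rightarrow> ('m rn) set"
  where "local_dom c d f = snd c ` {p \<in> fst c. f p \<in> fst d}"

definition smooth_maps :: "('p, 'm::{finite,wellorder}) manifold \<Rightarrow>
    ('q, 'n::{finite,wellorder}) manifold \<Rightarrow> ('p \<Rightarrow> 'q) set"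
  where "smooth_maps M N = {f. f \<in> extensional (topspace (mtop M)) \<and>
    continuous_map (mtop M) (mtop N) f \<and>
    (\<forall>c\<in>atlas M. \<forall>d\<in>atlas N. smooth_on (local_dom c d f) (local_rep c d f))}"

definition smooth_variation :: "('p, 'm::{finite,wellorder}) manifold \<Rightarrow>
    ('q, 'n::{finite,wellorder}) manifold \<Rightarrow> real \<Rightarrow> (real \<Rightarrow> 'p \<Rightarrow> 'q) \<Rightarrow> bool"
  where "smooth_variation M N \<epsilon> F \<longleftrightarrow>
    (\<forall>t\<in>{-\<epsilon><..<\<epsilon>}. F t \<in> smooth_maps M N) \<and>
    continuous_map (prod_topology (top_of_set {-\<epsilon><..<\<epsilon>}) (mtop M)) (mtop N) (\<lambda>(t, p). F t p) \<and>
    (\<forall>c\<in>atlas M. \<forall>d\<in>atlas N.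
       smooth_on {(t, x). t \<in> {-\<epsilon><..<\<epsilon>} \<and> x \<in> local_dom c d (F t)}
         (\<lambda>(t, x). local_rep c d (F t) x))"

definition null_lagrangian :: "('p, 'm::{finite,wellorder}) manifold \<Rightarrow>
    ('q, 'n::{finite,wellorder}) manifold \<Rightarrow> (('p \<Rightarrow> 'q) \<Rightarrow> real) \<Rightarrow> bool"
  where "null_lagrangian M N E \<longleftrightarrow>
    (\<forall>f\<in>smooth_maps M N. \<forall>\<epsilon>>0. \<forall>F.
       smooth_variation M N \<epsilon> F \<and> F 0 = f \<and>
       (\<forall>t\<in>{-\<epsilon><..<\<epsilon>}. \<forall>p\<in>mboundary M. F t p = f p) \<longrightarrow>
       ((\<lambda>t. E (F t)) has_real_derivative 0) (at 0))"


section \<open>Differential forms\<close>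

text \<open>Alternating \<open>k\<close>-linear forms on a subspace \<open>T\<close>. The arguments are given by a sequence, of
  which only the first \<open>k\<close> members matter.\<close>

definition alternating_form ::
    "nat \<Rightarrow> 'a::real_vector set \<Rightarrow> ((nat \<Rightarrow> 'a) \<Rightarrow> real) \<Rightarrow> bool"
  where "alternating_form k T a \<longleftrightarrow>
    (\<forall>v w. (\<forall>i<k. v i = w i) \<longrightarrow> a v = a w) \<and>
    (\<forall>v. (\<forall>i<k. v i \<in> T) \<longrightarrow>
       (\<forall>i<k. \<forall>x\<in>T. \<forall>y\<in>T. \<forall>r s.
          a (v(i := r *\<^sub>R x + s *\<^sub>R y)) = r * a (v(i := x)) + s * a (v(i := y))) \<and>
       (\<forall>i<k. \<forall>j<k. i \<noteq> j \<and> v i = v j \<longrightarrow> a v = 0))"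

text \<open>A differential form is the family of its coordinate representations: \<open>\<omega> c x v\<close> is the value
  in the chart \<open>c\<close>, at the point with coordinates \<open>x\<close>, on the tangent vectors with
  components \<open>v 0, v 1, \<dots>\<close>.\<close>

type_synonym ('p, 'n) form = "('p, 'n) chart \<Rightarrow> 'n rn \<Rightarrow> (nat \<Rightarrow> 'n rn) \<Rightarrow> real"

definition differential_form ::
    "nat \<Rightarrow> ('p, 'n::{finite,wellorder}) manifold \<Rightarrow> ('p, 'n) form \<Rightarrow> bool"
  where "differential_form k M \<omega> \<longleftrightarrow>
    (\<forall>c\<in>atlas M.
       (\<forall>x\<in>snd c ` fst c. alternating_form k (coord_space (mdim M)) (\<omega> c x)) \<and>
       (\<forall>v. (\<forall>i. v i \<in> coord_space (mdim M)) \<longrightarrow>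
          smooth_on (snd c ` fst c) (\<lambda>x. \<omega> c x v))) \<and>
    (\<forall>c\<in>atlas M. \<forall>d\<in>atlas M. \<forall>p\<in>fst c \<inter> fst d. \<forall>v. (\<forall>i. v i \<in> coord_space (mdim M)) \<longrightarrow>
       \<omega> c (snd c p) v = \<omega> d (snd d p) (\<lambda>i. transition_deriv c d p (v i)))"

text \<open>The usual coordinate expression
  \<open>d\<omega>(v\<^sub>0, \<dots>, v\<^sub>k) = \<Sum>i\<le>k. (-1)^i D(\<omega>(v\<^sub>0, \<dots>, omit v\<^sub>i, \<dots>, v\<^sub>k)) v\<^sub>i\<close> for constant
  vector fields \<open>v\<^sub>i\<close>.\<close>

definition exterior_deriv :: "nat \<Rightarrow> ('p, 'n::{finite,wellorder}) form \<Rightarrow> ('p, 'n) form"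
  where "exterior_deriv k \<omega> = (\<lambda>c x v. \<Sum>i\<le>k. (-1) ^ i *
    frechet_derivative (\<lambda>y. \<omega> c y (\<lambda>j. if j < i then v j else v (Suc j)))
      (at x within snd c ` fst c) (v i))"

definition closed_form ::
    "nat \<Rightarrow> ('p, 'n::{finite,wellorder}) manifold \<Rightarrow> ('p, 'n) form \<Rightarrow> bool"
  where "closed_form k M \<omega> \<longleftrightarrow>
    (\<forall>c\<in>atlas M. \<forall>x\<in>snd c ` fst c. \<forall>v. (\<forall>i. v i \<in> coord_space (mdim M)) \<longrightarrow>
       exterior_deriv k \<omega> c x v = 0)"

text \<open>By the transformation law of \<open>\<omega>\<close>, the choice of the chart \<open>d\<close> around the image point
  is immaterial.\<close>

definition pullback :: "('q, 'n::{finite,wellorder}) manifold \<Rightarrow> ('p \<Rightarrow> 'q) \<Rightarrow>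
    ('q, 'n) form \<Rightarrow> ('p, 'm::{finite,wellorder}) form"
  where "pullback N f \<omega> = (\<lambda>c x v.
    let d = (SOME d. d \<in> atlas N \<and> f (chart_inv c x) \<in> fst d)
    in \<omega> d (local_rep c d f x)
         (\<lambda>i. frechet_derivative (local_rep c d f) (at x within local_dom c d f) (v i)))"


section \<open>Orientation and integration\<close>

text \<open>An orientation is a continuous choice of orientations of the tangent spaces: \<open>\<sigma> c p\<close> is
  \<open>1\<close> if the coordinate basis of the chart \<open>c\<close> at \<open>p\<close> is positively oriented, and \<open>-1\<close> otherwise.
  (Requiring an atlas of positively oriented charts instead would be too restrictive for
  one-dimensional manifolds with boundary, as there is only one half-space to map to.)\<close>

definition orientation :: "('p, 'n::{finite,wellorder}) manifold \<Rightarrow>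
    (('p, 'n) chart \<Rightarrow> 'p \<Rightarrow> real) \<Rightarrow> bool"
  where "orientation M \<sigma> \<longleftrightarrow>
    (\<forall>c\<in>atlas M. (\<forall>p\<in>fst c. \<sigma> c p \<in> {-1, 1}) \<and>
       continuous_map (subtopology (mtop M) (fst c)) euclideanreal (\<sigma> c)) \<and>
    (\<forall>c\<in>atlas M. \<forall>d\<in>atlas M. \<forall>p\<in>fst c \<inter> fst d.
       \<sigma> c p = sgn (coord_det (mdim M) (transition_deriv c d p)) * \<sigma> d p)"

text \<open>Finite smooth partitions of unity \<open>\<rho> 0, \<dots>, \<rho> (k - 1)\<close> with the support of \<open>\<rho> i\<close> contained
  in the domain of the chart \<open>c i\<close>; these exist on compact manifolds.\<close>

definition partition_of_unity :: "('p, 'n::{finite,wellorder}) manifold \<Rightarrow>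
    nat \<Rightarrow> (nat \<Rightarrow> ('p, 'n) chart) \<Rightarrow> (nat \<Rightarrow> 'p \<Rightarrow> real) \<Rightarrow> bool"
  where "partition_of_unity M k c \<rho> \<longleftrightarrow>
    (\<forall>i<k. c i \<in> atlas M \<and>
       (\<forall>d\<in>atlas M. smooth_on (snd d ` fst d) (\<rho> i \<circ> chart_inv d)) \<and>
       (\<forall>p\<in>topspace (mtop M). 0 \<le> \<rho> i p) \<and>
       mtop M closure_of {p \<in> topspace (mtop M). \<rho> i p \<noteq> 0} \<subseteq> fst (c i)) \<and>
    (\<forall>p\<in>topspace (mtop M). (\<Sum>i<k. \<rho> i p) = 1)"

text \<open>The integral of a form of top degree over a compact oriented manifold; it does not depend
  on the partition of unity chosen.\<close>

definition form_integral :: "('p, 'n::{finite,wellorder}) manifold \<Rightarrow>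
    (('p, 'n) chart \<Rightarrow> 'p \<Rightarrow> real) \<Rightarrow> ('p, 'n) form \<Rightarrow> real"
  where "form_integral M \<sigma> \<eta> =
    (let (k, c, \<rho>) = (SOME (k, c, \<rho>). partition_of_unity M k c \<rho>)
     in \<Sum>i<k. set_lebesgue_integral (coord_measure (mdim M)) (snd (c i) ` fst (c i))
          (\<lambda>x. \<rho> i (chart_inv (c i) x) * \<sigma> (c i) (chart_inv (c i) x) * \<eta> (c i) x coord_vector))"

end

theory Submission
  imports Defs
begin

text \<open>
  Read the variation as a single map \<open>(-\<epsilon>, \<epsilon>) \<times> M \<rightarrow> N\<close>. The pullback \<open>\<Theta>\<close> of \<open>\<omega>\<close> along this map is
  closed because \<open>\<omega>\<close> is. Contract \<open>\<Theta>\<close> with the time direction to obtain a form \<open>\<beta>\<close> of degree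
  \<open>m - 1\<close> on \<open>M\<close>; closedness of \<open>\<Theta>\<close> then says that the time derivative of the pullback of \<open>\<omega>\<close> is
  \<open>d \<beta>\<close> (\<open>pulled_divergence\<close>). The form \<open>\<beta>\<close> vanishes on the boundary of \<open>M\<close>, where the variation
  does not move (\<open>pulled_stationary\<close>). Hence the derivative of \<open>E\<close> is the integral of \<open>d \<beta>\<close>, which
  is \<open>0\<close> by Stokes' theorem.

  Stokes' theorem is proved for this purpose with the partition of unity \<open>\<rho>\<^sub>i\<close> that
  defines the integral. In the chart belonging to \<open>\<rho>\<^sub>i\<close> the form \<open>\<rho>\<^sub>i \<beta>\<close> is compactly supported, so
  that the integral of \<open>d (\<rho>\<^sub>i \<beta>)\<close> vanishes (\<open>stokes_in_chart\<close>) and \<open>\<rho>\<^sub>i d \<beta>\<close> may be replaced by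
  \<open>- d \<rho>\<^sub>i \<and> \<beta>\<close>. It remains to sum the integrals of \<open>d \<rho>\<^sub>i \<and> \<beta>\<close>. These forms are tensorial, so
  each of them can be multiplied by \<open>1 = (\<Sum>j. \<rho>\<^sub>j)\<close> and its \<open>j\<close>-th part moved to the \<open>j\<close>-th chart by the
  change of variables formula (\<open>flux_exchange\<close>); in that chart the sum over \<open>i\<close> contains the factor
  \<open>d (\<Sum>i. \<rho>\<^sub>i) = 0\<close> (\<open>total_flux_zero\<close>). This order of steps never differentiates a transition
  map twice. In coordinates \<open>\<beta>\<close> is a vector field, whose component \<open>l\<close> is the value of \<open>\<Theta>\<close> on the
  coordinate vectors with the \<open>l\<close>-th one replaced by the time direction; \<open>d \<beta>\<close> is its divergence and
  \<open>d \<rho> \<and> \<beta>\<close> is the derivative of \<open>\<rho>\<close> along it, called \<open>flux\<close> below.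

  That a compactly supported directional derivative has integral \<open>0\<close> follows from the translation
  invariance of Lebesgue measure: all difference quotients have integral \<open>0\<close>, and they are dominated
  because the function is Lipschitz (\<open>integral_directional_derivative_zero\<close>). At the boundary of a
  half-space it is the vanishing of \<open>\<beta>\<close> that keeps the extension by \<open>0\<close> Lipschitz.

  If \<open>M\<close> has dimension \<open>0\<close>, then the integral is a finite signed sum of values of the function \<open>\<omega>\<close>
  along curves, and closedness says that \<open>\<omega>\<close> is locally constant
  (\<open>point_pullback_derivative_zero\<close>).
\<close>

section \<open>Calculus of smooth functions on subsets\<close>

lemma Ck_on_SucD: "Ck_on (Suc k) S f \<Longrightarrow> Ck_on k S f"
  by (induction k arbitrary: f) (auto simp: differentiable_imp_continuous_on)

lemma Ck_on_subset: "Ck_on k S f \<Longrightarrow> T \<subseteq> S \<Longrightarrow> Ck_on k T f"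
  by (induction k arbitrary: f) (auto intro: continuous_on_subset differentiable_on_subset)

lemma Ck_on_cong:
  assumes "open S" "\<And>x. x \<in> S \<Longrightarrow> f x = g x" "Ck_on k S f"
  shows "Ck_on k S g"
  using assms(2,3)
proof (induction k arbitrary: f g)
  case 0
  then show ?case using continuous_on_cong[of S S f g] by simp
next
  case (Suc k)
  have D: "(f has_derivative frechet_derivative f (at x)) (at x)" if "x \<in> S" for x
    using Suc.prems(2) that at_within_open[OF that assms(1)] frechet_derivative_works
    unfolding Ck_on.simps differentiable_on_def by metis
  then have D': "(g has_derivative frechet_derivative f (at x)) (at x)" if "x \<in> S" for x
    using has_derivative_transform_within_open[OF _ assms(1) that] Suc.prems(1) that by blast
  then have "g differentiable_on S"
    by (meson differentiable_at_withinI differentiable_def differentiable_on_def)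
  moreover have "Ck_on k S (\<lambda>x. frechet_derivative g (at x) v)" for v
  proof (rule Suc.IH)
    show "frechet_derivative f (at x) v = frechet_derivative g (at x) v" if "x \<in> S" for x
      using frechet_derivative_at[OF D'[OF that]] by simp
    show "Ck_on k S (\<lambda>x. frechet_derivative f (at x) v)"
      using Suc.prems(2) by simp
  qed
  ultimately show ?case by simp
qed

lemma Ck_on_SucI:
  assumes "open S" and "\<And>x. x \<in> S \<Longrightarrow> (f has_derivative f' x) (at x)"
    and "\<And>v. Ck_on k S (\<lambda>x. f' x v)"
  shows "Ck_on (Suc k) S f"
proof -
  have "f differentiable_on S"
    using assms(1,2) by (meson differentiable_at_withinI differentiable_def differentiable_on_def)
  moreover have "frechet_derivative f (at x) = f' x" if "x \<in> S" for x
    using frechet_derivative_at[OF assms(2)[OF that]] by simp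
  then have "Ck_on k S (\<lambda>x. frechet_derivative f (at x) v)" for v
    by (intro Ck_on_cong[OF assms(1) _ assms(3)[of v]]) simp
  ultimately show ?thesis by simp
qed

lemma Ck_on_SucE:
  assumes "open S" "Ck_on (Suc k) S f"
  obtains f' where "\<And>x. x \<in> S \<Longrightarrow> (f has_derivative f' x) (at x)"
    and "\<And>v. Ck_on k S (\<lambda>x. f' x v)" and "\<And>x. f' x = frechet_derivative f (at x)"
proof
  show "(f has_derivative frechet_derivative f (at x)) (at x)" if "x \<in> S" for x
    using assms(2) that at_within_open[OF that assms(1)] frechet_derivative_works
    unfolding Ck_on.simps differentiable_on_def by metis
qed (use assms(2) in auto)

lemma Ck_on_const: "open S \<Longrightarrow> Ck_on k S (\<lambda>x. c)"
proof (induction k arbitrary: c)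
  case (Suc k)
  then show ?case by (intro Ck_on_SucI[where f' = "\<lambda>x v. 0"]) auto
qed auto

lemma Ck_on_bounded_linear: "bounded_linear f \<Longrightarrow> open S \<Longrightarrow> Ck_on k S f"
proof (induction k)
  case 0
  then show ?case using linear_continuous_on by simp
next
  case (Suc k)
  then show ?case
    by (intro Ck_on_SucI[where f' = "\<lambda>x. f"]) (auto intro: bounded_linear_imp_has_derivative Ck_on_const)
qed

lemma Ck_on_add:
  assumes "open S" "Ck_on k S f" "Ck_on k S g"
  shows "Ck_on k S (\<lambda>x. f x + g x)"
  using assms(2,3)
proof (induction k arbitrary: f g)
  case 0
  then show ?case by (auto intro: continuous_intros)
next
  case (Suc k)
  obtain f' g' where "\<And>x. x \<in> S \<Longrightarrow> (f has_derivative f' x) (at x)" "\<And>v. Ck_on k S (\<lambda>x. f' x v)"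
    "\<And>x. x \<in> S \<Longrightarrow> (g has_derivative g' x) (at x)" "\<And>v. Ck_on k S (\<lambda>x. g' x v)"
    using Ck_on_SucE[OF assms(1) Suc.prems(1)] Ck_on_SucE[OF assms(1) Suc.prems(2)] by metis
  then show ?case
    by (intro Ck_on_SucI[where f' = "\<lambda>x v. f' x v + g' x v"] Suc.IH)
       (auto intro: has_derivative_add assms(1))
qed

lemma (in bounded_bilinear) Ck_on_prod:
  assumes "open S" "Ck_on k S f" "Ck_on k S g"
  shows "Ck_on k S (\<lambda>x. prod (f x) (g x))"
  using assms(2,3)
proof (induction k arbitrary: f g)
  case 0
  then show ?case by (auto intro: continuous_on)
next
  case (Suc k)
  obtain f' g' where "\<And>x. x \<in> S \<Longrightarrow> (f has_derivative f' x) (at x)" "\<And>v. Ck_on k S (\<lambda>x. f' x v)"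
    "\<And>x. x \<in> S \<Longrightarrow> (g has_derivative g' x) (at x)" "\<And>v. Ck_on k S (\<lambda>x. g' x v)"
    using Ck_on_SucE[OF assms(1) Suc.prems(1)] Ck_on_SucE[OF assms(1) Suc.prems(2)] by metis
  moreover have "Ck_on k S f" "Ck_on k S g"
    using Suc.prems Ck_on_SucD by auto
  ultimately show ?case
    by (intro Ck_on_SucI[where f' = "\<lambda>x v. prod (f x) (g' x v) + prod (f' x v) (g x)"] Suc.IH Ck_on_add)
       (auto intro: FDERIV assms(1))
qed

lemma Ck_on_sum:
  assumes "open S" "\<And>i. i \<in> I \<Longrightarrow> Ck_on k S (f i)"
  shows "Ck_on k S (\<lambda>x. \<Sum>i\<in>I. f i x)"
  using assms(2)
  by (induction I rule: infinite_finite_induct) (auto intro: Ck_on_const Ck_on_add assms(1))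

text \<open>By the chain rule the derivative is a sum over the standard basis of products of partial
  derivatives; the induction hypothesis is applied to the partial derivatives of the outer function,
  which is why that function is generalized.\<close>

lemma Ck_on_compose:
  fixes f :: "'a::euclidean_space \<Rightarrow> 'b::euclidean_space"
  assumes "open S" "open T" "f ` S \<subseteq> T" "Ck_on k S f" "Ck_on k T g"
  shows "Ck_on k S (\<lambda>x. g (f x))"
  using assms(4,5)
proof (induction k arbitrary: g)
  case 0
  then show ?case using assms(3) continuous_on_compose2 by (auto, blast)
next
  case (Suc k)
  obtain f' g' where f': "\<And>x. x \<in> S \<Longrightarrow> (f has_derivative f' x) (at x)" "\<And>v. Ck_on k S (\<lambda>x. f' x v)"
    and g': "\<And>x. x \<in> T \<Longrightarrow> (g has_derivative g' x) (at x)" "\<And>v. Ck_on k T (\<lambda>x. g' x v)"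
    using Ck_on_SucE[OF assms(1) Suc.prems(1)] Ck_on_SucE[OF assms(2) Suc.prems(2)] by metis
  have D: "((\<lambda>x. g (f x)) has_derivative (\<lambda>v. \<Sum>b\<in>Basis. (f' x v \<bullet> b) *\<^sub>R g' (f x) b)) (at x)"
    if "x \<in> S" for x
  proof -
    have "((\<lambda>x. g (f x)) has_derivative (\<lambda>v. g' (f x) (f' x v))) (at x)"
      using has_derivative_compose[OF f'(1)[OF that] g'(1)[of "f x"]] assms(3) that by blast
    moreover have "g' (f x) (f' x v) = (\<Sum>b\<in>Basis. (f' x v \<bullet> b) *\<^sub>R g' (f x) b)" for v
    proof -
      have lin: "linear (g' (f x))"
        using g'(1)[of "f x"] assms(3) that has_derivative_linear by blast
      have "g' (f x) (f' x v) = g' (f x) (\<Sum>b\<in>Basis. (f' x v \<bullet> b) *\<^sub>R b)"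
        by (simp add: euclidean_representation)
      then show ?thesis by (simp add: linear_sum[OF lin] linear_scale[OF lin])
    qed
    ultimately show ?thesis by simp
  qed
  have "Ck_on k S (\<lambda>x. (f' x v \<bullet> b) *\<^sub>R g' (f x) b)" for v b
  proof (rule bounded_bilinear.Ck_on_prod[OF bounded_bilinear_scaleR assms(1)])
    show "Ck_on k S (\<lambda>x. f' x v \<bullet> b)"
      using bounded_bilinear.Ck_on_prod[OF bounded_bilinear_inner assms(1) f'(2) Ck_on_const[OF assms(1)]] .
    show "Ck_on k S (\<lambda>x. g' (f x) b)"
      using Suc.IH[OF _ g'(2)[of b]] Ck_on_SucD[OF Suc.prems(1)] by blast
  qed
  then show ?case
    by (intro Ck_on_SucI[OF assms(1) D] Ck_on_sum assms(1)) auto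
qed

lemma Ck_on_inverse: "Ck_on k (- {0::real}) inverse"
proof (induction k)
  case 0
  then show ?case by (auto intro!: continuous_intros)
next
  case (Suc k)
  have "Ck_on k (- {0}) (\<lambda>x. - (inverse x * v * inverse x))" for v :: real
    using bounded_bilinear.Ck_on_prod[OF bounded_bilinear_mult _
        bounded_bilinear.Ck_on_prod[OF bounded_bilinear_mult _ Suc] Suc, of "\<lambda>_. - v"]
      Ck_on_const[of "- {0::real}" k "- v"] by (simp add: algebra_simps open_Compl)
  then show ?case
    by (intro Ck_on_SucI[where f' = "\<lambda>x v. - (inverse x * v * inverse x)"])
       (auto intro!: has_derivative_inverse' simp: open_Compl)
qed

lemma Ck_on_has_derivative:
  assumes "open S" "Ck_on (Suc k) S f" "x \<in> S"
  shows "(f has_derivative frechet_derivative f (at x)) (at x)"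
  by (rule Ck_on_SucE[OF assms(1,2)]) (use assms(3) in simp)

lemma Ck_on_derivative: "Ck_on (Suc k) S f \<Longrightarrow> Ck_on k S (\<lambda>x. frechet_derivative f (at x) v)"
  by simp

lemma Ck_on_local:
  assumes "open S" "\<And>x. x \<in> S \<Longrightarrow> \<exists>W. open W \<and> x \<in> W \<and> Ck_on k W f"
  shows "Ck_on k S f"
  using assms(2)
proof (induction k arbitrary: f)
  case 0
  have "isCont f x" if x: "x \<in> S" for x
  proof -
    obtain W where "open W" "x \<in> W" "continuous_on W f" using 0[OF x] by auto
    then show ?thesis by (simp add: continuous_on_eq_continuous_at)
  qed
  then show ?case by (simp add: continuous_at_imp_continuous_on)
next
  case (Suc k)
  show ?case
  proof (rule Ck_on_SucI[OF assms(1), where f' = "\<lambda>x. frechet_derivative f (at x)"])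
    fix x assume x: "x \<in> S"
    obtain W where W: "open W" "x \<in> W" "Ck_on (Suc k) W f" using Suc.prems[OF x] by blast
    show "(f has_derivative frechet_derivative f (at x)) (at x)"
      using Ck_on_SucE[OF W(1,3)] W(2) by metis
  next
    fix v
    show "Ck_on k S (\<lambda>x. frechet_derivative f (at x) v)"
      using Suc.prems by (intro Suc.IH) (metis Ck_on.simps(2))
  qed
qed

lemma smooth_onE:
  assumes "smooth_on A f" "x \<in> A"
  obtains W g where "open W" "x \<in> W" "\<And>k. Ck_on k W g" "\<And>y. y \<in> A \<Longrightarrow> y \<in> W \<Longrightarrow> g y = f y"
proof -
  have "\<exists>W g. open W \<and> x \<in> W \<and> (\<forall>k. Ck_on k W g) \<and> (\<forall>y\<in>A \<inter> W. g y = f y)"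
    using assms unfolding smooth_on_def by (rule bspec)
  then obtain W g where "open W \<and> x \<in> W \<and> (\<forall>k. Ck_on k W g) \<and> (\<forall>y\<in>A \<inter> W. g y = f y)"
    by (elim exE)
  then show thesis by (intro that[of W g]) auto
qed

lemma smooth_onI:
  assumes "\<And>x. x \<in> A \<Longrightarrow> \<exists>W g. open W \<and> x \<in> W \<and> (\<forall>k. Ck_on k W g) \<and> (\<forall>y\<in>A \<inter> W. g y = f y)"
  shows "smooth_on A f"
  unfolding smooth_on_def using assms by (rule ballI)

lemma smooth_on_local:
  assumes "\<And>x. x \<in> A \<Longrightarrow> \<exists>W. open W \<and> x \<in> W \<and> smooth_on (A \<inter> W) f"
  shows "smooth_on A f"
  unfolding smooth_on_def
proof
  fix x assume x: "x \<in> A"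
  then obtain W where W: "open W" "x \<in> W" "smooth_on (A \<inter> W) f" using assms by blast
  then obtain W' g where g: "open W'" "x \<in> W'" "\<And>k. Ck_on k W' g"
      "\<And>y. y \<in> A \<inter> W \<Longrightarrow> y \<in> W' \<Longrightarrow> g y = f y"
    using smooth_onE[of "A \<inter> W" f x] x by blast
  show "\<exists>W g. open W \<and> x \<in> W \<and> (\<forall>k. Ck_on k W g) \<and> (\<forall>y\<in>A \<inter> W. g y = f y)"
    using W g Ck_on_subset[of _ W' g "W \<inter> W'"]
    by (intro exI[of _ "W \<inter> W'"] exI[of _ g]) auto
qed

lemma smooth_on_local_openin:
  assumes "\<And>x. x \<in> A \<Longrightarrow> \<exists>B. openin (top_of_set A) B \<and> x \<in> B \<and> smooth_on B f"
  shows "smooth_on A f"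
proof (rule smooth_on_local)
  fix x assume "x \<in> A"
  then obtain B where "openin (top_of_set A) B" "x \<in> B" "smooth_on B f" using assms by blast
  then show "\<exists>W. open W \<and> x \<in> W \<and> smooth_on (A \<inter> W) f" by (auto simp: openin_open)
qed

lemma smooth_on_subset:
  assumes "smooth_on A f" "B \<subseteq> A" shows "smooth_on B f"
proof (rule smooth_onI)
  fix x assume x: "x \<in> B"
  then obtain W g where "open W" "x \<in> W" "\<And>k. Ck_on k W g" "\<And>y. y \<in> A \<Longrightarrow> y \<in> W \<Longrightarrow> g y = f y"
    using smooth_onE[OF assms(1), of x] assms(2) by blast
  then show "\<exists>W g. open W \<and> x \<in> W \<and> (\<forall>k. Ck_on k W g) \<and> (\<forall>y\<in>B \<inter> W. g y = f y)"
    using assms(2) by (intro exI[of _ W] exI[of _ g]) auto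
qed

lemma smooth_on_cong: "(\<And>x. x \<in> A \<Longrightarrow> f x = g x) \<Longrightarrow> smooth_on A f \<longleftrightarrow> smooth_on A g"
  unfolding smooth_on_def by simp

lemma smooth_onI_Ck:
  assumes "open W" "A \<subseteq> W" "\<And>k. Ck_on k W f"
  shows "smooth_on A f"
  using assms by (intro smooth_onI exI[of _ W] exI[of _ f]) auto

lemma smooth_on_const: "smooth_on A (\<lambda>x. c)"
  by (rule smooth_onI_Ck[of UNIV]) (auto intro: Ck_on_const)

lemma smooth_on_bounded_linear: "bounded_linear f \<Longrightarrow> smooth_on A f"
  by (rule smooth_onI_Ck[of UNIV]) (auto intro: Ck_on_bounded_linear)

lemma smooth_on_add:
  assumes "smooth_on A f" "smooth_on A g"
  shows "smooth_on A (\<lambda>x. f x + g x)"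
  unfolding smooth_on_def
proof
  fix x assume x: "x \<in> A"
  obtain W f' where f: "open W" "x \<in> W" "\<And>k. Ck_on k W f'" "\<And>y. y \<in> A \<Longrightarrow> y \<in> W \<Longrightarrow> f' y = f y"
    using smooth_onE[OF assms(1) x] by blast
  obtain V g' where g: "open V" "x \<in> V" "\<And>k. Ck_on k V g'" "\<And>y. y \<in> A \<Longrightarrow> y \<in> V \<Longrightarrow> g' y = g y"
    using smooth_onE[OF assms(2) x] by blast
  show "\<exists>W h. open W \<and> x \<in> W \<and> (\<forall>k. Ck_on k W h) \<and> (\<forall>y\<in>A \<inter> W. h y = f y + g y)"
    using f g Ck_on_subset[OF f(3), of "W \<inter> V"] Ck_on_subset[OF g(3), of "W \<inter> V"]
    by (intro exI[of _ "W \<inter> V"] exI[of _ "\<lambda>x. f' x + g' x"]) (auto intro!: Ck_on_add)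
qed

lemma (in bounded_bilinear) smooth_on_prod:
  assumes "smooth_on A f" "smooth_on A g"
  shows "smooth_on A (\<lambda>x. prod (f x) (g x))"
  unfolding smooth_on_def
proof
  fix x assume x: "x \<in> A"
  obtain W f' where f: "open W" "x \<in> W" "\<And>k. Ck_on k W f'" "\<And>y. y \<in> A \<Longrightarrow> y \<in> W \<Longrightarrow> f' y = f y"
    using smooth_onE[OF assms(1) x] by blast
  obtain V g' where g: "open V" "x \<in> V" "\<And>k. Ck_on k V g'" "\<And>y. y \<in> A \<Longrightarrow> y \<in> V \<Longrightarrow> g' y = g y"
    using smooth_onE[OF assms(2) x] by blast
  show "\<exists>W h. open W \<and> x \<in> W \<and> (\<forall>k. Ck_on k W h) \<and> (\<forall>y\<in>A \<inter> W. h y = prod (f y) (g y))"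
    using f g Ck_on_subset[OF f(3), of "W \<inter> V"] Ck_on_subset[OF g(3), of "W \<inter> V"]
    by (intro exI[of _ "W \<inter> V"] exI[of _ "\<lambda>x. prod (f' x) (g' x)"]) (auto intro!: Ck_on_prod)
qed

lemmas smooth_on_mult = bounded_bilinear.smooth_on_prod[OF bounded_bilinear_mult]
lemmas smooth_on_inner = bounded_bilinear.smooth_on_prod[OF bounded_bilinear_inner]

lemma smooth_on_sum:
  "(\<And>i. i \<in> I \<Longrightarrow> smooth_on A (f i)) \<Longrightarrow> smooth_on A (\<lambda>x. \<Sum>i\<in>I. f i x)"
  by (induction I rule: infinite_finite_induct) (auto intro: smooth_on_const smooth_on_add)

lemma smooth_on_prod_family:
  fixes f :: "'i \<Rightarrow> 'a::euclidean_space \<Rightarrow> real"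
  shows "(\<And>i. i \<in> I \<Longrightarrow> smooth_on A (f i)) \<Longrightarrow> smooth_on A (\<lambda>x. \<Prod>i\<in>I. f i x)"
  by (induction I rule: infinite_finite_induct) (auto intro: smooth_on_const smooth_on_mult)

lemma smooth_on_imp_continuous_on: assumes "smooth_on A f" shows "continuous_on A f"
proof (clarsimp simp: continuous_on_eq_continuous_within)
  fix x assume x: "x \<in> A"
  obtain W g where g: "open W" "x \<in> W" "\<And>k. Ck_on k W g" "\<And>y. y \<in> A \<Longrightarrow> y \<in> W \<Longrightarrow> g y = f y"
    using smooth_onE[OF assms(1) x] by blast
  have "continuous_on W g" using g(3)[of 0] by simp
  then have "continuous (at x within A) g"
    using g(1,2) continuous_on_eq_continuous_at continuous_at_imp_continuous_within by blast
  then show "continuous (at x within A) f"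
    by (rule continuous_transform_within_openin[OF _ openin_open_Int[OF g(1)]])
       (use x g(2,4) in auto)
qed

lemma smooth_on_compose:
  fixes f :: "'a::euclidean_space \<Rightarrow> 'b::euclidean_space"
  assumes "smooth_on A f" "smooth_on B h" "f ` A \<subseteq> B"
  shows "smooth_on A (\<lambda>x. h (f x))"
  unfolding smooth_on_def
proof
  fix x assume x: "x \<in> A"
  obtain W g where g: "open W" "x \<in> W" "\<And>k. Ck_on k W g" "\<And>y. y \<in> A \<Longrightarrow> y \<in> W \<Longrightarrow> g y = f y"
    using smooth_onE[OF assms(1) x] by blast
  have "f x \<in> B" using x assms(3) by blast
  then obtain V h' where h: "open V" "f x \<in> V" "\<And>k. Ck_on k V h'" "\<And>y. y \<in> B \<Longrightarrow> y \<in> V \<Longrightarrow> h' y = h y"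
    using smooth_onE[OF assms(2)] by metis
  define U where "U = W \<inter> g -` V"
  have "continuous_on W g" using g(3)[of 0] by simp
  then have U: "open U" unfolding U_def
    by (simp add: continuous_on_open_vimage g(1) h(1) Int_commute)
  have "Ck_on k U (\<lambda>x. h' (g x))" for k
    by (rule Ck_on_compose[OF U h(1) _ Ck_on_subset[OF g(3)] h(3)]) (auto simp: U_def)
  moreover have "x \<in> U" using x g h unfolding U_def by auto
  moreover have "\<forall>y\<in>A \<inter> U. h' (g y) = h (f y)"
    using g h assms(3) unfolding U_def by auto
  ultimately show "\<exists>W g. open W \<and> x \<in> W \<and> (\<forall>k. Ck_on k W g) \<and> (\<forall>y\<in>A \<inter> W. g y = h (f y))"
    using U by (intro exI[of _ U] exI[of _ "\<lambda>x. h' (g x)"]) auto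
qed

lemma smooth_on_inverse:
  fixes f :: "'a::euclidean_space \<Rightarrow> real"
  assumes "smooth_on A f" "\<And>x. x \<in> A \<Longrightarrow> f x \<noteq> 0"
  shows "smooth_on A (\<lambda>x. inverse (f x))"
  by (rule smooth_on_compose[OF assms(1), of "- {0}"])
     (use assms(2) in \<open>auto intro!: smooth_onI_Ck[of "- {0}"] Ck_on_inverse\<close>)

lemma smooth_on_has_derivative:
  assumes "smooth_on A f" "x \<in> A"
  shows "(f has_derivative frechet_derivative f (at x within A)) (at x within A)"
proof -
  obtain W g where g: "open W" "x \<in> W" "\<And>k. Ck_on k W g" "\<And>y. y \<in> A \<Longrightarrow> y \<in> W \<Longrightarrow> g y = f y"
    using smooth_onE[OF assms] by blast
  have "g differentiable (at x)"
    using g(3)[of "Suc 0"] g(1,2) at_within_open[OF g(2,1)] unfolding Ck_on.simps differentiable_on_def by metis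
  then have "(g has_derivative frechet_derivative g (at x)) (at x within A)"
    by (simp add: frechet_derivative_works has_derivative_at_withinI)
  then have "(f has_derivative frechet_derivative g (at x)) (at x within A)"
    using g(1,2) openE
    by (smt (verit, ccfv_threshold) assms(2) g(4) has_derivative_transform_within mem_ball dist_commute subset_eq)
  then show ?thesis using frechet_derivative_works differentiable_def by blast
qed

lemma smooth_on_open_imp_Ck_on:
  assumes "open S" "smooth_on S f"
  shows "Ck_on k S f"
proof (rule Ck_on_local[OF assms(1)])
  fix x assume x: "x \<in> S"
  obtain W g where W: "open W" "x \<in> W" "\<And>k. Ck_on k W g" "\<And>y. y \<in> S \<Longrightarrow> y \<in> W \<Longrightarrow> g y = f y"
    using smooth_onE[OF assms(2) x] by blast
  have "Ck_on k (W \<inter> S) f"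
    by (rule Ck_on_cong[of _ g]) (use W assms(1) Ck_on_subset[OF W(3)] in auto)
  then show "\<exists>W. open W \<and> x \<in> W \<and> Ck_on k W f"
    using W x assms(1) by (intro exI[of _ "W \<inter> S"]) auto
qed

section \<open>Uniqueness and symmetry of derivatives\<close>

text \<open>A condition under which derivatives within a set are unique. Half-spaces of positive dimension and
  relatively open subsets of fat sets satisfy it, hence so do all chart images in positive dimension.\<close>

definition fat :: "'a::euclidean_space set \<Rightarrow> bool"
  where "fat S \<longleftrightarrow> (\<forall>x\<in>S. \<forall>i\<in>Basis. \<forall>e>0. \<exists>d. 0 < \<bar>d\<bar> \<and> \<bar>d\<bar> < e \<and> x + d *\<^sub>R i \<in> S)"

lemma fat_derivative_unique:
  assumes "fat S" "x \<in> S" "(f has_derivative f') (at x within S)" "(f has_derivative f'') (at x within S)"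
  shows "f' = f''"
  using assms(1,2) unfolding fat_def
  by (intro frechet_derivative_unique_within[OF assms(3,4)]) blast

lemma fat_frechet_derivative:
  assumes "fat S" "x \<in> S" "(f has_derivative f') (at x within S)"
  shows "frechet_derivative f (at x within S) = f'"
  using fat_derivative_unique[OF assms(1,2) _ assms(3)] assms(3) frechet_derivative_works differentiable_def
  by metis

lemma fat_openin:
  assumes "fat A" "openin (top_of_set A) S"
  shows "fat S"
  unfolding fat_def
proof (intro ballI allI impI)
  fix x i and e :: real assume *: "x \<in> S" "i \<in> (Basis :: 'a set)" "e > 0"
  obtain r where r: "r > 0" "ball x r \<inter> A \<subseteq> S" "S \<subseteq> A"
    using assms(2) *(1) openin_contains_ball by metis
  have "x \<in> A" using * r by blast
  then obtain d where "0 < \<bar>d\<bar>" "\<bar>d\<bar> < min e r" "x + d *\<^sub>R i \<in> A"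
    using assms(1) * r(1) unfolding fat_def by (metis min_less_iff_conj)
  moreover have "x + d *\<^sub>R i \<in> ball x r" using calculation *(2) by (simp add: dist_norm)
  ultimately show "\<exists>d. 0 < \<bar>d\<bar> \<and> \<bar>d\<bar> < e \<and> x + d *\<^sub>R i \<in> S" using r by auto
qed

lemma fat_UNIV: "fat UNIV"
  unfolding fat_def
proof (intro ballI allI impI)
  fix x i :: 'a and e :: real assume "e > 0"
  then show "\<exists>d. 0 < \<bar>d\<bar> \<and> \<bar>d\<bar> < e \<and> x + d *\<^sub>R i \<in> UNIV"
    by (intro exI[of _ "e / 2"]) auto
qed

lemma fat_open: "open S \<Longrightarrow> fat S"
  by (rule fat_openin[OF fat_UNIV]) simp

lemma fat_Times: "fat A \<Longrightarrow> fat B \<Longrightarrow> fat (A \<times> B)"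
  unfolding fat_def Basis_prod_def by (fastforce simp: scaleR_prod_def)

lemma fat_half_space: "n \<noteq> 0 \<Longrightarrow> fat (half_space n :: ('n::{finite,wellorder} rn) set)"
  unfolding fat_def half_space_def coord_space_def
proof (intro ballI allI impI)
  fix x i :: "'n rn" and e :: real assume "n \<noteq> 0" and *: "x \<in> {x \<in> if n = 0 then {0} else UNIV. 0 \<le> x $ Max UNIV}"
    "i \<in> (Basis :: 'n rn set)" "e > 0"
  then have "0 \<le> i $ Max UNIV" by (auto simp: Basis_vec_def axis_def)
  then have "0 \<le> (x + (e / 2) *\<^sub>R i) $ Max UNIV" using * by simp
  then show "\<exists>d. 0 < \<bar>d\<bar> \<and> \<bar>d\<bar> < e \<and>
      x + d *\<^sub>R i \<in> {x \<in> if n = 0 then {0} else UNIV. 0 \<le> x $ Max UNIV}"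
    using * \<open>n \<noteq> 0\<close> by (intro exI[of _ "e / 2"]) auto
qed

text \<open>Uniqueness of derivatives within \<open>A\<close> makes the derivative of \<open>f\<close> agree with that of every smooth local
  extension.\<close>

lemma smooth_on_derivative:
  assumes "fat A" "smooth_on A f"
  shows "smooth_on A (\<lambda>x. frechet_derivative f (at x within A) v)"
  unfolding smooth_on_def
proof
  fix x assume x: "x \<in> A"
  obtain W g where g: "open W" "x \<in> W" "\<And>k. Ck_on k W g" "\<And>y. y \<in> A \<Longrightarrow> y \<in> W \<Longrightarrow> g y = f y"
    using smooth_onE[OF assms(2) x] by blast
  have "frechet_derivative g (at y) v = frechet_derivative f (at y within A) v" if y: "y \<in> A \<inter> W" for y
  proof -
    have "(g has_derivative frechet_derivative g (at y)) (at y)"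
      using Ck_on_SucE[OF g(1) g(3)[of "Suc 0"]] y by (metis IntD2)
    then have "(g has_derivative frechet_derivative g (at y)) (at y within A \<inter> W)"
      by (rule has_derivative_at_withinI)
    then have 1: "(f has_derivative frechet_derivative g (at y)) (at y within A \<inter> W)"
      using g(4) y by (intro has_derivative_transform[of y "A \<inter> W" f g]) auto
    have 2: "(f has_derivative frechet_derivative f (at y within A)) (at y within A \<inter> W)"
      using smooth_on_has_derivative[OF assms(2), of y] y by (meson IntD1 Int_lower1 has_derivative_subset)
    have "fat (A \<inter> W)" using fat_openin[OF assms(1) openin_open_Int[OF g(1)]] .
    then show ?thesis using fat_derivative_unique[OF _ y 1 2] by simp
  qed
  moreover have "Ck_on k W (\<lambda>x. frechet_derivative g (at x) v)" for k
    using g(3)[of "Suc k"] by simp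
  ultimately show "\<exists>W g. open W \<and> x \<in> W \<and> (\<forall>k. Ck_on k W g) \<and>
      (\<forall>y\<in>A \<inter> W. g y = frechet_derivative f (at y within A) v)"
    using g(1,2) by (intro exI[of _ W] exI[of _ "\<lambda>x. frechet_derivative g (at x) v"]) auto
qed

lemma derivative_zero_openin:
  assumes "fat A" "smooth_on A f" "openin (top_of_set A) B" "x \<in> B" "\<And>y. y \<in> B \<Longrightarrow> f y = 0"
  shows "frechet_derivative f (at x within A) = (\<lambda>u. 0)"
proof -
  have sub: "B \<subseteq> A" using assms(3) openin_imp_subset by blast
  have "(f has_derivative frechet_derivative f (at x within A)) (at x within B)"
    by (rule has_derivative_subset[OF smooth_on_has_derivative[OF assms(2)] sub]) (use assms(4) sub in blast)
  moreover have "(f has_derivative (\<lambda>u. 0)) (at x within B)"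
    by (rule has_derivative_transform[OF assms(4) _ has_derivative_const[of 0]]) (rule assms(5))
  ultimately show ?thesis by (rule fat_derivative_unique[OF fat_openin[OF assms(1,3)] assms(4)])
qed

lemma has_derivative_frechet_derivative:
  "(f has_derivative f') net \<Longrightarrow> (f has_derivative frechet_derivative f net) net"
  unfolding frechet_derivative_def by (rule someI[where P = "\<lambda>f'. (f has_derivative f') net"])

lemma smooth_on_insert_time: "smooth_on A (\<lambda>x :: 'a::euclidean_space. (0 :: real, x))"
  using bounded_linear_Pair[OF bounded_linear_zero bounded_linear_ident]
  by (rule smooth_on_bounded_linear)

lemma has_real_derivative_along_line:
  fixes f :: "'a::real_normed_vector \<Rightarrow> real"
  assumes "(f has_derivative f') (at (z + a *\<^sub>R u))"
  shows "((\<lambda>a. f (z + a *\<^sub>R u)) has_real_derivative f' u) (at a)"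
proof -
  have "((\<lambda>a. z + a *\<^sub>R u) has_derivative (\<lambda>h. h *\<^sub>R u)) (at a)"
    by (auto intro!: derivative_eq_intros)
  then have "((\<lambda>a. f (z + a *\<^sub>R u)) has_derivative (\<lambda>h. f' (h *\<^sub>R u))) (at a)"
    using has_derivative_compose[of "\<lambda>a. z + a *\<^sub>R u" _ a UNIV f f'] assms by simp
  moreover have "(\<lambda>h. f' (h *\<^sub>R u)) = (*) (f' u)"
    using linear_scale[OF has_derivative_linear[OF assms]] by (auto simp: fun_eq_iff)
  ultimately show ?thesis by (simp add: has_field_derivative_def)
qed

text \<open>The mean value theorem, applied first along \<open>u\<close> and then along \<open>v\<close>, expresses the second
  difference, which is symmetric in \<open>u\<close> and \<open>v\<close>, by a mixed second derivative.\<close>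

lemma second_difference_mvt:
  fixes f :: "'a::euclidean_space \<Rightarrow> real"
  assumes "open W" "Ck_on 2 W f" "s > 0"
    and W: "\<And>a b. 0 \<le> a \<Longrightarrow> a \<le> s \<Longrightarrow> 0 \<le> b \<Longrightarrow> b \<le> s \<Longrightarrow> z + a *\<^sub>R u + b *\<^sub>R v \<in> W"
  obtains a b where "0 < a" "a < s" "0 < b" "b < s"
    "f (z + s *\<^sub>R u + s *\<^sub>R v) - f (z + s *\<^sub>R u) - f (z + s *\<^sub>R v) + f z =
     s * (s * frechet_derivative (\<lambda>y. frechet_derivative f (at y) u) (at (z + a *\<^sub>R u + b *\<^sub>R v)) v)"
proof -
  define f' where "f' = (\<lambda>y. frechet_derivative f (at y))"
  define f'' where "f'' = (\<lambda>y. frechet_derivative (\<lambda>y. f' y u) (at y))"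
  have C: "Ck_on (Suc (Suc 0)) W f" using assms(2) by (simp add: numeral_2_eq_2)
  have f': "(f has_derivative f' y) (at y)" if "y \<in> W" for y
    using Ck_on_SucE[OF assms(1) C] that unfolding f'_def by metis
  have f'': "((\<lambda>y. f' y u) has_derivative f'' y) (at y)" if "y \<in> W" for y
  proof -
    have "Ck_on (Suc 0) W (\<lambda>y. f' y u)" using C unfolding f'_def by (metis Ck_on.simps(2))
    then show ?thesis
      using Ck_on_SucE[OF assms(1)] that unfolding f''_def by metis
  qed
  define \<phi> where "\<phi> = (\<lambda>a. f ((z + s *\<^sub>R v) + a *\<^sub>R u) - f (z + a *\<^sub>R u))"
  have "(\<phi> has_real_derivative f' ((z + s *\<^sub>R v) + a *\<^sub>R u) u - f' (z + a *\<^sub>R u) u) (at a)"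
    if "0 \<le> a" "a \<le> s" for a
    unfolding \<phi>_def
  proof (rule DERIV_diff)
    have "z + s *\<^sub>R v + a *\<^sub>R u \<in> W" "z + a *\<^sub>R u \<in> W"
      using W[of a s] W[of a 0] that \<open>s > 0\<close> by (auto simp: add.commute add.left_commute)
    then show "((\<lambda>a. f (z + s *\<^sub>R v + a *\<^sub>R u)) has_real_derivative f' (z + s *\<^sub>R v + a *\<^sub>R u) u) (at a)"
      "((\<lambda>a. f (z + a *\<^sub>R u)) has_real_derivative f' (z + a *\<^sub>R u) u) (at a)"
      by (blast intro: has_real_derivative_along_line[OF f'])+
  qed
  then obtain a where a: "0 < a" "a < s"
    "\<phi> s - \<phi> 0 = (s - 0) * (f' ((z + s *\<^sub>R v) + a *\<^sub>R u) u - f' (z + a *\<^sub>R u) u)"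
    using MVT2[of 0 s \<phi> "\<lambda>a. f' ((z + s *\<^sub>R v) + a *\<^sub>R u) u - f' (z + a *\<^sub>R u) u"] \<open>s > 0\<close> by blast
  have "((\<lambda>b. f' (z + a *\<^sub>R u + b *\<^sub>R v) u) has_real_derivative f'' (z + a *\<^sub>R u + b *\<^sub>R v) v) (at b)"
    if "0 \<le> b" "b \<le> s" for b
    by (intro has_real_derivative_along_line[where f = "\<lambda>y. f' y u"] f'' W) (use a that in auto)
  then obtain b where b: "0 < b" "b < s"
    "f' (z + a *\<^sub>R u + s *\<^sub>R v) u - f' (z + a *\<^sub>R u + 0 *\<^sub>R v) u = (s - 0) * f'' (z + a *\<^sub>R u + b *\<^sub>R v) v"
    using MVT2[of 0 s "\<lambda>b. f' (z + a *\<^sub>R u + b *\<^sub>R v) u" "\<lambda>b. f'' (z + a *\<^sub>R u + b *\<^sub>R v) v"]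
      \<open>s > 0\<close> by blast
  have "f (z + s *\<^sub>R u + s *\<^sub>R v) - f (z + s *\<^sub>R u) - f (z + s *\<^sub>R v) + f z = \<phi> s - \<phi> 0"
    unfolding \<phi>_def by (simp add: algebra_simps)
  also have "\<dots> = s * (s * f'' (z + a *\<^sub>R u + b *\<^sub>R v) v)"
    using a(3) b(3) by (simp add: algebra_simps)
  finally show thesis
    using that[OF a(1,2) b(1,2)] unfolding f''_def f'_def by blast
qed

text \<open>Both orders of differentiation give the same second differences up to the choice of an
  intermediate point, and the intermediate points tend to \<open>z\<close>.\<close>

lemma second_derivative_symmetric_real:
  fixes f :: "'a::euclidean_space \<Rightarrow> real"
  assumes "open W" "Ck_on 2 W f" "z \<in> W"
  shows "frechet_derivative (\<lambda>y. frechet_derivative f (at y) u) (at z) v =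
    frechet_derivative (\<lambda>y. frechet_derivative f (at y) v) (at z) u"
proof -
  define q where "q = (\<lambda>u v y. frechet_derivative (\<lambda>y. frechet_derivative f (at y) u) (at y) v)"
  have cont: "isCont (q u v) z" for u v
    using assms unfolding q_def
    by (simp add: numeral_2_eq_2 continuous_on_eq_continuous_at)
  have "\<bar>q u v z - q v u z\<bar> < e" if "e > 0" for e
  proof -
    obtain d1 where d1: "d1 > 0" "\<And>y. dist y z < d1 \<Longrightarrow> dist (q u v y) (q u v z) < e / 2"
      using cont[of u v] \<open>e > 0\<close> unfolding continuous_at_eps_delta by (metis half_gt_zero)
    obtain d2 where d2: "d2 > 0" "\<And>y. dist y z < d2 \<Longrightarrow> dist (q v u y) (q v u z) < e / 2"
      using cont[of v u] \<open>e > 0\<close> unfolding continuous_at_eps_delta by (metis half_gt_zero)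
    obtain r where r: "r > 0" "ball z r \<subseteq> W" using assms(1,3) openE by blast
    define d where "d = min (min d1 d2) r"
    (* so small that the whole parallelogram stays within distance d of z *)
    define s where "s = d / (2 * (norm u + norm v + 1))"
    have pos: "norm u + norm v + 1 > 0" by (simp add: add_nonneg_pos)
    have "d > 0" using d1 d2 r unfolding d_def by simp
    then have "s > 0" using pos unfolding s_def by simp
    have near: "dist (z + a *\<^sub>R u + b *\<^sub>R v) z < d" if "0 \<le> a" "a \<le> s" "0 \<le> b" "b \<le> s" for a b
    proof -
      have "dist (z + a *\<^sub>R u + b *\<^sub>R v) z = norm (a *\<^sub>R u + b *\<^sub>R v)" by (simp add: dist_norm)
      also have "\<dots> \<le> a * norm u + b * norm v"
        using norm_triangle_ineq[of "a *\<^sub>R u" "b *\<^sub>R v"] that by simp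
      also have "\<dots> \<le> s * norm u + s * norm v" using that by (intro add_mono mult_right_mono) auto
      also have "\<dots> < s * (2 * (norm u + norm v + 1))"
        using \<open>s > 0\<close> pos norm_ge_zero[of u] norm_ge_zero[of v] by (simp add: algebra_simps add_nonneg_pos)
      also have "\<dots> = d" using pos unfolding s_def by simp
      finally show ?thesis .
    qed
    have in1: "z + a *\<^sub>R u + b *\<^sub>R v \<in> W" if "0 \<le> a" "a \<le> s" "0 \<le> b" "b \<le> s" for a b
      using near[OF that] r(2) unfolding d_def by (auto simp: dist_commute)
    then have in2: "z + a *\<^sub>R v + b *\<^sub>R u \<in> W" if "0 \<le> a" "a \<le> s" "0 \<le> b" "b \<le> s" for a b
      using in1[of b a] that by (simp add: add.commute add.left_commute)
    obtain a b where 1: "0 < a" "a < s" "0 < b" "b < s"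
      "f (z + s *\<^sub>R u + s *\<^sub>R v) - f (z + s *\<^sub>R u) - f (z + s *\<^sub>R v) + f z =
       s * (s * q u v (z + a *\<^sub>R u + b *\<^sub>R v))"
      unfolding q_def by (rule second_difference_mvt[OF assms(1,2) \<open>s > 0\<close> in1])
    obtain a' b' where 2: "0 < a'" "a' < s" "0 < b'" "b' < s"
      "f (z + s *\<^sub>R v + s *\<^sub>R u) - f (z + s *\<^sub>R v) - f (z + s *\<^sub>R u) + f z =
       s * (s * q v u (z + a' *\<^sub>R v + b' *\<^sub>R u))"
      unfolding q_def by (rule second_difference_mvt[OF assms(1,2) \<open>s > 0\<close> in2])
    have "s * (s * q u v (z + a *\<^sub>R u + b *\<^sub>R v)) = s * (s * q v u (z + a' *\<^sub>R v + b' *\<^sub>R u))"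
    proof -
      have c: "z + s *\<^sub>R u + s *\<^sub>R v = z + s *\<^sub>R v + s *\<^sub>R u" by simp
      show ?thesis using 1(5) 2(5) unfolding c by linarith
    qed
    then have eq: "q u v (z + a *\<^sub>R u + b *\<^sub>R v) = q v u (z + b' *\<^sub>R u + a' *\<^sub>R v)"
      using \<open>s > 0\<close> by (simp add: add.commute add.left_commute)
    have "dist (q u v (z + a *\<^sub>R u + b *\<^sub>R v)) (q u v z) < e / 2"
      using near[of a b] 1 d1(2) unfolding d_def by simp
    moreover have "dist (q v u (z + b' *\<^sub>R u + a' *\<^sub>R v)) (q v u z) < e / 2"
      using near[of b' a'] 2 d2(2) unfolding d_def by simp
    ultimately show ?thesis using eq unfolding dist_real_def by linarith
  qed
  from this[of "\<bar>q u v z - q v u z\<bar>"] have "q u v z = q v u z" by fastforce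
  then show ?thesis unfolding q_def .
qed

lemma second_derivative_symmetric:
  fixes f :: "'a::euclidean_space \<Rightarrow> 'b::euclidean_space"
  assumes "open W" "Ck_on 2 W f" "z \<in> W"
  shows "frechet_derivative (\<lambda>y. frechet_derivative f (at y) u) (at z) v =
    frechet_derivative (\<lambda>y. frechet_derivative f (at y) v) (at z) u"
proof (rule euclidean_eqI)
  fix b :: 'b assume "b \<in> Basis"
  have C: "Ck_on (Suc (Suc 0)) W f" using assms(2) by (simp add: numeral_2_eq_2)
  have 1: "frechet_derivative (\<lambda>y. f y \<bullet> b) (at y) u = frechet_derivative f (at y) u \<bullet> b"
    if "y \<in> W" for y u
  proof -
    have "(f has_derivative frechet_derivative f (at y)) (at y)"
      using Ck_on_SucE[OF assms(1) C] that by metis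
    then show ?thesis using frechet_derivative_at[OF has_derivative_inner_left] by metis
  qed
  have 2: "frechet_derivative (\<lambda>y. frechet_derivative (\<lambda>y. f y \<bullet> b) (at y) u) (at z) v =
      frechet_derivative (\<lambda>y. frechet_derivative f (at y) u) (at z) v \<bullet> b" for u v
  proof -
    have "Ck_on (Suc 0) W (\<lambda>y. frechet_derivative f (at y) u)" using C by (metis Ck_on.simps(2))
    then have "((\<lambda>y. frechet_derivative f (at y) u) has_derivative
        frechet_derivative (\<lambda>y. frechet_derivative f (at y) u) (at z)) (at z)"
      using Ck_on_SucE[OF assms(1) _] assms(3) by metis
    then have "((\<lambda>y. frechet_derivative f (at y) u \<bullet> b) has_derivative
        (\<lambda>v. frechet_derivative (\<lambda>y. frechet_derivative f (at y) u) (at z) v \<bullet> b)) (at z)"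
      by (rule has_derivative_inner_left)
    then have "((\<lambda>y. frechet_derivative (\<lambda>y. f y \<bullet> b) (at y) u) has_derivative
        (\<lambda>v. frechet_derivative (\<lambda>y. frechet_derivative f (at y) u) (at z) v \<bullet> b)) (at z)"
      by (rule has_derivative_transform_within_open[OF _ assms(1,3)]) (simp add: 1)
    then show ?thesis using frechet_derivative_at by metis
  qed
  have "Ck_on 2 W (\<lambda>y. f y \<bullet> b)"
    using bounded_bilinear.Ck_on_prod[OF bounded_bilinear_inner assms(1,2) Ck_on_const[OF assms(1)]] .
  then show "frechet_derivative (\<lambda>y. frechet_derivative f (at y) u) (at z) v \<bullet> b =
      frechet_derivative (\<lambda>y. frechet_derivative f (at y) v) (at z) u \<bullet> b"
    using second_derivative_symmetric_real[OF assms(1) _ assms(3)] 2 by metis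
qed

text \<open>The powers of \<open>1 / x\<close> are included to obtain a family that is closed under differentiation.\<close>

definition flat_exp :: "nat \<Rightarrow> real \<Rightarrow> real"
  where "flat_exp n x = (if 0 < x then inverse x ^ n * exp (- inverse x) else 0)"

lemma flat_exp_tendsto_0: "(flat_exp n \<longlongrightarrow> 0) (at 0)"
proof -
  have "((\<lambda>y. y ^ n / exp y) \<longlongrightarrow> 0) (at_top :: real filter)" by (rule tendsto_power_div_exp_0)
  then have "((\<lambda>x. inverse x ^ n / exp (inverse x)) \<longlongrightarrow> 0) (at_right (0::real))"
    by (rule filterlim_compose) (rule filterlim_inverse_at_top_right)
  then have "(flat_exp n \<longlongrightarrow> 0) (at_right 0)"
    by (rule Lim_transform_eventually)
       (auto simp: eventually_at_right_field flat_exp_def exp_minus divide_inverse intro: exI[of _ 1])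
  moreover have "(flat_exp n \<longlongrightarrow> 0) (at_left 0)"
    by (rule Lim_transform_eventually[OF tendsto_const])
       (auto simp: eventually_at_left_field flat_exp_def intro: exI[of _ "-1"])
  ultimately show ?thesis by (simp add: filterlim_split_at)
qed

lemma flat_exp_has_derivative:
  "(flat_exp n has_real_derivative flat_exp (Suc (Suc n)) x - n * flat_exp (Suc n) x) (at x)"
proof -
  consider "x > 0" | "x < 0" | "x = 0" by linarith
  then show ?thesis
  proof cases
    case 1
    have "((\<lambda>x. inverse x ^ n * exp (- inverse x)) has_real_derivative
       flat_exp (Suc (Suc n)) x - n * flat_exp (Suc n) x) (at x)"
    proof -
      have "real n * (- (inverse x * inverse x)) * inverse x ^ (n - 1) = - (real n * inverse x ^ Suc n)"
        by (cases n) auto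
      then show ?thesis
        using 1 by (auto intro!: derivative_eq_intros simp: flat_exp_def algebra_simps)
    qed
    then show ?thesis
      by (rule has_field_derivative_transform_within_open[of _ _ _ "{0<..}"]) (use 1 in \<open>auto simp: flat_exp_def\<close>)
  next
    case 2
    have "((\<lambda>x. 0) has_real_derivative flat_exp (Suc (Suc n)) x - n * flat_exp (Suc n) x) (at x)"
      using 2 by (simp add: flat_exp_def)
    then show ?thesis
      by (rule has_field_derivative_transform_within_open[of _ _ _ "{..<0}"]) (use 2 in \<open>auto simp: flat_exp_def\<close>)
  next
    case 3
    have "(\<lambda>h. (flat_exp n (0 + h) - flat_exp n 0) / h) = flat_exp (Suc n)"
      by (auto simp: fun_eq_iff flat_exp_def divide_inverse)
    then have "(flat_exp n has_real_derivative 0) (at 0)"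
      using flat_exp_tendsto_0[of "Suc n"] unfolding DERIV_def by simp
    then show ?thesis using 3 by (simp add: flat_exp_def)
  qed
qed

text \<open>The functions \<open>flat_exp n\<close> are closed under differentiation up to linear combinations, so
  that smoothness follows by induction for all \<open>n\<close> at once.\<close>

lemma Ck_on_flat_exp: "Ck_on k UNIV (flat_exp n)"
proof (induction k arbitrary: n)
  case 0
  then show ?case
    using DERIV_isCont[OF flat_exp_has_derivative] by (auto simp: continuous_on_eq_continuous_at)
next
  case (Suc k)
  let ?D = "\<lambda>x v. (flat_exp (Suc (Suc n)) x + - n * flat_exp (Suc n) x) * v"
  have "Ck_on k UNIV (\<lambda>x. ?D x v)" for v
    by (intro Ck_on_add bounded_bilinear.Ck_on_prod[OF bounded_bilinear_mult] Ck_on_const Suc) auto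
  moreover have "(flat_exp n has_derivative ?D x) (at x)" for x
    using flat_exp_has_derivative[of n x] by (simp add: has_field_derivative_def)
  ultimately show ?case by (intro Ck_on_SucI[where f' = ?D]) auto
qed

section \<open>Alternating forms\<close>

lemma alternating_form_cong:
  "alternating_form k T a \<Longrightarrow> (\<And>i. i < k \<Longrightarrow> v i = w i) \<Longrightarrow> a v = a w"
  unfolding alternating_form_def by blast

lemma alternating_form_linear:
  assumes "alternating_form k T a" "\<And>i. i < k \<Longrightarrow> v i \<in> T" "j < k" "x \<in> T" "y \<in> T"
  shows "a (v(j := r *\<^sub>R x + s *\<^sub>R y)) = r * a (v(j := x)) + s * a (v(j := y))"
  using assms unfolding alternating_form_def by blast

lemma alternating_form_repeated:
  assumes "alternating_form k T a" "\<And>i. i < k \<Longrightarrow> v i \<in> T" "i < k" "j < k" "i \<noteq> j" "v i = v j"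
  shows "a v = 0"
  using assms unfolding alternating_form_def by blast

lemma alternating_form_zero:
  assumes "alternating_form k T a" "\<And>i. i < k \<Longrightarrow> v i \<in> T" "j < k" "v j = 0"
  shows "a v = 0"
proof -
  have "a (v(j := 0 *\<^sub>R v j + 0 *\<^sub>R v j)) = 0 * a (v(j := v j)) + 0 * a (v(j := v j))"
    by (rule alternating_form_linear[OF assms(1,2,3)]) (use assms(2,3) in auto)
  moreover have "v(j := 0 *\<^sub>R v j + 0 *\<^sub>R v j) = v" using assms(4) by (simp add: fun_upd_idem)
  ultimately show ?thesis by simp
qed

lemma alternating_form_sum:
  assumes a: "alternating_form k T a" and T: "subspace T" and v: "\<And>i. i < k \<Longrightarrow> v i \<in> T"
    and j: "j < k" and "finite I" "\<And>i. i \<in> I \<Longrightarrow> w i \<in> T"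
  shows "a (v(j := \<Sum>i\<in>I. c i *\<^sub>R w i)) = (\<Sum>i\<in>I. c i * a (v(j := w i)))"
  using assms(5,6)
proof (induction I)
  case empty
  have "a (v(j := 0)) = 0"
    using alternating_form_zero[OF a, of "v(j := 0)" j] v j subspace_0[OF T] by auto
  then show ?case by (simp add: fun_upd_def)
next
  case (insert i I)
  have "(\<Sum>i\<in>I. c i *\<^sub>R w i) \<in> T"
    using insert.prems by (intro subspace_sum[OF T] subspace_scale[OF T]) auto
  then have "a (v(j := c i *\<^sub>R w i + 1 *\<^sub>R (\<Sum>i\<in>I. c i *\<^sub>R w i))) =
      c i * a (v(j := w i)) + 1 * a (v(j := \<Sum>i\<in>I. c i *\<^sub>R w i))"
    using insert.prems by (intro alternating_form_linear[OF a v j]) auto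
  then show ?case using insert by (simp add: fun_upd_def)
qed

lemma alternating_form_swap:
  assumes a: "alternating_form k T a" and T: "subspace T" and v: "\<And>i. i < k \<Longrightarrow> v i \<in> T"
    and ij: "i < k" "j < k" "i \<noteq> j" and xy: "x \<in> T" "y \<in> T"
  shows "a (v(i := x, j := y)) = - a (v(i := y, j := x))"
proof -
  have sum_in: "x + y \<in> T" using T xy by (simp add: subspace_add)
  have lin: "a (u(l := x + y)) = a (u(l := x)) + a (u(l := y))" if "l < k" "\<And>i. i < k \<Longrightarrow> u i \<in> T" for u l
    using alternating_form_linear[where v = u and j = l and r = 1 and s = 1, OF a that(2,1) xy] by simp
  have rep: "a (v(i := z, j := z)) = 0" if "z \<in> T" for z
    by (rule alternating_form_repeated[OF a _ ij]) (use v ij that in auto)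
  have "0 = a (v(i := x + y, j := x + y))" using rep[OF sum_in] by simp
  also have "\<dots> = a (v(i := x + y, j := x)) + a (v(i := x + y, j := y))"
    by (rule lin) (use v ij sum_in in auto)
  also have "a (v(i := x + y, j := x)) = a (v(j := x, i := x + y))"
    using ij by (simp add: fun_upd_twist)
  also have "\<dots> = a (v(j := x, i := x)) + a (v(j := x, i := y))"
    by (rule lin) (use v ij xy in auto)
  also have "a (v(i := x + y, j := y)) = a (v(j := y, i := x + y))"
    using ij by (simp add: fun_upd_twist)
  also have "\<dots> = a (v(j := y, i := x)) + a (v(j := y, i := y))"
    by (rule lin) (use v ij xy in auto)
  finally show ?thesis
    using rep[OF xy(1)] rep[OF xy(2)] fun_upd_twist[OF ij(3), of v x x] fun_upd_twist[OF ij(3), of v x y]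
      fun_upd_twist[OF ij(3), of v y x]
      fun_upd_twist[OF ij(3), of v y y] by (simp add: fun_upd_def)
qed

text \<open>The basis is empty for \<open>n = 0\<close>, so that expansions over it hold in every dimension.\<close>

definition coord_basis :: "nat \<Rightarrow> 'n::{finite,wellorder} rn set"
  where "coord_basis n = (if n = 0 then {} else Basis)"

lemma finite_coord_basis [simp]: "finite (coord_basis n)"
  by (simp add: coord_basis_def)

lemma coord_basis_in: "b \<in> coord_basis n \<Longrightarrow> b \<in> coord_space n"
  by (auto simp: coord_basis_def coord_space_def split: if_splits)

lemma coord_basis_representation: "x \<in> coord_space n \<Longrightarrow> (\<Sum>b\<in>coord_basis n. (x \<bullet> b) *\<^sub>R b) = x"
  by (auto simp: coord_basis_def coord_space_def euclidean_representation split: if_splits)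

lemma subspace_coord_space: "subspace (coord_space n)"
  by (auto simp: coord_space_def)

text \<open>Multilinear expansion over all multi-indices. The arguments are replaced by basis vectors one
  at a time: after \<open>l\<close> steps the first \<open>l\<close> arguments are basis vectors.\<close>

lemma alternating_form_expand:
  fixes a :: "(nat \<Rightarrow> 'n::{finite,wellorder} rn) \<Rightarrow> real"
  assumes a: "alternating_form k (coord_space n) a" and w: "\<And>i. i < k \<Longrightarrow> w i \<in> coord_space n"
  shows "a w = (\<Sum>J\<in>Pi\<^sub>E {..<k} (\<lambda>_. coord_basis n). (\<Prod>i<k. w i \<bullet> J i) * a J)"
proof -
  let ?B = "coord_basis n :: 'n rn set"
  have "a w = (\<Sum>J\<in>Pi\<^sub>E {..<l} (\<lambda>_. ?B). (\<Prod>i<l. w i \<bullet> J i) * a (\<lambda>i. if i < l then J i else w i))"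
    if "l \<le> k" for l
    using that
  proof (induction l)
    case (Suc l)
    have "a (\<lambda>i. if i < l then J i else w i) =
        (\<Sum>b\<in>?B. (w l \<bullet> b) * a ((\<lambda>i. if i < l then J i else w i)(l := b)))"
      if J: "J \<in> Pi\<^sub>E {..<l} (\<lambda>_. ?B)" for J
    proof -
      let ?v = "\<lambda>i. if i < l then J i else w i"
      have "?v i \<in> coord_space n" if "i < k" for i
        using J w[OF that] by (auto intro!: coord_basis_in)
      then have "a (?v(l := \<Sum>b\<in>?B. (w l \<bullet> b) *\<^sub>R b)) = (\<Sum>b\<in>?B. (w l \<bullet> b) * a (?v(l := b)))"
        using Suc.prems by (intro alternating_form_sum[OF a subspace_coord_space]) (auto intro: coord_basis_in)
      moreover have "?v(l := w l) = ?v" by auto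
      ultimately show ?thesis using coord_basis_representation[OF w[of l]] Suc.prems by simp
    qed
    then have "a w = (\<Sum>J\<in>Pi\<^sub>E {..<l} (\<lambda>_. ?B). \<Sum>b\<in>?B.
        (\<Prod>i<l. w i \<bullet> J i) * ((w l \<bullet> b) * a ((\<lambda>i. if i < l then J i else w i)(l := b))))"
      using Suc by (simp add: sum_distrib_left)
    also have "\<dots> = (\<Sum>(b, J)\<in>?B \<times> Pi\<^sub>E {..<l} (\<lambda>_. ?B).
        (\<Prod>i<l. w i \<bullet> J i) * ((w l \<bullet> b) * a ((\<lambda>i. if i < l then J i else w i)(l := b))))"
      by (subst sum.swap) (simp add: sum.cartesian_product)
    also have "\<dots> = (\<Sum>(b, J)\<in>?B \<times> Pi\<^sub>E {..<l} (\<lambda>_. ?B). (\<lambda>J. (\<Prod>i<Suc l. w i \<bullet> J i) *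
        a (\<lambda>i. if i < Suc l then J i else w i)) (J(l := b)))"
    proof (intro sum.cong refl, clarify)
      fix b J assume "b \<in> ?B" "J \<in> Pi\<^sub>E {..<l} (\<lambda>_. ?B)"
      have "(\<lambda>i. if i < Suc l then (J(l := b)) i else w i) = (\<lambda>i. if i < l then J i else w i)(l := b)"
        by (auto simp: fun_eq_iff)
      moreover have "(\<Prod>i<l. w i \<bullet> (J(l := b)) i) = (\<Prod>i<l. w i \<bullet> J i)"
        by (rule prod.cong) auto
      ultimately show "(\<Prod>i<l. w i \<bullet> J i) * ((w l \<bullet> b) * a ((\<lambda>i. if i < l then J i else w i)(l := b))) =
          (\<Prod>i<Suc l. w i \<bullet> (J(l := b)) i) * a (\<lambda>i. if i < Suc l then (J(l := b)) i else w i)"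
        by simp
    qed
    also have "\<dots> = (\<Sum>J\<in>Pi\<^sub>E (insert l {..<l}) (\<lambda>_. ?B). (\<Prod>i<Suc l. w i \<bullet> J i) *
        a (\<lambda>i. if i < Suc l then J i else w i))"
      unfolding PiE_insert_eq
      by (subst sum.reindex[OF inj_combinator]) (auto simp: case_prod_unfold)
    finally show ?case by (simp add: lessThan_Suc)
  qed simp
  from this[of k] have "a w = (\<Sum>J\<in>Pi\<^sub>E {..<k} (\<lambda>_. ?B). (\<Prod>i<k. w i \<bullet> J i) * a (\<lambda>i. if i < k then J i else w i))"
    by simp
  also have "\<dots> = (\<Sum>J\<in>Pi\<^sub>E {..<k} (\<lambda>_. ?B). (\<Prod>i<k. w i \<bullet> J i) * a J)"
    by (intro sum.cong refl arg_cong2[where f = "(*)"] alternating_form_cong[OF a]) auto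
  finally show ?thesis .
qed

text \<open>The coefficients of a form are only known to be smooth for constant arguments; the expansion over
  a basis transfers this to smoothly varying arguments.\<close>

lemma smooth_on_alternating_form:
  fixes \<alpha> :: "'a::euclidean_space \<Rightarrow> (nat \<Rightarrow> 'n::{finite,wellorder} rn) \<Rightarrow> real"
  assumes "\<And>y. y \<in> A \<Longrightarrow> alternating_form k (coord_space n) (\<alpha> y)"
    and "\<And>v. (\<And>i. v i \<in> coord_space n) \<Longrightarrow> smooth_on A (\<lambda>y. \<alpha> y v)"
    and "\<And>i. i < k \<Longrightarrow> smooth_on A (w i)"
    and "\<And>i y. y \<in> A \<Longrightarrow> w i y \<in> coord_space n"
  shows "smooth_on A (\<lambda>y. \<alpha> y (\<lambda>i. w i y))"
proof -
  let ?B = "coord_basis n :: 'n rn set"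
  (* multi-indices are undefined from k on, where the hypotheses still ask for vectors in the space *)
  define ext where "ext = (\<lambda>(J :: nat \<Rightarrow> 'n rn) i. if i < k then J i else 0)"
  have ext: "\<alpha> y J = \<alpha> y (ext J)" if "y \<in> A" for y J
    by (rule alternating_form_cong[OF assms(1)[OF that]]) (simp add: ext_def)
  have "smooth_on A (\<lambda>y. \<Sum>J\<in>Pi\<^sub>E {..<k} (\<lambda>_. ?B). (\<Prod>i<k. w i y \<bullet> J i) * \<alpha> y (ext J))"
  proof (intro smooth_on_sum smooth_on_mult smooth_on_prod_family smooth_on_inner smooth_on_const)
    fix J assume "J \<in> Pi\<^sub>E {..<k} (\<lambda>_. ?B)"
    then show "smooth_on A (\<lambda>y. \<alpha> y (ext J))"
      by (intro assms(2)) (auto simp: ext_def subspace_0 subspace_coord_space intro!: coord_basis_in)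
  qed (use assms(3) in auto)
  moreover have "\<alpha> y (\<lambda>i. w i y) = (\<Sum>J\<in>Pi\<^sub>E {..<k} (\<lambda>_. ?B). (\<Prod>i<k. w i y \<bullet> J i) * \<alpha> y (ext J))"
    if "y \<in> A" for y
    using alternating_form_expand[OF assms(1)[OF that], of "\<lambda>i. w i y"] assms(4)[OF that] ext[OF that] by simp
  ultimately show ?thesis using smooth_on_cong[of A] by (metis (mono_tags, lifting))
qed

text \<open>The product rule for a family of forms evaluated on varying vectors: \<open>\<kappa>\<close> is the derivative of
  the coefficients, and each argument contributes one further term.\<close>

lemma has_derivative_alternating_form:
  fixes \<alpha> :: "'a::euclidean_space \<Rightarrow> (nat \<Rightarrow> 'n::{finite,wellorder} rn) \<Rightarrow> real"
  assumes O: "open X" "z \<in> X"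
    and \<alpha>: "\<And>y. y \<in> X \<Longrightarrow> alternating_form k (coord_space n) (\<alpha> y)"
    and \<kappa>: "\<And>v. (\<And>i. v i \<in> coord_space n) \<Longrightarrow> ((\<lambda>y. \<alpha> y v) has_derivative \<kappa> v) (at z)"
    and w': "\<And>i. i < k \<Longrightarrow> (w i has_derivative w' i) (at z)"
    and w: "\<And>i y. y \<in> X \<Longrightarrow> w i y \<in> coord_space n"
    and w'_in: "\<And>i u. i < k \<Longrightarrow> w' i u \<in> coord_space n"
  shows "((\<lambda>y. \<alpha> y (\<lambda>i. w i y)) has_derivative
    (\<lambda>u. \<kappa> (\<lambda>i. w i z) u + (\<Sum>j<k. \<alpha> z ((\<lambda>i. w i z)(j := w' j u))))) (at z)"
proof -
  let ?I = "Pi\<^sub>E {..<k} (\<lambda>_. coord_basis n :: 'n rn set)"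
  define ext where "ext = (\<lambda>(J :: nat \<Rightarrow> 'n rn) i. if i < k then J i else 0)"
  have ext: "\<alpha> y J = \<alpha> y (ext J)" if "y \<in> X" for y J
    by (rule alternating_form_cong[OF \<alpha>[OF that]]) (simp add: ext_def)
  have ext_in: "ext J i \<in> coord_space n" if "J \<in> ?I" for J i
    using that by (auto simp: ext_def subspace_0 subspace_coord_space intro!: coord_basis_in)
  have expand: "\<alpha> y v = (\<Sum>J\<in>?I. (\<Prod>i<k. v i \<bullet> J i) * \<alpha> y (ext J))"
    if "y \<in> X" "\<And>i. i < k \<Longrightarrow> v i \<in> coord_space n" for y v
    using alternating_form_expand[OF \<alpha>[OF that(1)] that(2)] ext[OF that(1)] by simp
  have \<kappa>_expand: "\<kappa> v u = (\<Sum>J\<in>?I. (\<Prod>i<k. v i \<bullet> J i) * \<kappa> (ext J) u)"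
    if v: "\<And>i. v i \<in> coord_space n" for v u
  proof -
    have "((\<lambda>y. \<Sum>J\<in>?I. (\<Prod>i<k. v i \<bullet> J i) * \<alpha> y (ext J)) has_derivative
        (\<lambda>u. \<Sum>J\<in>?I. (\<Prod>i<k. v i \<bullet> J i) * \<kappa> (ext J) u)) (at z)"
      by (intro has_derivative_sum has_derivative_mult_right \<kappa> ext_in)
    then have "((\<lambda>y. \<alpha> y v) has_derivative (\<lambda>u. \<Sum>J\<in>?I. (\<Prod>i<k. v i \<bullet> J i) * \<kappa> (ext J) u)) (at z)"
      by (rule has_derivative_transform_within_open[OF _ O]) (simp add: expand v)
    from has_derivative_unique[OF \<kappa>[OF v] this] show ?thesis by metis
  qed
  have "((\<lambda>y. \<Sum>J\<in>?I. (\<Prod>i<k. w i y \<bullet> J i) * \<alpha> y (ext J)) has_derivative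
      (\<lambda>u. \<Sum>J\<in>?I. (\<Prod>i<k. w i z \<bullet> J i) * \<kappa> (ext J) u +
        (\<Sum>j<k. (w' j u \<bullet> J j) * (\<Prod>i\<in>{..<k} - {j}. w i z \<bullet> J i)) * \<alpha> z (ext J))) (at z)"
    by (intro has_derivative_sum has_derivative_mult has_derivative_prod has_derivative_inner_left)
       (use w' \<kappa> ext_in in auto)
  then have "((\<lambda>y. \<alpha> y (\<lambda>i. w i y)) has_derivative
      (\<lambda>u. \<Sum>J\<in>?I. (\<Prod>i<k. w i z \<bullet> J i) * \<kappa> (ext J) u +
        (\<Sum>j<k. (w' j u \<bullet> J j) * (\<Prod>i\<in>{..<k} - {j}. w i z \<bullet> J i)) * \<alpha> z (ext J))) (at z)"
    by (rule has_derivative_transform_within_open[OF _ O]) (simp add: expand w)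
  moreover have "(\<Sum>J\<in>?I. (\<Prod>i<k. w i z \<bullet> J i) * \<kappa> (ext J) u +
        (\<Sum>j<k. (w' j u \<bullet> J j) * (\<Prod>i\<in>{..<k} - {j}. w i z \<bullet> J i)) * \<alpha> z (ext J)) =
      \<kappa> (\<lambda>i. w i z) u + (\<Sum>j<k. \<alpha> z ((\<lambda>i. w i z)(j := w' j u)))" for u
  proof -
    have "\<alpha> z ((\<lambda>i. w i z)(j := w' j u)) =
        (\<Sum>J\<in>?I. (w' j u \<bullet> J j) * (\<Prod>i\<in>{..<k} - {j}. w i z \<bullet> J i) * \<alpha> z (ext J))" if "j < k" for j
    proof -
      have "(\<Prod>i<k. ((\<lambda>i. w i z)(j := w' j u)) i \<bullet> J i) =
          (w' j u \<bullet> J j) * (\<Prod>i\<in>{..<k} - {j}. w i z \<bullet> J i)" for J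
        using that by (subst prod.remove[of _ j]) (auto intro!: prod.cong)
      then show ?thesis
        using expand[OF O(2), of "(\<lambda>i. w i z)(j := w' j u)"] w[OF O(2)] w'_in[OF that] by simp
    qed
    then have "(\<Sum>j<k. \<alpha> z ((\<lambda>i. w i z)(j := w' j u))) =
        (\<Sum>J\<in>?I. (\<Sum>j<k. (w' j u \<bullet> J j) * (\<Prod>i\<in>{..<k} - {j}. w i z \<bullet> J i)) * \<alpha> z (ext J))"
      by (simp add: sum_distrib_right) (rule sum.swap)
    then show ?thesis using \<kappa>_expand[of "\<lambda>i. w i z" u] w[OF O(2)] by (simp add: sum.distrib)
  qed
  ultimately show ?thesis by simp
qed

text \<open>Moving the vector in position \<open>l\<close> to the front costs \<open>l\<close> transpositions. The sequence on the left
  is the one that occurs in \<open>exterior_deriv\<close>.\<close>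

lemma alternating_form_move_front:
  assumes a: "alternating_form k T a" and T: "subspace T"
  shows "(\<And>i. w i \<in> T) \<Longrightarrow> x \<in> T \<Longrightarrow> l < k \<Longrightarrow>
    a (\<lambda>j. if j < Suc l then case_nat x w j else case_nat x w (Suc j)) = (-1) ^ l * a (w(l := x))"
proof (induction l arbitrary: w)
  case 0
  have eq: "(\<lambda>j. if j < Suc 0 then case_nat x w j else case_nat x w (Suc j)) = w(0 := x)"
    by (auto simp: fun_eq_iff split: nat.split)
  show ?case unfolding eq by (simp add: fun_upd_def)
next
  case (Suc l)
  (* the induction hypothesis omits or overwrites the entry l, so its old value can move up *)
  define w' where "w' = w(Suc l := w l)"
  have eq: "(\<lambda>j. if j < Suc l then case_nat x w' j else case_nat x w' (Suc j)) =
      (\<lambda>j. if j < Suc (Suc l) then case_nat x w j else case_nat x w (Suc j))"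
  proof
    fix j show "(if j < Suc l then case_nat x w' j else case_nat x w' (Suc j)) =
        (if j < Suc (Suc l) then case_nat x w j else case_nat x w (Suc j))"
      by (cases j) (auto simp: w'_def less_Suc_eq)
  qed
  have "\<And>i. w' i \<in> T" using Suc.prems(1) by (simp add: w'_def)
  then have "a (\<lambda>j. if j < Suc (Suc l) then case_nat x w j else case_nat x w (Suc j)) = (-1) ^ l * a (w'(l := x))"
    using Suc.IH[of w'] Suc.prems(2,3) unfolding eq by (simp add: fun_upd_def)
  also have "w'(l := x) = w(l := x, Suc l := w l)" by (simp add: w'_def fun_upd_twist)
  also have "a \<dots> = - a (w(l := w l, Suc l := x))"
    by (rule alternating_form_swap[OF a T]) (use Suc.prems in auto)
  finally show ?case by (simp add: fun_upd_def)
qed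

lemma coord_index_bij: "bij_betw ((!) (sorted_list_of_set (UNIV :: 'n::{finite,wellorder} set))) {..<CARD('n)} UNIV"
  by (rule bij_betw_nth) auto

lemma coord_index_right:
  "sorted_list_of_set UNIV ! (inv_into {..<CARD('n)} ((!) (sorted_list_of_set UNIV)) l) = (l :: 'n::{finite,wellorder})"
  using bij_betw_inv_into_right[OF coord_index_bij] by blast

text \<open>The determinant as a form of top degree: the sequence of vectors is turned into a matrix by the
  enumeration of the index type that also underlies \<open>coord_vector\<close>.\<close>

definition det_form :: "(nat \<Rightarrow> 'n::{finite,wellorder} rn) \<Rightarrow> real"
  where "det_form w = det (\<chi> l. w (inv_into {..<CARD('n)} ((!) (sorted_list_of_set UNIV)) l))"

lemma alternating_det_form: "alternating_form CARD('n) UNIV (det_form :: (nat \<Rightarrow> 'n::{finite,wellorder} rn) \<Rightarrow> real)"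
proof -
  define en where "en = (!) (sorted_list_of_set (UNIV :: 'n set))"
  define idx where "idx = inv_into {..<CARD('n)} en"
  have bij: "bij_betw en {..<CARD('n)} UNIV" unfolding en_def by (rule coord_index_bij)
  have en_idx: "en (idx l) = l" for l
    unfolding idx_def using bij by (simp add: bij_betw_inv_into_right)
  have idx_en: "idx (en i) = i" if "i < CARD('n)" for i
    unfolding idx_def using bij that by (simp add: bij_betw_inv_into_left)
  have idx: "idx l < CARD('n)" for l
    unfolding idx_def using bij inv_into_into[of l en "{..<CARD('n)}"] by (simp add: bij_betw_def)
  have df: "det_form w = det (\<chi> l. w (idx l))" for w :: "nat \<Rightarrow> 'n rn"
    unfolding det_form_def idx_def en_def ..
  have upd: "(\<chi> l. (v(i := x)) (idx l)) = (\<chi> l. if l = en i then x else v (idx l))"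
    if "i < CARD('n)" for v :: "nat \<Rightarrow> 'n rn" and i x
    using that en_idx idx_en by (auto simp: vec_eq_iff)
  have "det_form (v(i := r *\<^sub>R x + s *\<^sub>R y)) = r * det_form (v(i := x)) + s * det_form (v(i := y))"
    if "i < CARD('n)" for v :: "nat \<Rightarrow> 'n rn" and i x y r s
    unfolding df upd[OF that] det_row_add scalar_mult_eq_scaleR[symmetric] det_row_mul ..
  moreover have "det_form v = 0" if "i < CARD('n)" "j < CARD('n)" "i \<noteq> j" "v i = v j"
    for v :: "nat \<Rightarrow> 'n rn" and i j
    unfolding df
  proof (rule det_identical_rows)
    show "en i \<noteq> en j" using that idx_en by metis
    show "row (en i) (\<chi> l. v (idx l)) = row (en j) (\<chi> l. v (idx l))"
      using that by (simp add: row_def idx_en)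
  qed
  moreover have "det_form v = det_form w" if "\<forall>i<CARD('n). v i = w i" for v w :: "nat \<Rightarrow> 'n rn"
    using that idx by (simp add: df)
  ultimately show ?thesis unfolding alternating_form_def by blast
qed

lemma det_form_coord_vector: "det_form (coord_vector :: nat \<Rightarrow> 'n::{finite,wellorder} rn) = 1"
proof -
  have "(\<chi> l. coord_vector (inv_into {..<CARD('n)} ((!) (sorted_list_of_set UNIV)) l)) = (mat 1 :: ('n rn, 'n) vec)"
    by (simp add: coord_index_right vec_eq_iff coord_vector_def mat_def axis_def)
  then show ?thesis by (simp add: det_form_def)
qed

lemma det_form_linear_image:
  assumes "linear D"
  shows "det_form (\<lambda>i. D (coord_vector i)) = det (matrix (D :: 'n::{finite,wellorder} rn \<Rightarrow> 'n rn))"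
proof -
  have "(\<chi> l. D (coord_vector (inv_into {..<CARD('n)} ((!) (sorted_list_of_set UNIV)) l))) = transpose (matrix D)"
    by (simp add: coord_index_right vec_eq_iff coord_vector_def transpose_def matrix_def)
  then show ?thesis by (simp add: det_form_def det_transpose)
qed

text \<open>Both sides change sign under transpositions of the arguments.\<close>

lemma alternating_form_permuted_basis:
  fixes a :: "(nat \<Rightarrow> 'n::{finite,wellorder} rn) \<Rightarrow> real"
  assumes a: "alternating_form CARD('n) UNIV a" and "p permutes {..<CARD('n)}"
  shows "a (\<lambda>i. coord_vector (p i)) = a coord_vector * det_form (\<lambda>i. coord_vector (p i) :: 'n rn)"
  using finite_lessThan assms(2)
proof (induction p rule: permutes_rev_induct)
  case id
  then show ?case by (simp add: det_form_coord_vector)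
next
  case (swap i j p)
  let ?v = "\<lambda>i. coord_vector (p i) :: 'n rn"
  have eq: "(\<lambda>l. coord_vector ((p \<circ> Transposition.transpose i j) l)) = ?v(i := ?v j, j := ?v i)"
    by (auto simp: fun_eq_iff Transposition.transpose_def)
  have neg: "b (?v(i := ?v j, j := ?v i)) = - b ?v" if "alternating_form CARD('n) UNIV b" for b
  proof -
    have "b (?v(i := ?v j, j := ?v i)) = - b (?v(i := ?v i, j := ?v j))"
      by (rule alternating_form_swap[OF that]) (use swap in auto)
    moreover have "?v(i := ?v i, j := ?v j) = ?v" by (simp add: fun_eq_iff)
    ultimately show ?thesis by simp
  qed
  show ?case
    unfolding eq neg[OF a] neg[OF alternating_det_form] using swap by simp
qed

text \<open>Expand both sides over the basis. On multi-indices with a repetition both forms vanish, and the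
  others are permutations of the basis.\<close>

lemma alternating_form_top_degree:
  fixes a :: "(nat \<Rightarrow> 'n::{finite,wellorder} rn) \<Rightarrow> real"
  assumes a: "alternating_form CARD('n) UNIV a"
  shows "a w = a coord_vector * det_form w"
proof -
  define en where "en = (!) (sorted_list_of_set (UNIV :: 'n set))"
  have bij: "bij_betw en {..<CARD('n)} UNIV" unfolding en_def by (rule coord_index_bij)
  have T: "(UNIV :: 'n rn set) = coord_space CARD('n)" by (simp add: coord_space_def)
  let ?I = "Pi\<^sub>E {..<CARD('n)} (\<lambda>_. coord_basis CARD('n) :: 'n rn set)"
  have J: "a J = a coord_vector * det_form J" if "J \<in> ?I" for J
  proof (cases "inj_on J {..<CARD('n)}")
    case False
    then obtain i j where ij: "i < CARD('n)" "j < CARD('n)" "i \<noteq> j" "J i = J j"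
      unfolding inj_on_def by auto
    then show ?thesis
      using alternating_form_repeated[OF a, of J i j] alternating_form_repeated[OF alternating_det_form, of J i j]
      by simp
  next
    case True
    have "\<exists>l. J i = axis l 1" if "i < CARD('n)" for i
      using \<open>J \<in> ?I\<close> that by (auto simp: coord_basis_def Basis_vec_def PiE_def Pi_def)
    then obtain L where L: "\<And>i. i < CARD('n) \<Longrightarrow> J i = axis (L i) 1" by metis
    (* extended by the identity, as required of a permutation *)
    define p where "p = (\<lambda>i. if i < CARD('n) then inv_into {..<CARD('n)} en (L i) else i)"
    have enp: "en (p i) = L i" if "i < CARD('n)" for i
      using that bij_betw_inv_into_right[OF bij, of "L i"] by (simp add: p_def)
    have pin: "p i < CARD('n)" if "i < CARD('n)" for i
      using that bij inv_into_into[of "L i" en "{..<CARD('n)}"] by (simp add: p_def bij_betw_def)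
    have "inj_on p {..<CARD('n)}"
      using True L enp unfolding inj_on_def by (metis lessThan_iff)
    then have "bij_betw p {..<CARD('n)} {..<CARD('n)}"
      using pin by (intro bij_betw_imageI endo_inj_surj) auto
    then have p: "p permutes {..<CARD('n)}"
      by (rule bij_imp_permutes) (simp add: p_def)
    have eq: "J i = coord_vector (p i)" if "i < CARD('n)" for i
      using L[OF that] enp[OF that] by (simp add: coord_vector_def en_def)
    have "b J = b (\<lambda>i. coord_vector (p i))" if "alternating_form CARD('n) UNIV b" for b
      by (rule alternating_form_cong[OF that eq])
    then show ?thesis
      using alternating_form_permuted_basis[OF a p] a alternating_det_form by metis
  qed
  have "a w = (\<Sum>J\<in>?I. (\<Prod>i<CARD('n). w i \<bullet> J i) * a J)"
    using a unfolding T by (rule alternating_form_expand) (simp add: coord_space_def)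
  also have "\<dots> = a coord_vector * (\<Sum>J\<in>?I. (\<Prod>i<CARD('n). w i \<bullet> J i) * det_form J)"
    by (simp add: J sum_distrib_left mult_ac)
  also have "(\<Sum>J\<in>?I. (\<Prod>i<CARD('n). w i \<bullet> J i) * det_form J) = det_form w"
    using alternating_det_form[where 'n = 'n] unfolding T
    by (rule alternating_form_expand[symmetric]) (simp add: coord_space_def)
  finally show ?thesis .
qed

corollary alternating_form_det:
  fixes D :: "'n::{finite,wellorder} rn \<Rightarrow> 'n rn"
  assumes "alternating_form CARD('n) UNIV a" "linear D"
  shows "a (\<lambda>i. D (coord_vector i)) = det (matrix D) * a coord_vector"
  using alternating_form_top_degree[OF assms(1), of "\<lambda>i. D (coord_vector i)"]
  unfolding det_form_linear_image[OF assms(2)] by simp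

text \<open>This cancels the mixed second derivatives in \<open>pulled_divergence\<close>.\<close>

lemma antisymmetric_sum_zero:
  fixes \<beta> :: "'i \<Rightarrow> 'i \<Rightarrow> real"
  assumes "finite I" "\<And>i j. i \<in> I \<Longrightarrow> j \<in> I \<Longrightarrow> i \<noteq> j \<Longrightarrow> \<beta> i j = - \<beta> j i"
  shows "(\<Sum>i\<in>I. \<Sum>j\<in>I - {i}. \<beta> i j) = 0"
proof -
  define \<gamma> where "\<gamma> = (\<lambda>i j. if i = j then 0 else \<beta> i j)"
  have neg: "\<gamma> j i = - \<gamma> i j" if "i \<in> I" "j \<in> I" for i j
    using assms(2)[OF that] by (cases "i = j") (auto simp: \<gamma>_def)
  have "(\<Sum>i\<in>I. \<Sum>j\<in>I - {i}. \<beta> i j) = (\<Sum>i\<in>I. \<Sum>j\<in>I. \<gamma> i j)"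
    by (intro sum.cong refl sum.mono_neutral_cong_left) (auto simp: \<gamma>_def assms(1))
  moreover have "(\<Sum>i\<in>I. \<Sum>j\<in>I. \<gamma> i j) = (\<Sum>i\<in>I. \<Sum>j\<in>I. - \<gamma> i j)"
  proof -
    have "(\<Sum>i\<in>I. \<Sum>j\<in>I. \<gamma> i j) = (\<Sum>j\<in>I. \<Sum>i\<in>I. \<gamma> i j)" by (rule sum.swap)
    also have "\<dots> = (\<Sum>j\<in>I. \<Sum>i\<in>I. - \<gamma> j i)"
    proof (intro sum.cong[OF refl])
      show "\<gamma> i j = - \<gamma> j i" if "j \<in> I" "i \<in> I" for i j using that by (rule neg)
    qed
    finally show ?thesis .
  qed
  moreover have "(\<Sum>i\<in>I. \<Sum>j\<in>I. - \<gamma> i j) = - (\<Sum>i\<in>I. \<Sum>j\<in>I. \<gamma> i j)" by (simp only: sum_negf)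
  ultimately show ?thesis by linarith
qed

section \<open>Charts\<close>

abbreviation chart_image :: "('p, 'n::{finite,wellorder}) chart \<Rightarrow> 'n rn set"
  where "chart_image c \<equiv> snd c ` fst c"

lemma closed_half_space: "closed (half_space n :: 'n::{finite,wellorder} rn set)"
proof -
  have "closed {x :: 'n rn. 0 \<le> x $ Max UNIV}"
    by (intro closed_Collect_le continuous_intros)
  moreover have "half_space n = coord_space n \<inter> {x :: 'n rn. 0 \<le> x $ Max UNIV}"
    by (auto simp: half_space_def)
  ultimately show ?thesis by (auto simp: coord_space_def)
qed

lemma closed_coord_space: "closed (coord_space n)"
  by (simp add: coord_space_def)

lemma manifold_chart: "smooth_manifold M \<Longrightarrow> c \<in> atlas M \<Longrightarrow> is_chart (mdim M) (mtop M) c"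
  unfolding smooth_manifold_def by blast

lemma manifold_covered: "smooth_manifold M \<Longrightarrow> p \<in> topspace (mtop M) \<Longrightarrow> \<exists>c\<in>atlas M. p \<in> fst c"
  by (simp add: smooth_manifold_def) blast

lemma chart_openin: "is_chart n X c \<Longrightarrow> openin X (fst c)"
  by (simp add: is_chart_def)

lemma chart_subset_topspace: "is_chart n X c \<Longrightarrow> fst c \<subseteq> topspace X"
  using chart_openin openin_subset by blast

lemma chart_homeomorphic_maps:
  assumes "is_chart n X c"
  shows "homeomorphic_maps (subtopology X (fst c)) (top_of_set (chart_image c)) (snd c) (chart_inv c)"
proof -
  have hom: "homeomorphic_map (subtopology X (fst c)) (top_of_set (chart_image c)) (snd c)"
    using assms by (simp add: is_chart_def)
  have top: "topspace (subtopology X (fst c)) = fst c"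
    using chart_subset_topspace[OF assms] by auto
  obtain g where g: "homeomorphic_maps (subtopology X (fst c)) (top_of_set (chart_image c)) (snd c) g"
    using hom homeomorphic_map_maps by blast
  have "inj_on (snd c) (fst c)"
    using hom top homeomorphic_imp_injective_map by metis
  then have "g y = chart_inv c y" if "y \<in> chart_image c" for y
    using g that top unfolding homeomorphic_maps_def chart_inv_def by auto
  then show ?thesis
    using homeomorphic_maps_eq[OF g] by simp
qed

lemma chart_inv_left: "is_chart n X c \<Longrightarrow> p \<in> fst c \<Longrightarrow> chart_inv c (snd c p) = p"
  using chart_homeomorphic_maps[of n X c] chart_subset_topspace[of n X c]
  unfolding homeomorphic_maps_def by auto

lemma chart_inv_right: "x \<in> chart_image c \<Longrightarrow> snd c (chart_inv c x) = x"
  unfolding chart_inv_def by (rule f_inv_into_f)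

lemma chart_inv_in: "x \<in> chart_image c \<Longrightarrow> chart_inv c x \<in> fst c"
  unfolding chart_inv_def by (rule inv_into_into)

lemma chart_continuous_map: "is_chart n X c \<Longrightarrow> continuous_map (subtopology X (fst c)) euclidean (snd c)"
  using chart_homeomorphic_maps[of n X c] continuous_map_into_fulltopology
  unfolding homeomorphic_maps_def by blast

lemma chart_inv_continuous_map: "is_chart n X c \<Longrightarrow> continuous_map (top_of_set (chart_image c)) X (chart_inv c)"
  using chart_homeomorphic_maps[of n X c] continuous_map_into_fulltopology
  unfolding homeomorphic_maps_def by blast

lemma chart_image_Int: "is_chart n X c \<Longrightarrow> snd c ` (fst c \<inter> V) = {x \<in> chart_image c. chart_inv c x \<in> V}"
proof (intro set_eqI iffI)
  assume c: "is_chart n X c"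
  show "x \<in> {x \<in> chart_image c. chart_inv c x \<in> V}" if "x \<in> snd c ` (fst c \<inter> V)" for x
    using that chart_inv_left[OF c] by auto
  show "x \<in> snd c ` (fst c \<inter> V)" if "x \<in> {x \<in> chart_image c. chart_inv c x \<in> V}" for x
    using that chart_inv_right[of x c] chart_inv_in[of x c] by (intro image_eqI[of _ _ "chart_inv c x"]) auto
qed

lemma chart_image_Int_openin:
  assumes "is_chart n X c" "openin X V"
  shows "openin (top_of_set (chart_image c)) (snd c ` (fst c \<inter> V))"
  using openin_continuous_map_preimage[OF chart_inv_continuous_map[OF assms(1)] assms(2)]
  by (simp add: chart_image_Int[OF assms(1)])

lemma chart_model:
  assumes "is_chart n X c"
  obtains A where "A = coord_space n \<or> A = half_space n" "openin (top_of_set A) (chart_image c)" "closed A" "n \<noteq> 0 \<longrightarrow> fat A"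
proof -
  have "fat (coord_space n)" if "n \<noteq> 0" using that fat_UNIV by (simp add: coord_space_def)
  then show thesis
    using assms that[of "coord_space n"] that[of "half_space n"] closed_half_space closed_coord_space fat_half_space
    unfolding is_chart_def by blast
qed

lemma convex_half_space: "convex (half_space n :: 'n::{finite,wellorder} rn set)"
  unfolding convex_def half_space_def coord_space_def by auto

text \<open>This turns frontier points of the model set into boundary points in the sense of \<open>mboundary\<close>.\<close>

lemma frontier_half_space_nth:
  assumes "n \<noteq> 0" "x \<in> frontier (half_space n :: 'n::{finite,wellorder} rn set)"
  shows "x $ Max UNIV = 0"
proof (rule ccontr)
  assume neq: "x $ Max UNIV \<noteq> 0"
  have "x \<in> half_space n" using assms(2) closed_half_space frontier_subset_eq by blast
  then have "0 < x $ Max UNIV" using neq by (simp add: half_space_def)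
  moreover have "open {x :: 'n rn. 0 < x $ Max UNIV}"
    by (intro open_Collect_less continuous_intros)
  moreover have "{x :: 'n rn. 0 < x $ Max UNIV} \<subseteq> half_space n"
    using assms(1) by (auto simp: half_space_def coord_space_def)
  ultimately have "x \<in> interior (half_space n)" using interior_maximal by blast
  then show False using assms(2) by (simp add: frontier_def)
qed

lemma chart_image_subset_coord_space: "is_chart n X c \<Longrightarrow> chart_image c \<subseteq> coord_space n"
  unfolding is_chart_def half_space_def by (auto dest!: openin_imp_subset)

lemma fat_chart_image: "is_chart n X c \<Longrightarrow> n \<noteq> 0 \<Longrightarrow> fat (chart_image c)"
  by (metis chart_model fat_openin)

lemma overlap_openin:
  assumes "is_chart n X c" "is_chart n X d"
  shows "openin (top_of_set (chart_image c)) (overlap c d)"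
  unfolding overlap_def by (rule chart_image_Int_openin[OF assms(1) chart_openin[OF assms(2)]])

lemma overlap_eq: "is_chart n X c \<Longrightarrow> overlap c d = {x \<in> chart_image c. chart_inv c x \<in> fst d}"
  unfolding overlap_def by (rule chart_image_Int)

lemma overlap_borel:
  assumes "is_chart n X c" "is_chart n X d"
  shows "overlap c d \<in> sets borel"
proof -
  obtain A where "openin (top_of_set A) (chart_image c)" "closed A" using chart_model[OF assms(1)] by metis
  then have "openin (top_of_set A) (overlap c d)" using overlap_openin[OF assms] openin_trans by blast
  then obtain W where "open W" "overlap c d = A \<inter> W" by (auto simp: openin_open)
  then show ?thesis using \<open>closed A\<close> by auto
qed

lemma local_dom_eq:
  assumes "is_chart n X c"
  shows "local_dom c d f = {x \<in> chart_image c. f (chart_inv c x) \<in> fst d}"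
proof -
  have "{p \<in> fst c. f p \<in> fst d} = fst c \<inter> {p. f p \<in> fst d}" by blast
  then show ?thesis unfolding local_dom_def using chart_image_Int[OF assms, of "{p. f p \<in> fst d}"] by simp
qed

lemma derivative_in_coord_space:
  assumes "fat S" "z \<in> S" "(f has_derivative f') (at z within S)"
    and "\<And>y. y \<in> S \<Longrightarrow> f y \<in> coord_space n"
  shows "f' u \<in> coord_space n"
proof (cases "n = 0")
  case True
  then have "(f has_derivative (\<lambda>u. 0)) (at z within S)"
    using assms(2,4) by (intro has_derivative_transform[OF assms(2) _ has_derivative_const[of 0]])
      (auto simp: coord_space_def)
  then show ?thesis using fat_derivative_unique[OF assms(1,2,3)] True by (auto simp: coord_space_def)
qed (simp add: coord_space_def)

section \<open>Partitions of unity\<close>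

text \<open>In the chart \<open>c\<close> the bump is \<open>exp (- 1 / (r\<^sup>2 - \<bar>x - x\<^sub>0\<bar>\<^sup>2))\<close>, extended by \<open>0\<close>. The preimage
  of a small closed ball is compact, hence closed in the Hausdorff space \<open>M\<close>, and this makes the
  extension smooth in all other charts.\<close>

lemma smooth_bump_exists:
  fixes M :: "('p, 'n::{finite,wellorder}) manifold"
  assumes M: "smooth_manifold M" and c: "c \<in> atlas M" and p: "p \<in> fst c"
  obtains \<phi> :: "'p \<Rightarrow> real" and V where "openin (mtop M) V" "p \<in> V" "\<And>q. q \<in> V \<Longrightarrow> 0 < \<phi> q" "\<And>q. 0 \<le> \<phi> q"
    "mtop M closure_of {q \<in> topspace (mtop M). \<phi> q \<noteq> 0} \<subseteq> fst c"
    "\<And>d. d \<in> atlas M \<Longrightarrow> smooth_on (chart_image d) (\<lambda>x. \<phi> (chart_inv d x))"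
proof -
  let ?X = "mtop M" and ?n = "mdim M"
  have chart: "is_chart ?n ?X d" if "d \<in> atlas M" for d using manifold_chart[OF M that] .
  obtain A where A: "openin (top_of_set A) (chart_image c)" "closed A" using chart_model[OF chart[OF c]] by metis
  then obtain r where r: "r > 0" "cball (snd c p) r \<inter> A \<subseteq> chart_image c"
    using p openin_contains_cball[of A "chart_image c"] by blast
  have subA: "chart_image c \<subseteq> A" using A(1) openin_imp_subset by blast
  define K where "K = cball (snd c p) r \<inter> A"
  define C where "C = chart_inv c ` K"
  have "compact K" unfolding K_def using A(2) by (simp add: compact_Int_closed)
  then have "compactin (top_of_set (chart_image c)) K"
    using r(2) by (simp add: compactin_subtopology K_def)
  then have "compactin ?X C"
    unfolding C_def by (rule image_compactin) (rule chart_inv_continuous_map[OF chart[OF c]])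
  moreover have "Hausdorff_space ?X" using M by (simp add: smooth_manifold_def)
  ultimately have closedC: "closedin ?X C" by (rule compactin_imp_closedin[rotated])
  have C_sub: "C \<subseteq> fst c" 
  proof -
    have "chart_inv c x \<in> fst c" if "x \<in> K" for x
      by (rule chart_inv_in) (use that r(2) in \<open>unfold K_def, blast\<close>)
    then show ?thesis unfolding C_def by blast
  qed
  define \<phi> where "\<phi> = (\<lambda>q. if q \<in> fst c
    then flat_exp 0 (r\<^sup>2 - (snd c q - snd c p) \<bullet> (snd c q - snd c p)) else 0)"
  have pos: "\<phi> q > 0 \<longleftrightarrow> q \<in> fst c \<and> dist (snd c p) (snd c q) < r" for q
  proof -
    let ?u = "snd c q - snd c p"
    have "(norm ?u)\<^sup>2 < r\<^sup>2 \<longleftrightarrow> norm ?u < r"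
      using power2_less_imp_less[of "norm ?u" r] power_strict_mono[of "norm ?u" r 2] r(1) by auto
    then show ?thesis
      by (simp add: \<phi>_def flat_exp_def power2_norm_eq_inner[symmetric] dist_norm norm_minus_commute)
  qed
  have nonneg: "0 \<le> \<phi> q" for q by (simp add: \<phi>_def flat_exp_def)
  have supp: "\<phi> q \<noteq> 0 \<Longrightarrow> q \<in> C" for q
  proof -
    assume "\<phi> q \<noteq> 0"
    then have "q \<in> fst c" "dist (snd c p) (snd c q) < r"
      using pos[of q] nonneg[of q] by linarith+
    then have "snd c q \<in> K" unfolding K_def using subA by auto
    then show "q \<in> C" unfolding C_def
      using chart_inv_left[OF chart[OF c] \<open>q \<in> fst c\<close>] by force
  qed
  let ?V = "{q \<in> topspace (subtopology ?X (fst c)). snd c q \<in> ball (snd c p) r}"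
  show thesis
  proof (rule that[of ?V \<phi>])
    have "openin (subtopology ?X (fst c)) ?V"
      by (rule openin_continuous_map_preimage[OF chart_continuous_map[OF chart[OF c]]]) simp
    then show "openin ?X ?V" using chart_openin[OF chart[OF c]] openin_trans_full by blast
    show "p \<in> ?V" using p r(1) chart_subset_topspace[OF chart[OF c]] by auto
    show "0 < \<phi> q" if "q \<in> ?V" for q using that pos by auto
    show "0 \<le> \<phi> q" for q by (rule nonneg)
    have "{q \<in> topspace ?X. \<phi> q \<noteq> 0} \<subseteq> C" using supp by blast
    then have "?X closure_of {q \<in> topspace ?X. \<phi> q \<noteq> 0} \<subseteq> C" by (rule closure_of_minimal[OF _ closedC])
    then show "?X closure_of {q \<in> topspace ?X. \<phi> q \<noteq> 0} \<subseteq> fst c" using C_sub by blast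
    show "smooth_on (chart_image d) (\<lambda>x. \<phi> (chart_inv d x))" if d: "d \<in> atlas M" for d
    proof (rule smooth_on_local_openin)
      fix x assume x: "x \<in> chart_image d"
      show "\<exists>B. openin (top_of_set (chart_image d)) B \<and> x \<in> B \<and> smooth_on B (\<lambda>x. \<phi> (chart_inv d x))"
      proof (cases "chart_inv d x \<in> fst c")
        case True
        have T: "smooth_on (overlap d c) (transition d c)"
          using M c d unfolding smooth_manifold_def by blast
        have "smooth_on (overlap d c) (\<lambda>y. r\<^sup>2 + (-1) *
            ((transition d c y + - snd c p) \<bullet> (transition d c y + - snd c p)))"
          by (intro smooth_on_add smooth_on_mult smooth_on_inner smooth_on_const T)
        then have "smooth_on (overlap d c) (\<lambda>y. flat_exp 0 (r\<^sup>2 + (-1) *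
            ((transition d c y + - snd c p) \<bullet> (transition d c y + - snd c p))))"
          by (rule smooth_on_compose[of _ _ UNIV]) (auto intro: smooth_onI_Ck[of UNIV] Ck_on_flat_exp)
        moreover have "flat_exp 0 (r\<^sup>2 + (-1) *
            ((transition d c y + - snd c p) \<bullet> (transition d c y + - snd c p))) = \<phi> (chart_inv d y)"
          if "y \<in> overlap d c" for y
        proof -
          have "chart_inv d y \<in> fst c"
            using that chart_inv_left[OF chart[OF d]] by (auto simp: overlap_def)
          then show ?thesis by (simp add: \<phi>_def transition_def)
        qed
        ultimately have "smooth_on (overlap d c) (\<lambda>y. \<phi> (chart_inv d y))"
          using smooth_on_cong[of "overlap d c"] by (metis (no_types, lifting))
        moreover have "x \<in> overlap d c"
          using True x chart_image_Int[OF chart[OF d]] unfolding overlap_def by blast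
        ultimately show ?thesis using overlap_openin[OF chart[OF d] chart[OF c]] by blast
      next
        case False
        let ?B = "snd d ` (fst d \<inter> (topspace ?X - C))"
        have "openin (top_of_set (chart_image d)) ?B"
          using closedC by (intro chart_image_Int_openin[OF chart[OF d]]) blast
        moreover have "x \<in> ?B"
          using False C_sub x chart_inv_in[OF x] chart_subset_topspace[OF chart[OF d]]
          unfolding chart_image_Int[OF chart[OF d]] by blast
        moreover have "\<phi> (chart_inv d y) = 0" if "y \<in> ?B" for y
          using that supp unfolding chart_image_Int[OF chart[OF d]] by blast
        then have "smooth_on ?B (\<lambda>x. \<phi> (chart_inv d x))"
          using smooth_on_cong[of ?B "\<lambda>x. \<phi> (chart_inv d x)" "\<lambda>x. 0"] smooth_on_const by blast
        ultimately show ?thesis by blast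
      qed
    qed
  qed
qed

lemma partition_of_unity_exists:
  assumes M: "smooth_manifold M" and comp: "compact_space (mtop M)"
  shows "\<exists>k c \<rho>. partition_of_unity M k c \<rho>"
proof -
  let ?X = "mtop M"
  define good where "good = (\<lambda>p c (\<phi> :: _ \<Rightarrow> real) V. c \<in> atlas M \<and> openin ?X V \<and> p \<in> V \<and>
    (\<forall>q\<in>V. 0 < \<phi> q) \<and> (\<forall>q. 0 \<le> \<phi> q) \<and>
    ?X closure_of {q \<in> topspace ?X. \<phi> q \<noteq> 0} \<subseteq> fst c \<and>
    (\<forall>d\<in>atlas M. smooth_on (chart_image d) (\<lambda>x. \<phi> (chart_inv d x))))"
  have "\<exists>c \<phi> V. good p c \<phi> V"
    if "p \<in> topspace ?X" for p
  proof -
    from manifold_covered[OF M that] obtain c where c: "c \<in> atlas M" "p \<in> fst c" by blast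
    show ?thesis
    proof (rule smooth_bump_exists[OF M c])
      fix \<phi> V
      assume *: "openin ?X V" "p \<in> V" "\<And>q. q \<in> V \<Longrightarrow> 0 < \<phi> q" "\<And>q. 0 \<le> (\<phi> q :: real)"
        "?X closure_of {q \<in> topspace ?X. \<phi> q \<noteq> 0} \<subseteq> fst c"
        "\<And>d. d \<in> atlas M \<Longrightarrow> smooth_on (chart_image d) (\<lambda>x. \<phi> (chart_inv d x))"
      show ?thesis
        unfolding good_def by (intro exI[of _ c] exI[of _ \<phi>] exI[of _ V] conjI ballI allI c(1) *)
    qed
  qed
  then obtain c \<phi> V where "\<And>p. p \<in> topspace ?X \<Longrightarrow> good p (c p) (\<phi> p) (V p)"
    by metis
  note * = this[unfolded good_def]
  have "\<exists>\<F>. finite \<F> \<and> \<F> \<subseteq> V ` topspace ?X \<and> topspace ?X \<subseteq> \<Union>\<F>"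
  proof (rule comp[unfolded compact_space_alt, THEN spec, THEN mp], intro conjI ballI subsetI)
    show "openin ?X U" if "U \<in> V ` topspace ?X" for U using that * by auto
    show "p \<in> \<Union> (V ` topspace ?X)" if "p \<in> topspace ?X" for p using that *[OF that] by auto
  qed
  then obtain D where D: "finite D" "D \<subseteq> topspace ?X" "topspace ?X \<subseteq> (\<Union>p\<in>D. V p)"
    by (metis finite_subset_image)
  obtain h where h: "bij_betw h {..<card D} D"
    using ex_bij_betw_nat_finite[OF D(1)] by (metis atLeast0LessThan)
  have hD: "h i \<in> topspace ?X" if "i < card D" for i
    using h D(2) that bij_betwE by fastforce
  define \<Phi> where "\<Phi> = (\<lambda>q. \<Sum>i<card D. \<phi> (h i) q)"
  have \<Phi>: "\<Phi> q > 0" if q: "q \<in> topspace ?X" for q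
  proof -
    obtain p where "p \<in> D" "q \<in> V p" using D(3) q by blast
    then obtain i where "i < card D" "q \<in> V (h i)" using h unfolding bij_betw_def by force
    then show ?thesis unfolding \<Phi>_def
      using * hD by (intro sum_pos2[of _ i]) auto
  qed
  have "partition_of_unity M (card D) (\<lambda>i. c (h i)) (\<lambda>i q. \<phi> (h i) q * inverse (\<Phi> q))"
    unfolding partition_of_unity_def
  proof (intro conjI allI impI ballI)
    fix i assume i: "i < card D"
    show "c (h i) \<in> atlas M" using * hD[OF i] by blast
    show "smooth_on (snd d ` fst d) ((\<lambda>q. \<phi> (h i) q * inverse (\<Phi> q)) \<circ> chart_inv d)" if d: "d \<in> atlas M" for d
    proof -
      have "chart_inv d x \<in> topspace ?X" if "x \<in> chart_image d" for x
        using chart_inv_in[OF that] chart_subset_topspace[OF manifold_chart[OF M d]] by blast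
      then have "\<Phi> (chart_inv d x) \<noteq> 0" if "x \<in> chart_image d" for x
        using \<Phi> that by (metis less_irrefl)
      moreover have "smooth_on (chart_image d) (\<lambda>x. \<phi> (h j) (chart_inv d x))" if "j < card D" for j
        using * hD[OF that] d by blast
      ultimately have "smooth_on (chart_image d) (\<lambda>x. \<phi> (h i) (chart_inv d x) * inverse (\<Sum>j<card D. \<phi> (h j) (chart_inv d x)))"
        using i unfolding \<Phi>_def by (intro smooth_on_mult smooth_on_inverse smooth_on_sum) auto
      then show ?thesis by (simp add: o_def \<Phi>_def)
    qed
    show "0 \<le> \<phi> (h i) p * inverse (\<Phi> p)" if "p \<in> topspace ?X" for p
      using * hD[OF i] \<Phi>[OF that] by simp
    have "{p \<in> topspace ?X. \<phi> (h i) p * inverse (\<Phi> p) \<noteq> 0} \<subseteq> {p \<in> topspace ?X. \<phi> (h i) p \<noteq> 0}" by auto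
    then show "?X closure_of {p \<in> topspace ?X. \<phi> (h i) p * inverse (\<Phi> p) \<noteq> 0} \<subseteq> fst (c (h i))"
      using *[OF hD[OF i]] by (blast dest: closure_of_mono[of _ _ ?X])
  next
    fix p assume "p \<in> topspace ?X"
    then show "(\<Sum>i<card D. \<phi> (h i) p * inverse (\<Phi> p)) = 1"
      using \<Phi>[of p] by (simp add: sum_distrib_right[symmetric] \<Phi>_def)
  qed
  then show ?thesis by blast
qed

section \<open>Pulling back a closed form along a variation\<close>

text \<open>The time interval is kept as an open factor: all statements about the variation are statements about
  functions on \<open>times \<times> chart_image c\<close>.\<close>

locale closed_form_variation =
  fixes M :: "('p, 'm::{finite,wellorder}) manifold" and N :: "('q, 'n::{finite,wellorder}) manifold"
    and \<omega> :: "('q, 'n) form" and \<epsilon> :: real and F :: "real \<Rightarrow> 'p \<Rightarrow> 'q"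
  assumes M: "smooth_manifold M" and N: "smooth_manifold N"
    and \<omega>: "differential_form (mdim M) N \<omega>" and closed: "closed_form (mdim M) N \<omega>"
    and \<epsilon>: "\<epsilon> > 0" and F: "smooth_variation M N \<epsilon> F"
begin

abbreviation times :: "real set" where "times \<equiv> {-\<epsilon><..<\<epsilon>}"

definition rep_dom :: "('p, 'm) chart \<Rightarrow> ('q, 'n) chart \<Rightarrow> (real \<times> 'm rn) set"
  where "rep_dom c d = {(t, x). t \<in> times \<and> x \<in> local_dom c d (F t)}"

definition rep :: "('p, 'm) chart \<Rightarrow> ('q, 'n) chart \<Rightarrow> real \<times> 'm rn \<Rightarrow> 'n rn"
  where "rep c d = (\<lambda>(t, x). local_rep c d (F t) x)"

definition rep_deriv :: "('p, 'm) chart \<Rightarrow> ('q, 'n) chart \<Rightarrow> real \<times> 'm rn \<Rightarrow> real \<times> 'm rn \<Rightarrow> 'n rn"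
  where "rep_deriv c d z = frechet_derivative (rep c d) (at z within rep_dom c d)"

text \<open>The pullback of \<open>\<omega>\<close> along the map \<open>(t, p) \<mapsto> F t p\<close> in the chart \<open>c\<close>; its arguments are
  tangent vectors of \<open>\<real> \<times> M\<close>. The chart \<open>d\<close> is chosen as in \<open>pullback\<close>.\<close>

definition pulled :: "('p, 'm) chart \<Rightarrow> real \<times> 'm rn \<Rightarrow> (nat \<Rightarrow> real \<times> 'm rn) \<Rightarrow> real"
  where "pulled c z u =
    (let d = (SOME d. d \<in> atlas N \<and> F (fst z) (chart_inv c (snd z)) \<in> fst d)
     in \<omega> d (rep c d z) (\<lambda>i. rep_deriv c d z (u i)))"

lemma M_chart: "c \<in> atlas M \<Longrightarrow> is_chart (mdim M) (mtop M) c"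
  using manifold_chart[OF M] .

lemma N_chart: "d \<in> atlas N \<Longrightarrow> is_chart (mdim N) (mtop N) d"
  using manifold_chart[OF N] .

lemma F_maps: "t \<in> times \<Longrightarrow> F t \<in> smooth_maps M N"
  using F unfolding smooth_variation_def by blast

lemma F_in_N:
  assumes "t \<in> times" "c \<in> atlas M" "x \<in> chart_image c"
  shows "F t (chart_inv c x) \<in> topspace (mtop N)"
proof -
  have "chart_inv c x \<in> topspace (mtop M)"
    using chart_inv_in[OF assms(3)] chart_subset_topspace[OF M_chart[OF assms(2)]] by blast
  then show ?thesis
    using F_maps[OF assms(1)] unfolding smooth_maps_def continuous_map_def by blast
qed

lemma rep_dom_eq:
  assumes "c \<in> atlas M"
  shows "rep_dom c d = {z \<in> times \<times> chart_image c. F (fst z) (chart_inv c (snd z)) \<in> fst d}"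
  unfolding rep_dom_def using local_dom_eq[OF M_chart[OF assms], where d = d] by auto

lemma rep_dom_covered:
  assumes "c \<in> atlas M" "z \<in> times \<times> chart_image c"
  obtains d where "d \<in> atlas N" "z \<in> rep_dom c d"
  using manifold_covered[OF N F_in_N[of "fst z" c "snd z"]] assms rep_dom_eq[OF assms(1)] by auto

lemma rep_dom_openin:
  assumes c: "c \<in> atlas M" and d: "d \<in> atlas N"
  shows "openin (top_of_set (times \<times> chart_image c)) (rep_dom c d)"
proof -
  have 1: "continuous_map (top_of_set (times \<times> chart_image c)) (top_of_set times) fst"
    by (auto intro: continuous_intros)
  have 2: "continuous_map (top_of_set (times \<times> chart_image c)) (top_of_set (chart_image c)) snd"
    by (auto intro: continuous_intros)
  have "continuous_map (top_of_set (times \<times> chart_image c)) (mtop M) (\<lambda>z. chart_inv c (snd z))"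
    using continuous_map_compose[OF 2 chart_inv_continuous_map[OF M_chart[OF c]]] by (simp add: o_def)
  then have "continuous_map (top_of_set (times \<times> chart_image c)) (prod_topology (top_of_set times) (mtop M))
      (\<lambda>z. (fst z, chart_inv c (snd z)))"
    by (intro continuous_map_pairedI 1)
  moreover have "continuous_map (prod_topology (top_of_set times) (mtop M)) (mtop N) (\<lambda>(t, p). F t p)"
    using F unfolding smooth_variation_def by blast
  ultimately have "continuous_map (top_of_set (times \<times> chart_image c)) (mtop N) (\<lambda>z. F (fst z) (chart_inv c (snd z)))"
    using continuous_map_compose by (fastforce simp: o_def)
  from openin_continuous_map_preimage[OF this chart_openin[OF N_chart[OF d]]]
  show ?thesis unfolding rep_dom_eq[OF c] by simp
qed

lemma rep_in: "c \<in> atlas M \<Longrightarrow> z \<in> rep_dom c d \<Longrightarrow> rep c d z \<in> chart_image d"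
  by (auto simp: rep_dom_eq rep_def local_rep_def)

lemma rep_smooth: "c \<in> atlas M \<Longrightarrow> d \<in> atlas N \<Longrightarrow> smooth_on (rep_dom c d) (rep c d)"
  using F unfolding smooth_variation_def rep_dom_def rep_def by blast

lemma fat_domain:
  assumes "mdim M \<noteq> 0" "c \<in> atlas M"
  shows "fat (times \<times> chart_image c)"
  by (intro fat_Times fat_open fat_chart_image[OF M_chart[OF assms(2)] assms(1)]) simp

lemma fat_rep_dom:
  assumes "mdim M \<noteq> 0" "c \<in> atlas M" "d \<in> atlas N"
  shows "fat (rep_dom c d)"
  using fat_openin[OF fat_domain[OF assms(1,2)] rep_dom_openin[OF assms(2,3)]] .

lemma rep_has_derivative:
  assumes "c \<in> atlas M" "d \<in> atlas N" "z \<in> rep_dom c d"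
  shows "(rep c d has_derivative rep_deriv c d z) (at z within rep_dom c d)"
  unfolding rep_deriv_def by (rule smooth_on_has_derivative[OF rep_smooth[OF assms(1,2)] assms(3)])

lemma rep_deriv_linear:
  assumes "c \<in> atlas M" "d \<in> atlas N" "z \<in> rep_dom c d"
  shows "linear (rep_deriv c d z)"
  using rep_has_derivative[OF assms] has_derivative_linear by blast

lemma rep_deriv_in:
  assumes "mdim M \<noteq> 0" "c \<in> atlas M" "d \<in> atlas N" "z \<in> rep_dom c d"
  shows "rep_deriv c d z u \<in> coord_space (mdim N)"
  using rep_has_derivative[OF assms(2-)] rep_in[OF assms(2)] chart_image_subset_coord_space[OF N_chart[OF assms(3)]]
  by (intro derivative_in_coord_space[OF fat_rep_dom[OF assms(1-3)] assms(4)]) blast+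

lemma rep_change:
  assumes "c \<in> atlas M" "d \<in> atlas N" "z \<in> rep_dom c d" "z \<in> rep_dom c d'"
  shows "rep c d' z = transition d d' (rep c d z)" "rep c d z \<in> overlap d d'"
  using assms chart_inv_left[OF N_chart[OF assms(2)]]
  by (auto simp: rep_dom_eq rep_def local_rep_def transition_def overlap_def)

text \<open>The chain rule on the common domain of the two representations, together with uniqueness of
  derivatives there.\<close>

lemma rep_deriv_change:
  assumes m: "mdim M \<noteq> 0" and c: "c \<in> atlas M" and d: "d \<in> atlas N" "d' \<in> atlas N"
    and z: "z \<in> rep_dom c d" "z \<in> rep_dom c d'"
  shows "rep_deriv c d' z u = transition_deriv d d' (F (fst z) (chart_inv c (snd z))) (rep_deriv c d z u)"
proof -
  let ?D = "rep_dom c d \<inter> rep_dom c d'" and ?p = "F (fst z) (chart_inv c (snd z))"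
  have zD: "z \<in> ?D" using z by blast
  have "fat ?D"
    by (intro fat_openin[OF fat_domain[OF m c]] openin_Int rep_dom_openin c d)
  have rep_z: "rep c d z = snd d ?p" by (simp add: rep_def local_rep_def case_prod_unfold)
  have "smooth_on (overlap d d') (transition d d')"
    using N d unfolding smooth_manifold_def by blast
  then have "(transition d d' has_derivative transition_deriv d d' ?p) (at (rep c d z) within overlap d d')"
    unfolding transition_deriv_def rep_z[symmetric]
    by (rule smooth_on_has_derivative) (use rep_change[OF c d(1) z] in simp)
  moreover have "rep c d ` ?D \<subseteq> overlap d d'" using rep_change(2)[OF c d(1)] by blast
  ultimately have "(transition d d' has_derivative transition_deriv d d' ?p) (at (rep c d z) within rep c d ` ?D)"
    by (rule has_derivative_subset)
  then have "((\<lambda>z. transition d d' (rep c d z)) has_derivative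
      (\<lambda>u. transition_deriv d d' ?p (rep_deriv c d z u))) (at z within ?D)"
    by (rule has_derivative_in_compose[OF has_derivative_subset[OF rep_has_derivative[OF c d(1) z(1)] Int_lower1]])
  then have "(rep c d' has_derivative (\<lambda>u. transition_deriv d d' ?p (rep_deriv c d z u))) (at z within ?D)"
  proof (rule has_derivative_transform[OF zD, rotated])
    show "rep c d' y = transition d d' (rep c d y)" if "y \<in> ?D" for y
      using that rep_change(1)[OF c d(1)] by blast
  qed
  moreover have "(rep c d' has_derivative rep_deriv c d' z) (at z within ?D)"
    using has_derivative_subset[OF rep_has_derivative[OF c d(2) z(2)], of ?D] by blast
  ultimately show ?thesis using fat_derivative_unique[OF \<open>fat ?D\<close> zD] by metis
qed

lemma \<omega>_alternating: "d \<in> atlas N \<Longrightarrow> y \<in> chart_image d \<Longrightarrow> alternating_form (mdim M) (coord_space (mdim N)) (\<omega> d y)"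
  using \<omega> unfolding differential_form_def by blast

lemma \<omega>_smooth: "d \<in> atlas N \<Longrightarrow> (\<And>i. v i \<in> coord_space (mdim N)) \<Longrightarrow> smooth_on (chart_image d) (\<lambda>y. \<omega> d y v)"
  using \<omega> unfolding differential_form_def by blast

text \<open>The transformation law of \<open>\<omega>\<close> absorbs the change of the derivative, so any chart around the image
  point may be used.\<close>

lemma pulled_eq:
  assumes m: "mdim M \<noteq> 0" and c: "c \<in> atlas M" and d: "d \<in> atlas N" and z: "z \<in> rep_dom c d"
  shows "pulled c z u = \<omega> d (rep c d z) (\<lambda>i. rep_deriv c d z (u i))"
proof -
  let ?p = "F (fst z) (chart_inv c (snd z))"
  define d' where "d' = (SOME d. d \<in> atlas N \<and> ?p \<in> fst d)"
  have "d \<in> atlas N \<and> ?p \<in> fst d" using d z rep_dom_eq[OF c] by auto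
  then have d': "d' \<in> atlas N" "?p \<in> fst d'" unfolding d'_def by (metis (mono_tags, lifting) someI)+
  have z': "z \<in> rep_dom c d'" using z d' rep_dom_eq[OF c] by auto
  have p: "?p \<in> fst d \<inter> fst d'" using z z' rep_dom_eq[OF c] by auto
  have rep_z: "rep c e z = snd e ?p" for e by (simp add: rep_def local_rep_def case_prod_unfold)
  have in_T: "\<forall>i. rep_deriv c d z (u i) \<in> coord_space (mdim N)"
    using rep_deriv_in[OF m c d z] by blast
  have law: "\<forall>c\<in>atlas N. \<forall>d\<in>atlas N. \<forall>p\<in>fst c \<inter> fst d. \<forall>v. (\<forall>i. v i \<in> coord_space (mdim N)) \<longrightarrow>
      \<omega> c (snd c p) v = \<omega> d (snd d p) (\<lambda>i. transition_deriv c d p (v i))"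
    using \<omega> unfolding differential_form_def by (elim conjE)
  have "\<omega> d (snd d ?p) (\<lambda>i. rep_deriv c d z (u i)) =
      \<omega> d' (snd d' ?p) (\<lambda>i. transition_deriv d d' ?p (rep_deriv c d z (u i)))"
    by (rule law[rule_format, OF d d'(1) p]) (use in_T in blast)
  then show ?thesis
    unfolding pulled_def Let_def d'_def[symmetric] rep_z
    using rep_deriv_change[OF m c d d'(1) z z'] by simp
qed

lemma pulled_alternating:
  assumes m: "mdim M \<noteq> 0" and c: "c \<in> atlas M" and z: "z \<in> times \<times> chart_image c"
  shows "alternating_form (mdim M) UNIV (pulled c z)"
proof -
  obtain d where d: "d \<in> atlas N" "z \<in> rep_dom c d" using rep_dom_covered[OF c z] .
  note a = \<omega>_alternating[OF d(1) rep_in[OF c d(2)]]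
  note lin = rep_deriv_linear[OF c d]
  have in_T: "rep_deriv c d z u \<in> coord_space (mdim N)" for u
    using rep_deriv_in[OF m c d] .
  let ?L = "rep_deriv c d z"
  have upd: "(\<lambda>j. ?L ((v(i := x)) j)) = (\<lambda>j. ?L (v j))(i := ?L x)" for v i x
    by (auto simp: fun_eq_iff)
  have 1: "pulled c z v = pulled c z w" if "\<forall>i<mdim M. v i = w i" for v w
    unfolding pulled_eq[OF m c d] using that by (intro alternating_form_cong[OF a]) simp
  have 2: "pulled c z (v(i := r *\<^sub>R x + s *\<^sub>R y)) = r * pulled c z (v(i := x)) + s * pulled c z (v(i := y))"
    if "i < mdim M" for v i r x s y
    unfolding pulled_eq[OF m c d] upd linear_add[OF lin] linear_scale[OF lin]
    by (rule alternating_form_linear[OF a _ that]) (use in_T in auto)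
  have 3: "pulled c z v = 0" if "i < mdim M" "j < mdim M" "i \<noteq> j" "v i = v j" for v i j
    unfolding pulled_eq[OF m c d] by (rule alternating_form_repeated[OF a _ that(1-3)]) (use in_T that in auto)
  show ?thesis unfolding alternating_form_def using 1 2 3 by blast
qed

lemma pulled_smooth:
  assumes m: "mdim M \<noteq> 0" and c: "c \<in> atlas M"
  shows "smooth_on (times \<times> chart_image c) (\<lambda>z. pulled c z u)"
proof (rule smooth_on_local_openin)
  fix z assume "z \<in> times \<times> chart_image c"
  then obtain d where d: "d \<in> atlas N" "z \<in> rep_dom c d" using rep_dom_covered[OF c] by blast
  have "smooth_on (rep_dom c d) (\<lambda>y. \<omega> d (rep c d y) (\<lambda>i. rep_deriv c d y (u i)))"
  proof (rule smooth_on_alternating_form)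
    show "alternating_form (mdim M) (coord_space (mdim N)) (\<omega> d (rep c d y))" if "y \<in> rep_dom c d" for y
      using \<omega>_alternating[OF d(1) rep_in[OF c that]] .
    show "smooth_on (rep_dom c d) (\<lambda>y. \<omega> d (rep c d y) v)" if "\<And>i. v i \<in> coord_space (mdim N)" for v
    proof (rule smooth_on_compose[OF rep_smooth[OF c d(1)]])
      show "smooth_on (chart_image d) (\<lambda>y. \<omega> d y v)" using d(1) that by (rule \<omega>_smooth)
      show "rep c d ` rep_dom c d \<subseteq> chart_image d" using rep_in[OF c] by blast
    qed
    show "smooth_on (rep_dom c d) (\<lambda>y. rep_deriv c d y (u i))" for i
      unfolding rep_deriv_def by (rule smooth_on_derivative[OF fat_rep_dom[OF m c d(1)] rep_smooth[OF c d(1)]])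
    show "rep_deriv c d y (u i) \<in> coord_space (mdim N)" if "y \<in> rep_dom c d" for i y
      using rep_deriv_in[OF m c d(1) that] .
  qed
  then have "smooth_on (rep_dom c d) (\<lambda>z. pulled c z u)"
    using pulled_eq[OF m c d(1)] smooth_on_cong[of "rep_dom c d"] by (metis (no_types, lifting))
  then show "\<exists>B. openin (top_of_set (times \<times> chart_image c)) B \<and> z \<in> B \<and> smooth_on B (\<lambda>z. pulled c z u)"
    using rep_dom_openin[OF c d(1)] d(2) by blast
qed

text \<open>Uniqueness of derivatives on the slice identifies the derivative used in \<open>pullback\<close> with the spatial
  part of \<open>rep_deriv\<close>.\<close>

lemma pulled_slice:
  assumes m: "mdim M \<noteq> 0" and c: "c \<in> atlas M" and t: "t \<in> times" and x: "x \<in> chart_image c"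
  shows "pullback N (F t) \<omega> c x v = pulled c (t, x) (\<lambda>i. (0, v i))"
proof -
  define d where "d = (SOME d. d \<in> atlas N \<and> F t (chart_inv c x) \<in> fst d)"
  have "\<exists>d. d \<in> atlas N \<and> F t (chart_inv c x) \<in> fst d"
    using manifold_covered[OF N F_in_N[OF t c x]] by blast
  then have d: "d \<in> atlas N" "F t (chart_inv c x) \<in> fst d" unfolding d_def by (metis (mono_tags, lifting) someI)+
  have z: "(t, x) \<in> rep_dom c d" using d t x rep_dom_eq[OF c] by simp
  let ?U = "local_dom c d (F t)"
  have xU: "x \<in> ?U" using d x local_dom_eq[OF M_chart[OF c], where d = d] by simp
  have sub: "(\<lambda>y. (t, y)) ` ?U \<subseteq> rep_dom c d" using t by (auto simp: rep_dom_def)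
  have "continuous_map (mtop M) (mtop N) (F t)"
    using F_maps[OF t] unfolding smooth_maps_def by blast
  then have "openin (mtop M) {p \<in> topspace (mtop M). F t p \<in> fst d}"
    by (rule openin_continuous_map_preimage[OF _ chart_openin[OF N_chart[OF d(1)]]])
  from chart_image_Int_openin[OF M_chart[OF c] this]
  have "openin (top_of_set (chart_image c)) (snd c ` (fst c \<inter> {p \<in> topspace (mtop M). F t p \<in> fst d}))" .
  moreover have "fst c \<inter> {p \<in> topspace (mtop M). F t p \<in> fst d} = {p \<in> fst c. F t p \<in> fst d}"
    using chart_subset_topspace[OF M_chart[OF c]] by blast
  ultimately have "openin (top_of_set (chart_image c)) ?U" unfolding local_dom_def by simp
  then have "fat ?U" by (rule fat_openin[OF fat_chart_image[OF M_chart[OF c] m]])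
  have "((\<lambda>y. (t, y)) has_derivative (\<lambda>u. (0, u))) (at x within ?U)"
    by (intro has_derivative_Pair has_derivative_const has_derivative_ident)
  moreover have "(rep c d has_derivative rep_deriv c d (t, x)) (at (t, x) within (\<lambda>y. (t, y)) ` ?U)"
    using rep_has_derivative[OF c d(1) z] sub by (rule has_derivative_subset)
  ultimately have "((\<lambda>y. rep c d (t, y)) has_derivative (\<lambda>u. rep_deriv c d (t, x) (0, u))) (at x within ?U)"
    by (rule has_derivative_in_compose)
  moreover have "(\<lambda>y. rep c d (t, y)) = local_rep c d (F t)" by (simp add: rep_def)
  ultimately have "frechet_derivative (local_rep c d (F t)) (at x within ?U) = (\<lambda>u. rep_deriv c d (t, x) (0, u))"
    using fat_frechet_derivative[OF \<open>fat ?U\<close> xU] by simp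
  moreover have "local_rep c d (F t) x = rep c d (t, x)" by (simp add: rep_def)
  ultimately show ?thesis
    unfolding pulled_eq[OF m c d(1) z] pullback_def d_def[symmetric] Let_def by simp
qed

text \<open>This is closedness of the pullback on constant vector fields, solved for the term with the
  derivative in direction \<open>u0\<close>. By the product rule each derivative splits into a derivative of the
  coefficients of \<open>\<omega>\<close> and terms with second derivatives of the map. The former match because \<open>\<omega>\<close> is
  closed; of the latter, those containing \<open>u0\<close> agree on both sides by symmetry of second derivatives,
  and the others cancel in pairs because \<open>\<omega>\<close> is alternating.\<close>

lemma pulled_divergence:
  assumes m: "mdim M \<noteq> 0" and c: "c \<in> atlas M"
    and X: "open X" "X \<subseteq> times \<times> chart_image c" "z \<in> X"
  shows "frechet_derivative (\<lambda>y. pulled c y a) (at z) u0 =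
    (\<Sum>l<mdim M. frechet_derivative (\<lambda>y. pulled c y (a(l := u0))) (at z) (a l))"
proof -
  let ?k = "mdim M"
  have "z \<in> times \<times> chart_image c" using X by blast
  then obtain d where d: "d \<in> atlas N" "z \<in> rep_dom c d" using rep_dom_covered[OF c] by blast
  define Y where "Y = X \<inter> rep_dom c d"
  obtain W where W: "open W" "rep_dom c d = (times \<times> chart_image c) \<inter> W"
    using rep_dom_openin[OF c d(1)] by (auto simp: openin_open)
  have Yeq: "Y = X \<inter> W" unfolding Y_def W(2) using X(2) by blast
  have Y: "open Y" "z \<in> Y" "Y \<subseteq> rep_dom c d" using Yeq X W d(2) by (auto simp: Y_def)
  let ?\<Phi> = "rep c d"
  let ?T = "coord_space (mdim N) :: 'n rn set"
  define D where "D = (\<lambda>u y. frechet_derivative ?\<Phi> (at y) u)"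
  have D: "rep_deriv c d y u = D u y" if "y \<in> Y" for y u
  proof -
    have "y \<in> interior (rep_dom c d)" using that interior_maximal[OF Y(3,1)] by blast
    then show ?thesis unfolding rep_deriv_def D_def using at_within_interior by metis
  qed
  have C: "Ck_on k Y ?\<Phi>" for k
    by (rule smooth_on_open_imp_Ck_on[OF Y(1) smooth_on_subset[OF rep_smooth[OF c d(1)] Y(3)]])
  have \<Phi>': "(?\<Phi> has_derivative (\<lambda>u. D u y)) (at y)" if "y \<in> Y" for y
    unfolding D_def by (rule Ck_on_has_derivative[OF Y(1) C[of "Suc 0"] that])
  define D2 where "D2 = (\<lambda>u v. frechet_derivative (D u) (at z) v)"
  have D': "(D u has_derivative D2 u) (at z)" for u
  proof -
    have "Ck_on (Suc 0) Y (D u)" unfolding D_def by (rule Ck_on_derivative[OF C])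
    then show ?thesis unfolding D2_def using Ck_on_has_derivative[OF Y(1) _ Y(2)] by blast
  qed
  have sym: "D2 u v = D2 v u" for u v
    unfolding D2_def D_def by (rule second_derivative_symmetric[OF Y(1) C Y(2)])
  have D_in: "D u y \<in> ?T" if "y \<in> Y" for u y
    using rep_deriv_in[OF m c d(1), of y u] D[OF that] Y(3) that by auto
  have D2_in: "D2 u v \<in> ?T" for u v
    by (rule derivative_in_coord_space[OF fat_open[OF Y(1)] Y(2) has_derivative_at_withinI[OF D' ]])
       (rule D_in)
  define \<alpha> where "\<alpha> = (\<lambda>y. \<omega> d (?\<Phi> y))"
  have \<alpha>: "alternating_form ?k ?T (\<alpha> y)" if "y \<in> Y" for y
    unfolding \<alpha>_def by (rule \<omega>_alternating[OF d(1) rep_in[OF c]]) (use that Y(3) in blast)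
  define \<kappa> where "\<kappa> = (\<lambda>v. frechet_derivative (\<lambda>y. \<alpha> y v) (at z))"
  have \<omega>': "((\<lambda>y. \<alpha> y v) has_derivative
      (\<lambda>u. frechet_derivative (\<lambda>y. \<omega> d y v) (at (?\<Phi> z) within chart_image d) (D u z))) (at z)"
    if v: "\<And>i. v i \<in> ?T" for v
  proof -
    have "((\<lambda>y. \<omega> d y v) has_derivative frechet_derivative (\<lambda>y. \<omega> d y v) (at (?\<Phi> z) within chart_image d))
        (at (?\<Phi> z) within chart_image d)"
      by (rule smooth_on_has_derivative[OF \<omega>_smooth[OF d(1), of v, OF v] rep_in[OF c d(2)]])
    then have "((\<lambda>y. \<omega> d y v) has_derivative frechet_derivative (\<lambda>y. \<omega> d y v) (at (?\<Phi> z) within chart_image d))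
        (at (?\<Phi> z) within ?\<Phi> ` Y)"
      by (rule has_derivative_subset) (use rep_in[OF c] Y(3) in blast)
    from has_derivative_in_compose[OF has_derivative_at_withinI[OF \<Phi>'[OF Y(2)]] this]
    show ?thesis unfolding \<alpha>_def by (simp add: at_within_open[OF Y(2,1)])
  qed
  have \<kappa>: "((\<lambda>y. \<alpha> y v) has_derivative \<kappa> v) (at z)" if "\<And>i. v i \<in> ?T" for v
    unfolding \<kappa>_def by (rule has_derivative_frechet_derivative[OF \<omega>'[of v, OF that]])
  have \<kappa>_eq: "\<kappa> v u = frechet_derivative (\<lambda>y. \<omega> d y v) (at (?\<Phi> z) within chart_image d) (D u z)"
    if "\<And>i. v i \<in> ?T" for v u
    using has_derivative_unique[OF \<kappa>[of v, OF that] \<omega>'[of v, OF that]] by simp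
  have pulled': "frechet_derivative (\<lambda>y. pulled c y b) (at z) u =
      \<kappa> (\<lambda>i. D (b i) z) u + (\<Sum>j<?k. \<alpha> z ((\<lambda>i. D (b i) z)(j := D2 (b j) u)))" for b u
  proof -
    have "((\<lambda>y. \<alpha> y (\<lambda>i. D (b i) y)) has_derivative
      (\<lambda>u. \<kappa> (\<lambda>i. D (b i) z) u + (\<Sum>j<?k. \<alpha> z ((\<lambda>i. D (b i) z)(j := D2 (b j) u))))) (at z)"
      by (rule has_derivative_alternating_form[where \<alpha> = \<alpha> and \<kappa> = \<kappa> and n = "mdim N" and X = Y
            and w = "\<lambda>i. D (b i)" and w' = "\<lambda>i. D2 (b i)", OF Y(1,2)])
         (fact \<alpha> \<kappa> | rule D' D_in D2_in, assumption?)+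
    then have "((\<lambda>y. pulled c y b) has_derivative
      (\<lambda>u. \<kappa> (\<lambda>i. D (b i) z) u + (\<Sum>j<?k. \<alpha> z ((\<lambda>i. D (b i) z)(j := D2 (b j) u))))) (at z)"
    proof (rule has_derivative_transform_within_open[OF _ Y(1,2)])
      fix y assume y: "y \<in> Y"
      then have "y \<in> rep_dom c d" using Y(3) by blast
      then show "\<alpha> y (\<lambda>i. D (b i) y) = pulled c y b"
        by (simp add: pulled_eq[OF m c d(1)] \<alpha>_def D[OF y])
    qed
    from fun_cong[OF frechet_derivative_at[OF this], of u] show ?thesis by (rule HOL.sym)
  qed
  define W where "W = (\<lambda>i. D (a i) z)"
  define V where "V = D u0 z"
  have W_in: "W i \<in> ?T" for i unfolding W_def by (rule D_in[OF Y(2)])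
  have V_in: "V \<in> ?T" unfolding V_def by (rule D_in[OF Y(2)])
  (* the terms with a second derivative that does not involve u0; they cancel in pairs *)
  define \<beta> where "\<beta> = (\<lambda>l j. \<alpha> z (W(l := V, j := D2 (a j) (a l))))"
  have "(\<Sum>l<?k. \<Sum>j\<in>{..<?k} - {l}. \<beta> l j) = 0"
  proof (rule antisymmetric_sum_zero)
    fix i j assume "i \<in> {..<?k}" "j \<in> {..<?k}" "i \<noteq> j"
    then show "\<beta> i j = - \<beta> j i"
      unfolding \<beta>_def sym[of "a i" "a j"]
      using alternating_form_swap[OF \<alpha>[OF Y(2)] subspace_coord_space W_in, of i j V "D2 (a j) (a i)"]
        V_in D2_in fun_upd_twist[of i j W "D2 (a j) (a i)" V] by simp
  qed simp
  moreover have "frechet_derivative (\<lambda>y. pulled c y (a(l := u0))) (at z) (a l) =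
      \<kappa> (W(l := V)) (a l) + \<alpha> z (W(l := D2 (a l) u0)) + (\<Sum>j\<in>{..<?k} - {l}. \<beta> l j)" if l: "l < ?k" for l
  proof -
    have eq: "(\<lambda>i. D ((a(l := u0)) i) z) = W(l := V)" by (auto simp: W_def V_def fun_eq_iff)
    have "(\<Sum>j<?k. \<alpha> z ((W(l := V))(j := D2 ((a(l := u0)) j) (a l)))) =
        \<alpha> z (W(l := V, l := D2 u0 (a l))) + (\<Sum>j\<in>{..<?k} - {l}. \<beta> l j)"
      using l by (subst sum.remove[of _ l]) (auto simp: \<beta>_def intro!: sum.cong)
    then show ?thesis unfolding pulled' eq by (simp add: sym[of u0])
  qed
  ultimately have "(\<Sum>l<?k. frechet_derivative (\<lambda>y. pulled c y (a(l := u0))) (at z) (a l)) =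
      (\<Sum>l<?k. \<kappa> (W(l := V)) (a l)) + (\<Sum>l<?k. \<alpha> z (W(l := D2 (a l) u0)))"
    by (simp add: sum.distrib)
  moreover have "frechet_derivative (\<lambda>y. pulled c y a) (at z) u0 =
      \<kappa> W u0 + (\<Sum>l<?k. \<alpha> z (W(l := D2 (a l) u0)))"
    unfolding pulled' W_def ..
  moreover have "\<kappa> W u0 = (\<Sum>l<?k. \<kappa> (W(l := V)) (a l))"
  proof -
    (* closedness is applied to the image of u0 followed by the images of the a i *)
    define v where "v = case_nat V W"
    define u where "u = case_nat u0 a"
    define omit where "omit = (\<lambda>i j. if j < i then v j else v (Suc j))"
    have v_in: "v i \<in> ?T" for i using V_in W_in by (cases i) (auto simp: v_def)
    have omit_in: "omit i j \<in> ?T" for i j using v_in by (simp add: omit_def)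
    have vu: "v i = D (u i) z" for i by (cases i) (auto simp: v_def u_def V_def W_def)
    have "exterior_deriv ?k \<omega> d (?\<Phi> z) v = 0"
      using closed d(1) rep_in[OF c d(2)] v_in unfolding closed_form_def by blast
    moreover have "\<kappa> (omit i) (u i) = frechet_derivative
        (\<lambda>y. \<omega> d y (\<lambda>j. if j < i then v j else v (Suc j))) (at (?\<Phi> z) within chart_image d) (v i)" for i
      using \<kappa>_eq[of "omit i", OF omit_in] by (simp add: omit_def vu)
    ultimately have "(\<Sum>i\<le>?k. (-1) ^ i * \<kappa> (omit i) (u i)) = 0"
      by (simp add: exterior_deriv_def)
    moreover have "omit 0 = W" by (simp add: omit_def v_def fun_eq_iff)
    moreover have "\<kappa> (omit (Suc l)) = (\<lambda>u. (-1) ^ l * \<kappa> (W(l := V)) u)" if l: "l < ?k" for l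
    proof -
      have "\<alpha> y (omit (Suc l)) = (-1) ^ l * \<alpha> y (W(l := V))" if "y \<in> Y" for y
        unfolding omit_def v_def
        by (rule alternating_form_move_front[OF \<alpha>[OF that] subspace_coord_space W_in V_in l])
      note eq = this
      have "((\<lambda>y. (-1) ^ l * \<alpha> y (W(l := V))) has_derivative
          (\<lambda>u. (-1) ^ l * \<kappa> (W(l := V)) u)) (at z)"
        by (intro has_derivative_mult_right \<kappa>) (use V_in W_in in simp)
      then have "((\<lambda>y. \<alpha> y (omit (Suc l))) has_derivative
          (\<lambda>u. (-1) ^ l * \<kappa> (W(l := V)) u)) (at z)"
        by (rule has_derivative_transform_within_open[OF _ Y(1,2)]) (simp only: eq)
      then show ?thesis using has_derivative_unique[OF \<kappa>[of "omit (Suc l)", OF omit_in]] by blast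
    qed
    ultimately have "\<kappa> W u0 + (\<Sum>l<?k. (-1) ^ Suc l * ((-1) ^ l * \<kappa> (W(l := V)) (a l))) = 0"
      by (simp add: sum.atMost_shift u_def)
    moreover have "(-1) ^ Suc l * ((-1) ^ l * r) = - r" for l and r :: real
      by (simp add: power_mult_distrib[symmetric] mult.assoc[symmetric])
    ultimately show ?thesis by (simp only: sum_negf)
  qed
  ultimately show ?thesis by simp
qed

text \<open>The map in the chart \<open>c\<close> is the map in the chart \<open>c'\<close> after the transition map, which leaves the time
  coordinate alone.\<close>

lemma pulled_chart_change:
  assumes m: "mdim M \<noteq> 0" and c: "c \<in> atlas M" "c' \<in> atlas M" and t: "t \<in> times"
    and p: "p \<in> fst c" "p \<in> fst c'"
  shows "pulled c (t, snd c p) (\<lambda>i. (s i, v i)) =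
    pulled c' (t, snd c' p) (\<lambda>i. (s i, transition_deriv c c' p (v i)))"
proof -
  let ?x = "snd c p" and ?x' = "snd c' p" and ?T = "transition c c'" and ?DT = "transition_deriv c c' p"
  note inv = chart_inv_left[OF M_chart[OF c(1)]] and inv' = chart_inv_left[OF M_chart[OF c(2)]]
  have x: "?x \<in> chart_image c" "?x' \<in> chart_image c'" "?x \<in> overlap c c'" using p by (auto simp: overlap_def)
  obtain d where d: "d \<in> atlas N" "(t, ?x) \<in> rep_dom c d"
    using rep_dom_covered[OF c(1), of "(t, ?x)"] t x(1) by blast
  have d': "(t, ?x') \<in> rep_dom c' d"
    using d t x p unfolding rep_dom_eq[OF c(1)] rep_dom_eq[OF c(2)] by (simp add: inv inv')
  define D where "D = rep_dom c d \<inter> (times \<times> overlap c c')"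
  define G where "G = (\<lambda>z :: real \<times> 'm rn. (fst z, ?T (snd z)))"
  have zD: "(t, ?x) \<in> D" using d t x by (simp add: D_def)
  have "openin (top_of_set (times \<times> chart_image c)) (times \<times> overlap c c')"
    by (intro openin_Times overlap_openin[OF M_chart[OF c(1)] M_chart[OF c(2)]]) simp
  then have "openin (top_of_set (times \<times> chart_image c)) D"
    unfolding D_def by (intro openin_Int rep_dom_openin c d)
  then have fatD: "fat D" by (rule fat_openin[OF fat_domain[OF m c(1)]])
  have G: "G z \<in> rep_dom c' d" "rep c' d (G z) = rep c d z" if zD: "z \<in> D" for z
  proof -
    obtain s q where z: "z = (s, snd c q)" "s \<in> times" "q \<in> fst c" "q \<in> fst c'"
      using zD unfolding D_def overlap_def by auto
    have "F s q \<in> fst d" using zD z unfolding D_def rep_dom_eq[OF c(1)] by (simp add: inv)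
    moreover have "G z = (s, snd c' q)" using z by (simp add: G_def transition_def inv)
    ultimately show "G z \<in> rep_dom c' d" "rep c' d (G z) = rep c d z"
      using z unfolding rep_dom_eq[OF c(2)] by (simp_all add: inv inv' rep_def local_rep_def)
  qed
  have Gz: "G (t, ?x) = (t, ?x')" using p by (simp add: G_def transition_def inv)
  have "smooth_on (overlap c c') ?T"
    using M c unfolding smooth_manifold_def by blast
  then have T: "(?T has_derivative ?DT) (at ?x within overlap c c')"
    unfolding transition_deriv_def by (rule smooth_on_has_derivative) (rule x(3))
  have "(snd has_derivative snd) (at (t, ?x) within D)"
    by (rule has_derivative_snd[OF has_derivative_ident])
  moreover have "(?T has_derivative ?DT) (at (snd (t, ?x)) within snd ` D)"
    by (rule has_derivative_subset[of _ _ _ "overlap c c'"]) (use T in \<open>auto simp: D_def\<close>)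
  ultimately have "((\<lambda>z. ?T (snd z)) has_derivative (\<lambda>u. ?DT (snd u))) (at (t, ?x) within D)"
    by (rule has_derivative_in_compose)
  then have "(G has_derivative (\<lambda>u. (fst u, ?DT (snd u)))) (at (t, ?x) within D)"
    unfolding G_def by (intro has_derivative_Pair has_derivative_fst has_derivative_ident)
  moreover have "(rep c' d has_derivative rep_deriv c' d (t, ?x')) (at (G (t, ?x)) within G ` D)"
    by (rule has_derivative_subset[of _ _ _ "rep_dom c' d"])
       (use rep_has_derivative[OF c(2) d(1) d'] Gz G(1) in auto)
  ultimately have "((\<lambda>z. rep c' d (G z)) has_derivative
      (\<lambda>u. rep_deriv c' d (t, ?x') (fst u, ?DT (snd u)))) (at (t, ?x) within D)"
    by (rule has_derivative_in_compose)
  then have "(rep c d has_derivative (\<lambda>u. rep_deriv c' d (t, ?x') (fst u, ?DT (snd u)))) (at (t, ?x) within D)"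
    by (rule has_derivative_transform[OF zD, rotated]) (simp add: G(2))
  moreover have "(rep c d has_derivative rep_deriv c d (t, ?x)) (at (t, ?x) within D)"
    by (rule has_derivative_subset[OF rep_has_derivative[OF c(1) d]]) (simp add: D_def)
  ultimately have "rep_deriv c d (t, ?x) = (\<lambda>u. rep_deriv c' d (t, ?x') (fst u, ?DT (snd u)))"
    using fat_derivative_unique[OF fatD zD] by blast
  moreover have "rep c d (t, ?x) = rep c' d (t, ?x')" using G(2)[OF zD] Gz by simp
  ultimately show ?thesis
    unfolding pulled_eq[OF m c(1) d] pulled_eq[OF m c(2) d(1) d'] by simp
qed

text \<open>The argument in position \<open>l\<close> is the time direction, along which the derivative of the map vanishes.\<close>

lemma pulled_stationary:
  assumes m: "mdim M \<noteq> 0" and c: "c \<in> atlas M" and x: "x \<in> chart_image c"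
    and stat: "\<And>s. s \<in> times \<Longrightarrow> F s (chart_inv c x) = F 0 (chart_inv c x)" and l: "l < mdim M"
  shows "pulled c (0, x) (a(l := (1, 0))) = 0"
proof -
  have 0: "0 \<in> times" using \<epsilon> by simp
  obtain d where d: "d \<in> atlas N" "(0, x) \<in> rep_dom c d"
    using rep_dom_covered[OF c, of "(0, x)"] 0 x by blast
  have dom: "(s, x) \<in> rep_dom c d" if "s \<in> times" for s
    using d that stat[OF that] unfolding rep_dom_eq[OF c] by simp
  have const: "rep c d (s, x) = rep c d (0, x)" if "s \<in> times" for s
    using stat[OF that] by (simp add: rep_def local_rep_def)
  have "((\<lambda>s. (s, x)) has_derivative (\<lambda>h. (h, 0))) (at 0 within times)"
    by (intro has_derivative_Pair has_derivative_const has_derivative_ident)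
  moreover have "(rep c d has_derivative rep_deriv c d (0, x)) (at (0, x) within (\<lambda>s. (s, x)) ` times)"
    by (rule has_derivative_subset[OF rep_has_derivative[OF c d]]) (use dom in blast)
  ultimately have "((\<lambda>s. rep c d (s, x)) has_derivative (\<lambda>h. rep_deriv c d (0, x) (h, 0))) (at 0 within times)"
    by (rule has_derivative_in_compose)
  moreover have "((\<lambda>s. rep c d (s, x)) has_derivative (\<lambda>h. 0)) (at 0 within times)"
    by (rule has_derivative_transform[OF 0 _ has_derivative_const]) (rule const)
  ultimately have "rep_deriv c d (0, x) (h, 0) = 0" for h
    using fat_derivative_unique[OF fat_open[of times] 0] open_greaterThanLessThan by metis
  then show ?thesis
    unfolding pulled_eq[OF m c d]
    by (intro alternating_form_zero[OF \<omega>_alternating[OF d(1) rep_in[OF c d(2)]] _ l])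
       (use rep_deriv_in[OF m c d] in auto)
qed

end

section \<open>Integration in Euclidean space\<close>

lemma supported_set_integrable:
  fixes g :: "'a::euclidean_space \<Rightarrow> real"
  assumes "compact K" "K \<subseteq> U" "continuous_on K g" "\<And>x. x \<in> U - K \<Longrightarrow> g x = 0"
  shows "set_integrable lborel U g"
proof -
  have "(\<lambda>x. indicator U x *\<^sub>R g x) = (\<lambda>x. indicator K x *\<^sub>R g x)"
    using assms(2,4) by (auto simp: fun_eq_iff indicator_def)
  then show ?thesis
    using borel_integrable_compact[OF assms(1,3)] by (simp add: set_integrable_def)
qed

lemma frontier_meets_segment:
  fixes x y :: "'a::euclidean_space"
  assumes "x \<in> A" "y \<notin> A"
  obtains z where "z \<in> frontier A" "dist x z \<le> dist x y"
proof -
  have "closed_segment x y \<inter> frontier A \<noteq> {}"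
    by (rule connected_Int_frontier) (use assms in auto)
  then obtain z where "z \<in> closed_segment x y" "z \<in> frontier A" by blast
  then show thesis using that dist_in_closed_segment[of z x y] by (simp add: dist_commute)
qed

text \<open>A segment that leaves \<open>A\<close> meets the frontier, where \<open>G\<close> is \<open>0\<close> as it is outside.\<close>

lemma lipschitz_from_convex_closed:
  fixes G :: "'a::euclidean_space \<Rightarrow> real"
  assumes L: "\<And>x y. x \<in> A \<Longrightarrow> y \<in> A \<Longrightarrow> \<bar>G x - G y\<bar> \<le> L * dist x y" and "0 \<le> L" and "closed A"
    and 0: "\<And>x. x \<notin> A \<Longrightarrow> G x = 0" "\<And>x. x \<in> frontier A \<Longrightarrow> G x = 0"
  shows "\<bar>G x - G y\<bar> \<le> L * dist x y"
proof -
  have cross: "\<bar>G x - G y\<bar> \<le> L * dist x y" if xy: "x \<in> A" "y \<notin> A" for x y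
  proof -
    obtain z where z: "z \<in> frontier A" "dist x z \<le> dist x y" using frontier_meets_segment[OF xy] .
    have "z \<in> A" using z(1) \<open>closed A\<close> frontier_subset_eq by blast
    have "\<bar>G x - G y\<bar> = \<bar>G x - G z\<bar>" using 0(1)[OF xy(2)] 0(2)[OF z(1)] by simp
    also have "\<dots> \<le> L * dist x z" using L[OF xy(1) \<open>z \<in> A\<close>] .
    also have "\<dots> \<le> L * dist x y" using z(2) \<open>0 \<le> L\<close> by (rule mult_left_mono)
    finally show ?thesis .
  qed
  show ?thesis
  proof (cases "x \<in> A"; cases "y \<in> A")
    assume "x \<notin> A" "y \<in> A"
    then show ?thesis using cross[of y x] by (simp add: dist_commute abs_minus_commute)
  next
    assume "x \<notin> A" "y \<notin> A"
    then show ?thesis using 0(1) \<open>0 \<le> L\<close> by simp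
  qed (use L cross in auto)
qed

text \<open>The derivative is continuous, thus bounded on \<open>K\<close>, and it vanishes elsewhere; convexity turns this
  into a Lipschitz bound.\<close>

lemma compactly_supported_smooth_lipschitz:
  fixes G :: "'a::euclidean_space \<Rightarrow> real"
  assumes A: "convex A" "fat A" and G: "smooth_on A G" and K: "compact K" "K \<subseteq> A"
    and 0: "\<And>x. x \<in> A - K \<Longrightarrow> G x = 0"
  obtains L where "0 \<le> L" "\<And>x y. x \<in> A \<Longrightarrow> y \<in> A \<Longrightarrow> \<bar>G x - G y\<bar> \<le> L * dist x y"
proof -
  let ?D = "\<lambda>x. frechet_derivative G (at x within A)"
  have deriv: "(G has_derivative ?D x) (at x within A)" if "x \<in> A" for x
    by (rule smooth_on_has_derivative[OF G that])
  have "\<exists>C. \<forall>x\<in>K. \<bar>?D x b\<bar> \<le> C" for b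
  proof -
    have "continuous_on K (\<lambda>x. ?D x b)"
      using smooth_on_imp_continuous_on[OF smooth_on_derivative[OF A(2) G]] K(2) continuous_on_subset by blast
    then have "bounded ((\<lambda>x. ?D x b) ` K)"
      using K(1) compact_continuous_image compact_imp_bounded by blast
    then show ?thesis unfolding bounded_iff by auto
  qed
  then obtain C where C: "\<And>b x. x \<in> K \<Longrightarrow> \<bar>?D x b\<bar> \<le> C b" by metis
  define L where "L = (\<Sum>b\<in>Basis. \<bar>C b\<bar>)"
  have L0: "0 \<le> L" by (simp add: L_def sum_nonneg)
  have D0: "?D x = (\<lambda>u. 0)" if x: "x \<in> A - K" for x
  proof -
    have "openin (top_of_set A) (A - K)"
      using K(1) by (intro openin_diff) (auto simp: closedin_closed_Int compact_imp_closed closed_subset K(2))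
    then have "fat (A - K)" by (rule fat_openin[OF A(2)])
    moreover have "(G has_derivative ?D x) (at x within A - K)"
      by (rule has_derivative_subset[OF deriv]) (use x in auto)
    moreover have "(G has_derivative (\<lambda>u. 0)) (at x within A - K)"
      by (rule has_derivative_transform[OF x _ has_derivative_const[of 0]]) (use 0 in auto)
    ultimately show ?thesis using fat_derivative_unique x by blast
  qed
  have "onorm (?D x) \<le> L" if x: "x \<in> A" for x
  proof (cases "x \<in> K")
    case True
    have lin: "linear (?D x)" using deriv[OF x] has_derivative_linear by blast
    have "norm (?D x u) \<le> L * norm u" for u
    proof -
      have "?D x u = ?D x (\<Sum>b\<in>Basis. (u \<bullet> b) *\<^sub>R b)" by (simp add: euclidean_representation)
      also have "\<dots> = (\<Sum>b\<in>Basis. (u \<bullet> b) * ?D x b)"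
        by (simp add: linear_sum[OF lin] linear_scale[OF lin])
      also have "norm \<dots> \<le> (\<Sum>b\<in>Basis. norm u * \<bar>C b\<bar>)"
      proof (rule order_trans[OF norm_sum sum_mono])
        fix b :: 'a assume "b \<in> Basis"
        then show "norm ((u \<bullet> b) * ?D x b) \<le> norm u * \<bar>C b\<bar>"
          using C[OF True, of b] by (auto simp: abs_mult intro!: mult_mono Basis_le_norm)
      qed
      finally show ?thesis by (simp add: L_def sum_distrib_left mult.commute)
    qed
    then show ?thesis by (rule onorm_le)
  next
    case False
    then show ?thesis using D0[of x] x L0 by (simp add: onorm_zero)
  qed
  then have "norm (G x - G y) \<le> L * norm (x - y)" if "x \<in> A" "y \<in> A" for x y
    using differentiable_bound[OF A(1) deriv] that by blast
  then show thesis using L0 that by (simp add: dist_norm)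
qed

lemma integral_translation:
  fixes G :: "'a::euclidean_space \<Rightarrow> real"
  assumes "G \<in> borel_measurable borel"
  shows "(\<integral>x. G (x + v) \<partial>lborel) = (\<integral>x. G x \<partial>lborel)"
proof -
  have "(\<integral>x. G x \<partial>lborel) = (\<integral>x. G x \<partial>distr lborel borel ((+) v))"
    by (simp add: lborel_distr_plus)
  also have "\<dots> = (\<integral>x. G (v + x) \<partial>lborel)"
    by (rule integral_distr) (use assms in auto)
  finally show ?thesis by (simp add: add.commute)
qed

text \<open>The difference quotients of \<open>G\<close>, extended by \<open>0\<close>, have integral \<open>0\<close> by translation invariance. They
  are bounded by the Lipschitz constant, supported in a fixed compact set, and converge off the
  frontier of \<open>A\<close>, which is a null set.\<close>

lemma integral_directional_derivative_zero:
  fixes G :: "'a::euclidean_space \<Rightarrow> real"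
  assumes A: "closed A" "convex A" "fat A" and G: "smooth_on A G" and K: "compact K" "K \<subseteq> A"
    and 0: "\<And>x. x \<notin> K \<Longrightarrow> G x = 0" and front: "\<And>x. x \<in> frontier A \<Longrightarrow> G x = 0"
  shows "(LINT x : A | lborel. frechet_derivative G (at x within A) e) = 0"
proof -
  let ?D = "\<lambda>x. frechet_derivative G (at x within A) e"
  obtain L where L: "0 \<le> L" "\<And>x y. x \<in> A \<Longrightarrow> y \<in> A \<Longrightarrow> \<bar>G x - G y\<bar> \<le> L * dist x y"
    using compactly_supported_smooth_lipschitz[OF A(2,3) G K] 0 by blast
  have lip: "\<bar>G x - G y\<bar> \<le> L * dist x y" for x y
    by (rule lipschitz_from_convex_closed[OF L(2,1) A(1)]) (use 0 K(2) front in auto)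
  then have "L-lipschitz_on UNIV G" using L(1) by (intro lipschitz_onI) (auto simp: dist_real_def)
  then have contG: "continuous_on UNIV G" by (rule lipschitz_on_continuous_on)
  then have measG: "G \<in> borel_measurable borel" by (rule borel_measurable_continuous_onI)
  have intG: "integrable lborel G"
  proof -
    have "set_integrable lborel UNIV G"
      by (rule supported_set_integrable[OF K(1)]) (use contG continuous_on_subset 0 in auto)
    then show ?thesis by (simp add: set_integrable_def)
  qed
  define q where "q = (\<lambda>n x. real (Suc n) * (G (x + (1 / real (Suc n)) *\<^sub>R e) - G x))"
  have measq: "q n \<in> borel_measurable lborel" for n
    unfolding q_def using contG
    by (auto intro!: borel_measurable_continuous_onI continuous_intros continuous_on_compose2[OF contG])
  have "integral\<^sup>L lborel (q n) = 0" for n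
  proof -
    have "integrable lborel (\<lambda>x. G (x + v))" for v
    proof -
      have "integrable (distr lborel borel ((+) v)) G" using intG by (simp add: lborel_distr_plus)
      then have "integrable lborel (\<lambda>x. G (v + x))" by (rule integrable_distr[rotated]) simp
      then show ?thesis by (simp add: add.commute)
    qed
    then show ?thesis
      unfolding q_def using integral_translation[OF measG] intG by simp
  qed
  (* a compact set that contains the supports of all difference quotients *)
  define K' where "K' = (\<lambda>(x, y). x + y) ` (K \<times> cball 0 (norm e))"
  have K': "compact K'" unfolding K'_def
    by (intro compact_continuous_image compact_Times K(1) compact_cball)
       (auto intro!: continuous_intros simp: case_prod_unfold)
  have bound: "norm (q n x) \<le> indicator K' x * (L * norm e)" for n x
  proof (cases "x \<in> K'")
    case True
    have "norm (q n x) = real (Suc n) * \<bar>G (x + (1 / real (Suc n)) *\<^sub>R e) - G x\<bar>"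
      by (simp add: q_def abs_mult)
    also have "\<dots> \<le> real (Suc n) * (L * dist (x + (1 / real (Suc n)) *\<^sub>R e) x)"
      by (intro mult_left_mono lip) simp
    also have "\<dots> = L * norm e" by (simp add: dist_norm)
    finally show ?thesis using True by simp
  next
    case False
    have small: "norm ((1 / real (Suc n)) *\<^sub>R e) \<le> norm e"
      using mult_right_mono[of "1 / real (Suc n)" 1 "norm e"] by simp
    have "x \<notin> K"
    proof
      assume "x \<in> K"
      then have "(x, 0) \<in> K \<times> cball 0 (norm e)" by simp
      then show False using False unfolding K'_def by force
    qed
    moreover have "x + (1 / real (Suc n)) *\<^sub>R e \<notin> K"
    proof
      assume "x + (1 / real (Suc n)) *\<^sub>R e \<in> K"
      then have "(x + (1 / real (Suc n)) *\<^sub>R e, - ((1 / real (Suc n)) *\<^sub>R e)) \<in> K \<times> cball 0 (norm e)"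
        using small by simp
      then have "x \<in> K'" unfolding K'_def by (rule rev_image_eqI) simp
      then show False using False by simp
    qed
    ultimately show ?thesis using 0 False by (simp add: q_def)
  qed
  have lim: "(\<lambda>n. q n x) \<longlonglongrightarrow> indicator A x * ?D x" if x: "x \<notin> frontier A" for x
  proof -
    have "(G has_derivative (\<lambda>u. indicator A x * frechet_derivative G (at x within A) u)) (at x)"
    proof (cases "x \<in> A")
      case True
      then have "x \<in> interior A" using x A(1) by (simp add: frontier_def)
      then show ?thesis
        using smooth_on_has_derivative[OF G True] True at_within_interior[of x A] by simp
    next
      case False
      have "(G has_derivative (\<lambda>u. 0)) (at x)"
        by (rule has_derivative_transform_within_open[OF has_derivative_const[of 0], of "- A"])
           (use False A(1) 0 K(2) in auto)
      then show ?thesis using False by simp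
    qed
    then have "((\<lambda>s. G (x + s *\<^sub>R e)) has_real_derivative indicator A x * ?D x) (at 0)"
      using has_real_derivative_along_line[of G _ x 0 e] by simp
    then have "((\<lambda>h. (G (x + h *\<^sub>R e) - G x) / h) \<longlongrightarrow> indicator A x * ?D x) (at 0)"
      by (simp add: DERIV_def)
    then have "(\<lambda>n. (G (x + (1 / real (Suc n)) *\<^sub>R e) - G x) / (1 / real (Suc n))) \<longlonglongrightarrow> indicator A x * ?D x"
    proof (rule filterlim_compose)
      have "(\<lambda>n. 1 / real (Suc n)) \<longlonglongrightarrow> 0"
        using LIMSEQ_inverse_real_of_nat by (simp add: inverse_eq_divide)
      then show "filterlim (\<lambda>n. 1 / real (Suc n)) (at 0) sequentially"
        unfolding filterlim_at by (auto simp del: of_nat_Suc)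
    qed
    then show ?thesis unfolding q_def by (simp add: mult.commute)
  qed
  have AE: "AE x in lborel. x \<notin> frontier A"
  proof -
    have "frontier A \<in> null_sets lebesgue"
      using negligible_convex_frontier[OF A(2)] negligible_iff_null_sets by blast
    then have "AE x in lebesgue. x \<notin> frontier A" by (rule AE_not_in)
    then show ?thesis by (simp add: AE_completion_iff)
  qed
  have "(\<lambda>n. integral\<^sup>L lborel (q n)) \<longlonglongrightarrow> (\<integral>x. indicator A x * ?D x \<partial>lborel)"
  proof (rule integral_dominated_convergence)
    show "(\<lambda>x. indicator A x * ?D x) \<in> borel_measurable lborel"
    proof -
      have "continuous_on A ?D" by (rule smooth_on_imp_continuous_on[OF smooth_on_derivative[OF A(3) G]])
      then have "(\<lambda>x. indicator A x *\<^sub>R ?D x) \<in> borel_measurable borel"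
        using A(1) by (intro borel_measurable_continuous_on_indicator) auto
      then show ?thesis by simp
    qed
    show "integrable lborel (\<lambda>x. indicator K' x * (L * norm e))"
      using borel_integrable_compact[OF K', of "\<lambda>x. L * norm e"] by simp
    show "AE x in lborel. (\<lambda>n. q n x) \<longlonglongrightarrow> indicator A x * ?D x"
      using AE by eventually_elim (rule lim)
  qed (use measq bound in auto)
  then have "(\<lambda>n. 0) \<longlonglongrightarrow> (\<integral>x. indicator A x * ?D x \<partial>lborel)"
    using \<open>\<And>n. integral\<^sup>L lborel (q n) = 0\<close> by simp
  from LIMSEQ_unique[OF tendsto_const this] show ?thesis
    by (simp add: set_lebesgue_integral_def)
qed

text \<open>Differentiation under the integral: the time derivative is bounded on a compact neighbourhood of
  the slice \<open>{0} \<times> K\<close>, which dominates the difference quotients.\<close>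

lemma has_derivative_integral_parameter:
  fixes h :: "real \<times> 'a::euclidean_space \<Rightarrow> real" and w :: "'a \<Rightarrow> real"
  assumes \<epsilon>: "\<epsilon> > 0" and fatU: "fat U" and h: "smooth_on ({-\<epsilon><..<\<epsilon>} \<times> U) h"
    and K: "compact K" "K \<subseteq> U" and w: "continuous_on K w" "\<And>x. x \<in> U - K \<Longrightarrow> w x = 0"
  shows "((\<lambda>t. LINT x : U | lborel. w x * h (t, x)) has_real_derivative
    (LINT x : U | lborel. w x * frechet_derivative h (at (0, x) within {-\<epsilon><..<\<epsilon>} \<times> U) (1, 0))) (at 0)"
proof -
  let ?I = "{-\<epsilon><..<\<epsilon>}"
  define D where "D = (\<lambda>z. frechet_derivative h (at z within ?I \<times> U) (1, 0))"
  have fatIU: "fat (?I \<times> U)" by (intro fat_Times fat_open fatU) simp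
  have contD: "continuous_on (?I \<times> U) D" unfolding D_def
    by (rule smooth_on_imp_continuous_on[OF smooth_on_derivative[OF fatIU h]])
  have conth: "continuous_on (?I \<times> U) h" by (rule smooth_on_imp_continuous_on[OF h])
  have slice: "((\<lambda>t. h (t, x)) has_real_derivative D (t, x)) (at t)" if "t \<in> ?I" "x \<in> U" for t x
  proof -
    have "((\<lambda>s. (s, x)) has_derivative (\<lambda>s. (s, 0))) (at t within ?I)"
      by (intro has_derivative_Pair has_derivative_const has_derivative_ident)
    moreover have "(h has_derivative frechet_derivative h (at (t, x) within ?I \<times> U))
        (at (t, x) within (\<lambda>s. (s, x)) ` ?I)"
      by (rule has_derivative_subset[OF smooth_on_has_derivative[OF h]]) (use that in auto)
    ultimately have d: "((\<lambda>s. h (s, x)) has_derivative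
        (\<lambda>s. frechet_derivative h (at (t, x) within ?I \<times> U) (s, 0))) (at t within ?I)"
      by (rule has_derivative_in_compose)
    have lin: "linear (frechet_derivative h (at (t, x) within ?I \<times> U))"
      using smooth_on_has_derivative[OF h, of "(t, x)"] that has_derivative_linear by blast
    have "frechet_derivative h (at (t, x) within ?I \<times> U) (s, 0) = D (t, x) * s" for s
      using linear_scale[OF lin, of s "(1, 0)"] by (simp add: D_def)
    then have "(\<lambda>s. frechet_derivative h (at (t, x) within ?I \<times> U) (s, 0)) = (*) (D (t, x))" by (rule ext)
    moreover have "at t within ?I = at t" using that(1) by (intro at_within_open) auto
    ultimately show ?thesis using d unfolding has_field_derivative_def by simp
  qed
  have "compact ({-\<epsilon>/2..\<epsilon>/2} \<times> K)" by (intro compact_Times K(1)) simp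
  moreover have "continuous_on ({-\<epsilon>/2..\<epsilon>/2} \<times> K) D"
    by (rule continuous_on_subset[OF contD]) (use \<epsilon> K(2) in auto)
  ultimately have "bounded (D ` ({-\<epsilon>/2..\<epsilon>/2} \<times> K))"
    using compact_continuous_image compact_imp_bounded by blast
  then obtain C where "\<forall>y\<in>D ` ({-\<epsilon>/2..\<epsilon>/2} \<times> K). norm y \<le> C"
    unfolding bounded_iff by blast
  then have C: "\<bar>D (t, x)\<bar> \<le> C" if "t \<in> {-\<epsilon>/2..\<epsilon>/2}" "x \<in> K" for t x
    using that by (metis SigmaI image_eqI real_norm_def)
  have lip: "\<bar>h (t, x) - h (0, x)\<bar> \<le> C * \<bar>t\<bar>" if "t \<in> {-\<epsilon>/2..\<epsilon>/2}" "x \<in> K" for t x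
  proof -
    have "norm (h (t, x) - h (0, x)) \<le> C * norm (t - 0)"
    proof (rule field_differentiable_bound[of "{-\<epsilon>/2..\<epsilon>/2}" "\<lambda>t. h (t, x)" "\<lambda>t. D (t, x)" C])
      show "((\<lambda>t. h (t, x)) has_field_derivative D (s, x)) (at s within {-\<epsilon>/2..\<epsilon>/2})"
        if s: "s \<in> {-\<epsilon>/2..\<epsilon>/2}" for s
      proof (rule has_field_derivative_at_within[OF slice])
        show "s \<in> ?I" using s \<epsilon> by auto
        show "x \<in> U" using \<open>x \<in> K\<close> K(2) by blast
      qed
      show "norm (D (s, x)) \<le> C" if "s \<in> {-\<epsilon>/2..\<epsilon>/2}" for s using C[OF that \<open>x \<in> K\<close>] by simp
    qed (use that \<epsilon> in auto)
    then show ?thesis by simp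
  qed
  have intK: "set_integrable lborel U (\<lambda>x. w x * g x)" if "continuous_on K g" for g
    by (rule supported_set_integrable[OF K]) (use w that in \<open>auto intro!: continuous_intros\<close>)
  have inth: "set_integrable lborel U (\<lambda>x. w x * h (t, x))" if "t \<in> ?I" for t
    by (intro intK continuous_on_compose2[OF conth]) (use that K(2) in \<open>auto intro!: continuous_intros\<close>)
  have intD: "set_integrable lborel U (\<lambda>x. w x * D (0, x))"
    by (intro intK continuous_on_compose2[OF contD]) (use \<epsilon> K(2) in \<open>auto intro!: continuous_intros\<close>)
  have "((\<lambda>t. ((LINT x : U | lborel. w x * h (t, x)) - (LINT x : U | lborel. w x * h (0, x))) / (t - 0)) \<longlongrightarrow>
      (LINT x : U | lborel. w x * D (0, x))) (at 0)"
    unfolding tendsto_at_iff_sequentially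
  proof (intro allI impI)
    fix X :: "nat \<Rightarrow> real" assume X0: "\<forall>i. X i \<in> UNIV - {0}" and X: "X \<longlonglongrightarrow> 0"
    have "\<forall>\<^sub>F n in sequentially. \<bar>X n\<bar> < \<epsilon> / 2"
      using tendstoD[OF X, of "\<epsilon> / 2"] \<epsilon> by (simp add: dist_real_def)
    then obtain N where N: "\<And>n. n \<ge> N \<Longrightarrow> \<bar>X n\<bar> < \<epsilon> / 2" by (auto simp: eventually_sequentially)
    define Y where "Y = (\<lambda>n. X (n + N))"
    have Y: "Y n \<in> {-\<epsilon>/2..\<epsilon>/2}" "Y n \<in> ?I" "Y n \<noteq> 0" for n
      using N[of "n + N"] X0 by (auto simp: Y_def)
    have Ylim: "Y \<longlonglongrightarrow> 0" unfolding Y_def by (rule LIMSEQ_ignore_initial_segment[OF X])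
    define q where "q = (\<lambda>n x. indicator U x * (w x * ((h (Y n, x) - h (0, x)) / Y n)))"
    have eq: "((LINT x : U | lborel. w x * h (Y n, x)) - (LINT x : U | lborel. w x * h (0, x))) / Y n =
        integral\<^sup>L lborel (q n)" for n
    proof -
      have "0 \<in> ?I" using \<epsilon> by simp
      then have "(LINT x : U | lborel. w x * h (Y n, x)) - (LINT x : U | lborel. w x * h (0, x)) =
          (LINT x : U | lborel. w x * h (Y n, x) - w x * h (0, x))"
        using set_integral_diff(2)[OF inth[OF Y(2)] inth] by simp
      also have "\<dots> / Y n = (LINT x : U | lborel. (w x * h (Y n, x) - w x * h (0, x)) / Y n)"
        by simp
      finally show ?thesis
        unfolding q_def set_lebesgue_integral_def by (simp add: right_diff_distrib)
    qed
    have intq: "integrable lborel (q n)" for n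
    proof -
      have "0 \<in> ?I" using \<epsilon> by simp
      then have "set_integrable lborel U (\<lambda>x. (w x * h (Y n, x) - w x * h (0, x)) / Y n)"
        using set_integral_diff(1)[OF inth[OF Y(2)] inth] by simp
      then show ?thesis unfolding q_def set_integrable_def by (simp add: right_diff_distrib)
    qed
    have "(\<lambda>n. integral\<^sup>L lborel (q n)) \<longlonglongrightarrow> (\<integral>x. indicator U x * (w x * D (0, x)) \<partial>lborel)"
    proof (rule integral_dominated_convergence)
      show "(\<lambda>x. indicator U x * (w x * D (0, x))) \<in> borel_measurable lborel"
        using intD unfolding set_integrable_def by (auto dest: borel_measurable_integrable)
      show "q n \<in> borel_measurable lborel" for n using intq by (rule borel_measurable_integrable)
      have "set_integrable lborel U (\<lambda>x. w x * C)" by (intro intK) auto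
      then show "integrable lborel (\<lambda>x. \<bar>indicator U x * (w x * C)\<bar>)"
        unfolding set_integrable_def by simp
      show "AE x in lborel. norm (q n x) \<le> \<bar>indicator U x * (w x * C)\<bar>" for n
      proof (rule AE_I2)
        fix x
        show "norm (q n x) \<le> \<bar>indicator U x * (w x * C)\<bar>"
        proof (cases "x \<in> K")
          case True
          have "\<bar>(h (Y n, x) - h (0, x)) / Y n\<bar> \<le> C"
            using lip[OF Y(1) True, of n] Y(3)[of n] by (simp add: divide_le_eq abs_divide)
          then have "\<bar>w x\<bar> * \<bar>(h (Y n, x) - h (0, x)) / Y n\<bar> \<le> \<bar>w x\<bar> * \<bar>C\<bar>"
            by (intro mult_left_mono) auto
          then show ?thesis by (simp add: q_def abs_mult indicator_def)
        qed (use w(2) in \<open>auto simp: q_def indicator_def\<close>)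
      qed
      show "AE x in lborel. (\<lambda>n. q n x) \<longlonglongrightarrow> indicator U x * (w x * D (0, x))"
      proof (rule AE_I2)
        fix x
        show "(\<lambda>n. q n x) \<longlonglongrightarrow> indicator U x * (w x * D (0, x))"
        proof (cases "x \<in> U")
          case True
          have "((\<lambda>t. (h (0 + t, x) - h (0, x)) / t) \<longlongrightarrow> D (0, x)) (at 0)"
            using slice[of 0 x] True \<epsilon> by (simp add: DERIV_def)
          then have "(\<lambda>n. (h (Y n, x) - h (0, x)) / Y n) \<longlonglongrightarrow> D (0, x)"
            using filterlim_compose[of "\<lambda>t. (h (0 + t, x) - h (0, x)) / t" _ "at 0" Y sequentially] Ylim Y(3)
            by (auto simp: filterlim_at)
          then show ?thesis unfolding q_def by (intro tendsto_intros)
        qed (simp add: q_def)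
      qed
    qed
    then have "(\<lambda>n. ((LINT x : U | lborel. w x * h (Y n, x)) - (LINT x : U | lborel. w x * h (0, x))) / Y n)
        \<longlonglongrightarrow> (LINT x : U | lborel. w x * D (0, x))"
      unfolding eq by (simp add: set_lebesgue_integral_def)
    note lim = this[unfolded Y_def]
    show "((\<lambda>t. ((LINT x : U | lborel. w x * h (t, x)) - (LINT x : U | lborel. w x * h (0, x))) / (t - 0)) \<circ> X)
        \<longlonglongrightarrow> (LINT x : U | lborel. w x * D (0, x))"
      by (rule LIMSEQ_offset[where k = N]) (use lim in \<open>simp only: o_def diff_zero\<close>)
  qed
  then show ?thesis unfolding D_def by (simp add: has_field_derivative_iff)
qed

text \<open>The formula for vector-valued functions, applied to functions with values in \<open>real^1\<close>.\<close>

lemma integral_change_of_variables_real: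
  fixes f g :: "'m::{finite,wellorder} rn \<Rightarrow> real" and T :: "'m rn \<Rightarrow> 'm rn"
  assumes S: "S \<in> sets borel" "T ` S \<in> sets borel" and T: "\<And>x. x \<in> S \<Longrightarrow> (T has_derivative T' x) (at x within S)"
    and inj: "inj_on T S" and f: "set_integrable lborel (T ` S) f" and g: "set_integrable lborel S g"
    and eq: "\<And>x. x \<in> S \<Longrightarrow> g x = \<bar>det (matrix (T' x))\<bar> * f (T x)"
  shows "(LINT x : S | lborel. g x) = (LINT y : T ` S | lborel. f y)"
proof -
  let ?v = "\<lambda>r :: real. (\<chi> i. r) :: real^1"
  have lin: "bounded_linear ?v"
    by (intro linear_conv_bounded_linear[THEN iffD1] linearI) (simp_all add: vec_eq_iff)
  have "f absolutely_integrable_on (T ` S)"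
    using f S(2) unfolding set_integrable_def by (simp add: integrable_completion)
  then have vf: "(\<lambda>y. ?v (f y)) absolutely_integrable_on (T ` S)"
    using absolutely_integrable_linear[OF _ lin] by (simp add: o_def)
  have "integral (T ` S) (\<lambda>y. ?v (f y)) = integral S (\<lambda>x. \<bar>det (matrix (T' x))\<bar> *\<^sub>R ?v (f (T x)))"
    by (rule integral_change_of_variables[OF _ T inj]) (use S vf in auto)
  also have "\<dots> = integral S (\<lambda>x. ?v (g x))"
    by (rule integral_cong) (simp add: eq vec_eq_iff)
  also have "integral S (\<lambda>x. ?v (g x)) = ?v (integral S g)"
    using integral_linear[OF set_borel_integral_eq_integral(1)[OF g] lin] by (simp add: o_def)
  finally have "?v (integral S g) = integral (T ` S) (\<lambda>y. ?v (f y))" by simp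
  also have "\<dots> = ?v (integral (T ` S) f)"
    using integral_linear[OF set_borel_integral_eq_integral(1)[OF f] lin] by (simp add: o_def)
  finally have "integral S g = integral (T ` S) f" by (simp add: vec_eq_iff)
  then show ?thesis
    using set_borel_integral_eq_integral(2)[OF f] set_borel_integral_eq_integral(2)[OF g] by simp
qed

lemma set_integral_cong_support:
  fixes f :: "'a \<Rightarrow> real"
  assumes "T \<subseteq> S" "\<And>x. x \<in> S - T \<Longrightarrow> f x = 0"
  shows "set_lebesgue_integral \<mu> S f = set_lebesgue_integral \<mu> T f"
  unfolding set_lebesgue_integral_def
  by (rule Bochner_Integration.integral_cong) (use assms in \<open>auto simp: indicator_def\<close>)

section \<open>Stokes' theorem for the derivative of the integral\<close>

locale oriented_variation = closed_form_variation M N \<omega> \<epsilon> F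
  for M :: "('p, 'm::{finite,wellorder}) manifold" and N :: "('q, 'n::{finite,wellorder}) manifold"
    and \<omega> :: "('q, 'n) form" and \<epsilon> :: real and F :: "real \<Rightarrow> 'p \<Rightarrow> 'q" +
  fixes \<sigma> :: "('p, 'm) chart \<Rightarrow> 'p \<Rightarrow> real"
  assumes comp: "compact_space (mtop M)" and \<sigma>: "orientation M \<sigma>"
    and boundary: "\<And>t p. t \<in> {-\<epsilon><..<\<epsilon>} \<Longrightarrow> p \<in> mboundary M \<Longrightarrow> F t p = F 0 p"
begin

abbreviation supp :: "('p \<Rightarrow> real) \<Rightarrow> 'p set"
  where "supp r \<equiv> mtop M closure_of {p \<in> topspace (mtop M). r p \<noteq> 0}"

definition smooth_fun :: "('p \<Rightarrow> real) \<Rightarrow> bool"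
  where "smooth_fun r \<longleftrightarrow> (\<forall>c\<in>atlas M. smooth_on (chart_image c) (\<lambda>x. r (chart_inv c x)))"

abbreviation fun_deriv :: "('p, 'm) chart \<Rightarrow> ('p \<Rightarrow> real) \<Rightarrow> 'm rn \<Rightarrow> 'm rn \<Rightarrow> real"
  where "fun_deriv c r x \<equiv> frechet_derivative (\<lambda>x. r (chart_inv c x)) (at x within chart_image c)"

abbreviation space_vector :: "nat \<Rightarrow> real \<times> 'm rn"
  where "space_vector i \<equiv> (0, coord_vector i)"

text \<open>In terms of the form \<open>\<beta>\<close> obtained by contraction with the time direction, this is \<open>d r \<and> \<beta>\<close> on the
  coordinate vectors, at time \<open>0\<close>.\<close>

definition flux :: "('p, 'm) chart \<Rightarrow> ('p \<Rightarrow> real) \<Rightarrow> 'm rn \<Rightarrow> real"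
  where "flux c r x = (\<Sum>l<mdim M. fun_deriv c r x (coord_vector l) * pulled c (0, x) (space_vector(l := (1, 0))))"

lemma orientation_values: "c \<in> atlas M \<Longrightarrow> p \<in> fst c \<Longrightarrow> \<sigma> c p = - 1 \<or> \<sigma> c p = 1"
  using \<sigma> unfolding orientation_def by blast

lemma orientation_locally_constant:
  assumes c: "c \<in> atlas M" and x: "x \<in> chart_image c"
  obtains B where "openin (top_of_set (chart_image c)) B" "x \<in> B"
    "\<And>y. y \<in> B \<Longrightarrow> \<sigma> c (chart_inv c y) = \<sigma> c (chart_inv c x)"
proof -
  let ?s = "\<lambda>y. \<sigma> c (chart_inv c y)"
  have "continuous_map (subtopology (mtop M) (fst c)) euclideanreal (\<sigma> c)"
    using \<sigma> c unfolding orientation_def by blast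
  moreover have "continuous_map (top_of_set (chart_image c)) (subtopology (mtop M) (fst c)) (chart_inv c)"
    using chart_homeomorphic_maps[OF M_chart[OF c]] by (simp add: homeomorphic_maps_def)
  ultimately have "continuous_map (top_of_set (chart_image c)) euclideanreal (\<sigma> c \<circ> chart_inv c)"
    using continuous_map_compose by blast
  then have "openin (top_of_set (chart_image c)) {y \<in> topspace (top_of_set (chart_image c)). (\<sigma> c \<circ> chart_inv c) y \<in> ball (?s x) 1}"
    by (rule openin_continuous_map_preimage) simp
  then have "openin (top_of_set (chart_image c)) {y \<in> chart_image c. ?s y \<in> ball (?s x) 1}" by simp
  moreover have "?s y = ?s x" if "y \<in> {y \<in> chart_image c. ?s y \<in> ball (?s x) 1}" for y
  proof -
    have y: "y \<in> chart_image c" "dist (?s x) (?s y) < 1" using that by auto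
    from orientation_values[OF c chart_inv_in[OF y(1)]] orientation_values[OF c chart_inv_in[OF x]] y(2)
    show ?thesis by (elim disjE) (simp_all add: dist_real_def)
  qed
  moreover have "x \<in> {y \<in> chart_image c. ?s y \<in> ball (?s x) 1}" using x by simp
  ultimately show thesis using that by blast
qed

text \<open>A continuous function with values \<open>-1\<close> and \<open>1\<close> is locally constant.\<close>

lemma orientation_smooth:
  assumes "c \<in> atlas M"
  shows "smooth_on (chart_image c) (\<lambda>x. \<sigma> c (chart_inv c x))"
proof (rule smooth_on_local_openin)
  fix x assume "x \<in> chart_image c"
  from orientation_locally_constant[OF assms this] obtain B where B: "openin (top_of_set (chart_image c)) B" "x \<in> B"
    "\<And>y. y \<in> B \<Longrightarrow> \<sigma> c (chart_inv c y) = \<sigma> c (chart_inv c x)" by blast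
  have "smooth_on B (\<lambda>y. \<sigma> c (chart_inv c y))"
    using smooth_on_cong[of B "\<lambda>y. \<sigma> c (chart_inv c y)" "\<lambda>y. \<sigma> c (chart_inv c x)"] B(3) smooth_on_const by blast
  then show "\<exists>B. openin (top_of_set (chart_image c)) B \<and> x \<in> B \<and> smooth_on B (\<lambda>x. \<sigma> c (chart_inv c x))"
    using B by blast
qed

lemma supp_image_compact:
  assumes "c \<in> atlas M" "supp r \<subseteq> fst c"
  shows "compact (snd c ` supp r)"
proof -
  have "compactin (mtop M) (supp r)"
    using closedin_compact_space[OF comp closedin_closure_of] .
  then have "compactin (subtopology (mtop M) (fst c)) (supp r)"
    using assms(2) by (simp add: compactin_subtopology)
  then have "compactin euclidean (snd c ` supp r)"
    by (rule image_compactin) (rule chart_continuous_map[OF M_chart[OF assms(1)]])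
  then show ?thesis by simp
qed

lemma in_supp: "p \<in> topspace (mtop M) \<Longrightarrow> r p \<noteq> 0 \<Longrightarrow> p \<in> supp r"
  using closure_of_subset[of "{p \<in> topspace (mtop M). r p \<noteq> 0}" "mtop M"] by blast

lemma in_supp_image:
  assumes "c \<in> atlas M" "x \<in> chart_image c" "supp r \<subseteq> fst c"
  shows "x \<in> snd c ` supp r \<longleftrightarrow> chart_inv c x \<in> supp r"
proof
  show "chart_inv c x \<in> supp r" if "x \<in> snd c ` supp r"
    using that assms(3) chart_inv_left[OF M_chart[OF assms(1)]] by auto
  show "x \<in> snd c ` supp r" if "chart_inv c x \<in> supp r"
    by (rule image_eqI[OF _ that]) (simp add: chart_inv_right[OF assms(2)])
qed

lemma fun_zero_off_supp:
  assumes "c \<in> atlas M" "x \<in> chart_image c" "chart_inv c x \<notin> supp r"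
  shows "r (chart_inv c x) = 0"
  using in_supp assms chart_inv_in[OF assms(2)] chart_subset_topspace[OF M_chart[OF assms(1)]] by blast

lemma fun_deriv_zero_off_supp:
  assumes m: "mdim M \<noteq> 0" and c: "c \<in> atlas M" and r: "smooth_fun r"
    and x: "x \<in> chart_image c" "chart_inv c x \<notin> supp r"
  shows "fun_deriv c r x = (\<lambda>u. 0)"
proof (rule derivative_zero_openin[OF fat_chart_image[OF M_chart[OF c] m]])
  let ?B = "snd c ` (fst c \<inter> (topspace (mtop M) - supp r))"
  show "smooth_on (chart_image c) (\<lambda>x. r (chart_inv c x))" using r c unfolding smooth_fun_def by blast
  show "openin (top_of_set (chart_image c)) ?B"
    by (intro chart_image_Int_openin[OF M_chart[OF c]] openin_diff) auto
  have eq: "?B = {y \<in> chart_image c. chart_inv c y \<in> topspace (mtop M) - supp r}"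
    by (rule chart_image_Int[OF M_chart[OF c]])
  show "x \<in> ?B" unfolding eq
    using x chart_inv_in[OF x(1)] chart_subset_topspace[OF M_chart[OF c]] by blast
  show "r (chart_inv c y) = 0" if "y \<in> ?B" for y
    using that fun_zero_off_supp[OF c] unfolding eq by blast
qed

lemma flux_zero_off_supp:
  assumes "mdim M \<noteq> 0" "c \<in> atlas M" "smooth_fun r" "x \<in> chart_image c" "chart_inv c x \<notin> supp r"
  shows "flux c r x = 0"
  using fun_deriv_zero_off_supp[OF assms] by (simp add: flux_def)

lemma pulled_now_smooth:
  assumes m: "mdim M \<noteq> 0" and c: "c \<in> atlas M"
  shows "smooth_on (chart_image c) (\<lambda>x. pulled c (0, x) u)"
proof (rule smooth_on_compose[OF _ pulled_smooth[OF m c]])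
  show "smooth_on (chart_image c) (\<lambda>x. (0 :: real, x))"
    by (rule smooth_on_insert_time)
  show "(\<lambda>x. (0, x)) ` chart_image c \<subseteq> times \<times> chart_image c" using \<epsilon> by auto
qed

lemma flux_smooth:
  assumes m: "mdim M \<noteq> 0" and c: "c \<in> atlas M" and r: "smooth_fun r"
  shows "smooth_on (chart_image c) (flux c r)"
  unfolding flux_def
  using r c unfolding smooth_fun_def
  by (intro smooth_on_sum smooth_on_mult pulled_now_smooth m c smooth_on_derivative fat_chart_image[OF M_chart[OF c]]) auto

lemma fun_deriv_change:
  assumes m: "mdim M \<noteq> 0" and c: "c \<in> atlas M" "c' \<in> atlas M" and r: "smooth_fun r"
    and p: "p \<in> fst c" "p \<in> fst c'"
  shows "fun_deriv c r (snd c p) v = fun_deriv c' r (snd c' p) (transition_deriv c c' p v)"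
proof -
  let ?O = "overlap c c'"
  note inv = chart_inv_left[OF M_chart[OF c(1)]] and inv' = chart_inv_left[OF M_chart[OF c(2)]]
  have x: "snd c p \<in> chart_image c" "snd c p \<in> ?O" "snd c' p \<in> chart_image c'" using p by (auto simp: overlap_def)
  have fatO: "fat ?O"
    by (rule fat_openin[OF fat_chart_image[OF M_chart[OF c(1)] m] overlap_openin[OF M_chart[OF c(1)] M_chart[OF c(2)]]])
  have T: "transition c c' (snd c q) = snd c' q" if "q \<in> fst c" for q
    using inv[OF that] by (simp add: transition_def)
  have "smooth_on ?O (transition c c')" using M c unfolding smooth_manifold_def by blast
  then have "(transition c c' has_derivative transition_deriv c c' p) (at (snd c p) within ?O)"
    unfolding transition_deriv_def by (rule smooth_on_has_derivative) (rule x(2))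
  moreover have "((\<lambda>y. r (chart_inv c' y)) has_derivative fun_deriv c' r (snd c' p))
      (at (transition c c' (snd c p)) within transition c c' ` ?O)"
  proof (rule has_derivative_subset[of _ _ _ "chart_image c'"])
    show "((\<lambda>y. r (chart_inv c' y)) has_derivative fun_deriv c' r (snd c' p))
        (at (transition c c' (snd c p)) within chart_image c')"
      unfolding T[OF p(1)]
      by (rule smooth_on_has_derivative) (use r c x(3) in \<open>auto simp: smooth_fun_def\<close>)
    show "transition c c' ` ?O \<subseteq> chart_image c'" using T by (auto simp: overlap_def)
  qed
  ultimately have "((\<lambda>y. r (chart_inv c' (transition c c' y))) has_derivative
      (\<lambda>v. fun_deriv c' r (snd c' p) (transition_deriv c c' p v))) (at (snd c p) within ?O)"
    by (rule has_derivative_in_compose)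
  then have "((\<lambda>y. r (chart_inv c y)) has_derivative
      (\<lambda>v. fun_deriv c' r (snd c' p) (transition_deriv c c' p v))) (at (snd c p) within ?O)"
  proof (rule has_derivative_transform[OF x(2), rotated])
    show "r (chart_inv c y) = r (chart_inv c' (transition c c' y))" if "y \<in> ?O" for y
      using that inv inv' by (auto simp: overlap_def transition_def)
  qed
  moreover have "((\<lambda>y. r (chart_inv c y)) has_derivative fun_deriv c r (snd c p)) (at (snd c p) within ?O)"
    by (rule has_derivative_subset[OF smooth_on_has_derivative])
       (use r c x in \<open>auto simp: smooth_fun_def overlap_def\<close>)
  ultimately show ?thesis using fat_derivative_unique[OF fatO x(2)] by metis
qed

text \<open>As a function of the tangent vectors, \<open>d r \<and> \<beta>\<close> is an alternating form of top degree; under the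
  derivative of a transition map it is therefore multiplied by the determinant.\<close>

lemma flux_change:
  assumes m: "mdim M \<noteq> 0" and c: "c \<in> atlas M" "c' \<in> atlas M" and r: "smooth_fun r"
    and p: "p \<in> fst c" "p \<in> fst c'"
  shows "flux c r (snd c p) = det (matrix (transition_deriv c c' p)) * flux c' r (snd c' p)"
proof -
  let ?k = "mdim M" and ?DT = "transition_deriv c c' p"
  have k: "?k = CARD('m)" using M m unfolding smooth_manifold_def by blast
  have 0: "0 \<in> times" using \<epsilon> by simp
  have x': "snd c' p \<in> chart_image c'" and xO: "snd c p \<in> overlap c c'" using p by (auto simp: overlap_def)
  define dr where "dr = fun_deriv c' r (snd c' p)"
  define \<Theta> where "\<Theta> = pulled c' (0, snd c' p)"
  have \<Theta>: "alternating_form ?k UNIV \<Theta>" unfolding \<Theta>_def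
    by (rule pulled_alternating[OF m c(2)]) (use 0 x' in simp)
  have "smooth_on (chart_image c') (\<lambda>x. r (chart_inv c' x))" using r c unfolding smooth_fun_def by blast
  then have dr: "linear dr"
    unfolding dr_def using smooth_on_has_derivative x' has_derivative_linear by blast
  (* position l of e v l is the time direction, all others are the spatial vectors v *)
  define e where "e = (\<lambda>(v :: nat \<Rightarrow> 'm rn) l. (\<lambda>i. (0::real, v i))(l := (1, 0)))"
  define \<alpha> where "\<alpha> = (\<lambda>v. \<Sum>l<?k. dr (v l) * \<Theta> (e v l))"
  have "alternating_form ?k UNIV \<alpha>"
    unfolding alternating_form_def
  proof (intro conjI allI impI ballI)
    fix v w :: "nat \<Rightarrow> 'm rn" assume vw: "\<forall>i<?k. v i = w i"
    have "\<Theta> (e v l) = \<Theta> (e w l)" for l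
      by (rule alternating_form_cong[OF \<Theta>]) (use vw in \<open>simp add: e_def\<close>)
    then show "\<alpha> v = \<alpha> w" using vw by (simp add: \<alpha>_def)
  next
    fix v :: "nat \<Rightarrow> 'm rn" and j x y and a b :: real
    assume j: "j < ?k"
    have "dr ((v(j := a *\<^sub>R x + b *\<^sub>R y)) l) * \<Theta> (e (v(j := a *\<^sub>R x + b *\<^sub>R y)) l) =
        a * (dr ((v(j := x)) l) * \<Theta> (e (v(j := x)) l)) + b * (dr ((v(j := y)) l) * \<Theta> (e (v(j := y)) l))" for l
    proof (cases "l = j")
      case True
      have "e (v(j := z)) l = e v l" for z using True by (auto simp: e_def fun_eq_iff)
      then show ?thesis using True linear_add[OF dr] linear_scale[OF dr] by (simp add: algebra_simps)
    next
      case False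
      have e: "e (v(j := z)) l = (e v l)(j := (0, z))" for z using False by (auto simp: e_def fun_eq_iff)
      have "\<Theta> ((e v l)(j := a *\<^sub>R (0, x) + b *\<^sub>R (0, y))) =
          a * \<Theta> ((e v l)(j := (0, x))) + b * \<Theta> ((e v l)(j := (0, y)))"
        by (rule alternating_form_linear[OF \<Theta> _ j]) auto
      then show ?thesis using False by (simp add: e algebra_simps)
    qed
    then show "\<alpha> (v(j := a *\<^sub>R x + b *\<^sub>R y)) = a * \<alpha> (v(j := x)) + b * \<alpha> (v(j := y))"
      by (simp add: \<alpha>_def sum.distrib sum_distrib_left)
  next
    fix v :: "nat \<Rightarrow> 'm rn" and i j
    assume ij: "i < ?k" "j < ?k" "i \<noteq> j \<and> v i = v j"
    have zero: "\<Theta> (e v l) = 0" if "l \<noteq> i" "l \<noteq> j" for l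
      by (rule alternating_form_repeated[OF \<Theta> _ ij(1,2)]) (use that ij in \<open>auto simp: e_def\<close>)
    have "e v i = (\<lambda>i. (0, v i))(i := (1, 0), j := (0, v i))"
      "e v j = (\<lambda>i. (0, v i))(i := (0, v i), j := (1, 0))"
      using ij by (auto simp: e_def fun_eq_iff)
    then have "\<Theta> (e v i) = - \<Theta> (e v j)"
      using alternating_form_swap[OF \<Theta> subspace_UNIV _ ij(1,2), of "\<lambda>i. (0, v i)" "(1, 0)" "(0, v i)"] ij by simp
    moreover have "\<alpha> v = (\<Sum>l\<in>{i, j}. dr (v l) * \<Theta> (e v l))"
      unfolding \<alpha>_def using ij zero by (intro sum.mono_neutral_right) auto
    ultimately show "\<alpha> v = 0" using ij by simp
  qed
  then have alt: "alternating_form CARD('m) UNIV \<alpha>" by (simp add: k)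
  have "smooth_on (overlap c c') (transition c c')" using M c unfolding smooth_manifold_def by blast
  then have lin: "linear ?DT"
    unfolding transition_deriv_def using smooth_on_has_derivative xO has_derivative_linear by blast
  have DT0: "?DT 0 = 0" using linear_0[OF lin] .
  have "flux c r (snd c p) = \<alpha> (\<lambda>i. ?DT (coord_vector i))"
    unfolding flux_def \<alpha>_def
  proof (intro sum.cong refl arg_cong2[where f = "(*)"])
    fix l
    show "fun_deriv c r (snd c p) (coord_vector l) = dr (?DT (coord_vector l))"
      unfolding dr_def by (rule fun_deriv_change[OF m c r p])
    have 1: "space_vector(l := (1, 0)) = (\<lambda>i. (if i = l then 1 else 0, if i = l then 0 else coord_vector i))"
      and 2: "e (\<lambda>i. ?DT (coord_vector i)) l = (\<lambda>i. (if i = l then 1 else 0, ?DT (if i = l then 0 else coord_vector i)))"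
      by (auto simp: e_def fun_eq_iff DT0)
    show "pulled c (0, snd c p) (space_vector(l := (1, 0))) = \<Theta> (e (\<lambda>i. ?DT (coord_vector i)) l)"
      unfolding 1 2 \<Theta>_def by (rule pulled_chart_change[OF m c 0 p])
  qed
  also have "\<dots> = det (matrix ?DT) * \<alpha> coord_vector"
    by (rule alternating_form_det[OF alt lin])
  also have "\<alpha> coord_vector = flux c' r (snd c' p)"
    unfolding flux_def \<alpha>_def dr_def \<Theta>_def e_def ..
  finally show ?thesis .
qed

text \<open>In the half-space case the frontier points in the chart are boundary points of \<open>M\<close>, where the
  variation is constant; in the other case there is no frontier.\<close>

lemma chart_model_boundary:
  assumes m: "mdim M \<noteq> 0" and c: "c \<in> atlas M"
  obtains A where "openin (top_of_set A) (chart_image c)" "closed A" "convex A" "fat A"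
    "\<And>x. x \<in> chart_image c \<Longrightarrow> x \<in> frontier A \<Longrightarrow> chart_inv c x \<in> mboundary M"
proof -
  have "is_chart (mdim M) (mtop M) c" by (rule M_chart[OF c])
  then consider "openin (top_of_set (coord_space (mdim M))) (chart_image c)"
    | "openin (top_of_set (half_space (mdim M))) (chart_image c)"
    unfolding is_chart_def by blast
  then show thesis
  proof cases
    case 1
    then show thesis using m that[of UNIV] fat_UNIV by (simp add: coord_space_def)
  next
    case 2
    have "chart_inv c x \<in> mboundary M"
      if "x \<in> chart_image c" "x \<in> frontier (half_space (mdim M))" for x
      unfolding mboundary_def
      using m c 2 chart_inv_in[OF that(1)] chart_inv_right[OF that(1)] frontier_half_space_nth[OF m that(2)]
      by auto
    then show thesis
      using that[OF 2 closed_half_space convex_half_space fat_half_space[OF m]] by blast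
  qed
qed

definition time_deriv :: "('p, 'm) chart \<Rightarrow> 'm rn \<Rightarrow> real"
  where "time_deriv c x =
    frechet_derivative (\<lambda>z. pulled c z space_vector) (at (0, x) within times \<times> chart_image c) (1, 0)"

lemma time_deriv_smooth:
  assumes m: "mdim M \<noteq> 0" and c: "c \<in> atlas M"
  shows "smooth_on (chart_image c) (time_deriv c)"
  unfolding time_deriv_def
proof (rule smooth_on_compose[where h = "\<lambda>z. frechet_derivative (\<lambda>z. pulled c z space_vector) (at z within times \<times> chart_image c) (1, 0)"])
  show "smooth_on (chart_image c) (\<lambda>x. (0 :: real, x))"
    by (rule smooth_on_insert_time)
  show "smooth_on (times \<times> chart_image c)
      (\<lambda>z. frechet_derivative (\<lambda>z. pulled c z space_vector) (at z within times \<times> chart_image c) (1, 0))"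
    by (rule smooth_on_derivative[OF fat_domain[OF m c] pulled_smooth[OF m c]])
  show "(\<lambda>x. (0, x)) ` chart_image c \<subseteq> times \<times> chart_image c" using \<epsilon> by auto
qed

text \<open>Both terms together are \<open>d (r \<beta>)\<close>: the Leibniz rule for the vector field \<open>r \<beta>\<close>, whose divergence
  without \<open>r\<close> is the time derivative of the pulled back form.\<close>

lemma divergence_identity:
  assumes m: "mdim M \<noteq> 0" and c: "c \<in> atlas M" and r: "smooth_fun r" and x: "x \<in> interior (chart_image c)"
  shows "flux c r x + r (chart_inv c x) * time_deriv c x =
    (\<Sum>l<mdim M. frechet_derivative (\<lambda>y. r (chart_inv c y) * pulled c (0, y) (space_vector(l := (1, 0))))
      (at x) (coord_vector l))"
proof -
  let ?X = "times \<times> interior (chart_image c)"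
  let ?f = "\<lambda>l z. pulled c z (space_vector(l := (1, 0)))"
  have X: "open ?X" "?X \<subseteq> times \<times> chart_image c" "(0, x) \<in> ?X"
    using x \<epsilon> interior_subset by (auto intro: open_Times)
  have xc: "x \<in> chart_image c" using x interior_subset by blast
  have "(0, x) \<in> interior (times \<times> chart_image c)" using X interior_maximal by blast
  then have at_eq: "at (0, x) within times \<times> chart_image c = at (0, x)" by (rule at_within_interior)
  have "time_deriv c x = (\<Sum>l<mdim M. frechet_derivative (?f l) (at (0, x)) (space_vector l))"
    unfolding time_deriv_def at_eq by (rule pulled_divergence[OF m c X])
  moreover have "frechet_derivative (\<lambda>y. r (chart_inv c y) * ?f l (0, y)) (at x) (coord_vector l) =
      fun_deriv c r x (coord_vector l) * ?f l (0, x) +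
      r (chart_inv c x) * frechet_derivative (?f l) (at (0, x)) (space_vector l)" for l
  proof -
    have "(?f l has_derivative frechet_derivative (?f l) (at (0, x))) (at (0, x))"
      using smooth_on_has_derivative[OF pulled_smooth[OF m c], of "(0, x)"] X unfolding at_eq by blast
    moreover have "((\<lambda>y. (0 :: real, y)) has_derivative (\<lambda>u. (0, u))) (at x)"
      by (intro has_derivative_Pair has_derivative_const has_derivative_ident)
    ultimately have "((\<lambda>y. ?f l (0, y)) has_derivative (\<lambda>u. frechet_derivative (?f l) (at (0, x)) (0, u))) (at x)"
      using has_derivative_compose[of "\<lambda>y. (0 :: real, y)" _ x UNIV "?f l"] by simp
    moreover have "((\<lambda>y. r (chart_inv c y)) has_derivative fun_deriv c r x) (at x)"
      using smooth_on_has_derivative[of "chart_image c" "\<lambda>y. r (chart_inv c y)" x] r c xc at_within_interior[OF x]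
      unfolding smooth_fun_def by auto
    ultimately have "((\<lambda>y. r (chart_inv c y) * ?f l (0, y)) has_derivative
        (\<lambda>u. r (chart_inv c x) * frechet_derivative (?f l) (at (0, x)) (0, u) + fun_deriv c r x u * ?f l (0, x))) (at x)"
      by (intro has_derivative_mult)
    from fun_cong[OF frechet_derivative_at[OF this], of "coord_vector l"] show ?thesis by simp
  qed
  ultimately show ?thesis
    unfolding flux_def by (simp add: sum.distrib sum_distrib_left)
qed

lemma supported_in_chart_integrable:
  fixes g :: "'m rn \<Rightarrow> real"
  assumes c: "c \<in> atlas M" and r: "supp r \<subseteq> fst c" and g: "smooth_on (chart_image c) g"
    and 0: "\<And>x. x \<in> chart_image c \<Longrightarrow> chart_inv c x \<notin> supp r \<Longrightarrow> g x = 0"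
  shows "set_integrable lborel (chart_image c) g"
proof (rule supported_set_integrable[OF supp_image_compact[OF c r]])
  show "snd c ` supp r \<subseteq> chart_image c" using r by blast
  then show "continuous_on (snd c ` supp r) g"
    using smooth_on_imp_continuous_on[OF g] continuous_on_subset by blast
  show "g x = 0" if "x \<in> chart_image c - snd c ` supp r" for x
    using 0 in_supp_image[OF c _ r] that by blast
qed

text \<open>Each component of the vector field \<open>\<sigma> r \<beta>\<close>, extended by \<open>0\<close>, is smooth on the model set \<open>A\<close> and
  vanishes on its frontier, so that its partial derivatives have integral \<open>0\<close>. Their sum is the
  integrand off the null set \<open>frontier A\<close>.\<close>

lemma stokes_in_chart:
  assumes m: "mdim M \<noteq> 0" and c: "c \<in> atlas M" and r: "smooth_fun r" and supp: "supp r \<subseteq> fst c"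
  shows "(LINT x : chart_image c | lborel. \<sigma> c (chart_inv c x) * (flux c r x + r (chart_inv c x) * time_deriv c x)) = 0"
proof -
  obtain A where A: "openin (top_of_set A) (chart_image c)" "closed A" "convex A" "fat A"
    "\<And>x. x \<in> chart_image c \<Longrightarrow> x \<in> frontier A \<Longrightarrow> chart_inv c x \<in> mboundary M"
    using chart_model_boundary[OF m c] by blast
  have sub: "chart_image c \<subseteq> A" using A(1) openin_imp_subset by blast
  define K where "K = snd c ` supp r"
  have K: "compact K" "K \<subseteq> chart_image c" "K \<subseteq> A"
    using supp_image_compact[OF c supp] supp sub unfolding K_def by auto
  define b where "b = (\<lambda>l x. r (chart_inv c x) * pulled c (0, x) (space_vector(l := (1, 0))))"
  define s where "s = (\<lambda>x. \<sigma> c (chart_inv c x))"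
  define G where "G = (\<lambda>l x. if x \<in> chart_image c then s x * b l x else 0)"
  have r_smooth: "smooth_on (chart_image c) (\<lambda>x. r (chart_inv c x))"
    using r c unfolding smooth_fun_def by blast
  have b_smooth: "smooth_on (chart_image c) (b l)" for l
    unfolding b_def by (intro smooth_on_mult r_smooth pulled_now_smooth[OF m c])
  have r0: "r (chart_inv c x) = 0" if "x \<in> chart_image c - K" for x
    using that fun_zero_off_supp[OF c] in_supp_image[OF c _ supp] unfolding K_def by blast
  have G0: "G l x = 0" if "x \<notin> K" for l x
    using r0[of x] that by (simp add: G_def b_def)
  have openK: "openin (top_of_set A) (A - K)"
    using K by (intro openin_diff) (auto simp: closedin_closed_Int compact_imp_closed closed_subset)
  have G_smooth: "smooth_on A (G l)" for l
  proof (rule smooth_on_local_openin)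
    fix x assume x: "x \<in> A"
    show "\<exists>B. openin (top_of_set A) B \<and> x \<in> B \<and> smooth_on B (G l)"
    proof (cases "x \<in> K")
      case True
      have "smooth_on (chart_image c) (\<lambda>x. s x * b l x)"
        unfolding s_def by (intro smooth_on_mult orientation_smooth[OF c] b_smooth)
      then have "smooth_on (chart_image c) (G l)"
        using smooth_on_cong[of "chart_image c" "\<lambda>x. s x * b l x" "G l"] by (simp add: G_def)
      then show ?thesis using A(1) True K(2) by blast
    next
      case False
      have "smooth_on (A - K) (G l)"
        using smooth_on_cong[of "A - K" "G l" "\<lambda>x. 0"] G0 smooth_on_const by blast
      then show ?thesis using openK False x by blast
    qed
  qed
  have G_front: "G l x = 0" if x: "x \<in> frontier A" and l: "l < mdim M" for l x
  proof (cases "x \<in> chart_image c")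
    case True
    have "pulled c (0, x) (space_vector(l := (1, 0))) = 0"
      by (rule pulled_stationary[OF m c True _ l]) (rule boundary[OF _ A(5)[OF True x]])
    then show ?thesis by (simp add: G_def b_def)
  qed (simp add: G_def)
  define D where "D = (\<lambda>l x. frechet_derivative (G l) (at x within A) (coord_vector l))"
  have D_int: "set_integrable lborel A (D l)" for l
  proof (rule supported_set_integrable[OF K(1,3)])
    show "continuous_on K (D l)"
      using smooth_on_imp_continuous_on[OF smooth_on_derivative[OF A(4) G_smooth]] K(3) continuous_on_subset
      unfolding D_def by blast
    show "D l x = 0" if "x \<in> A - K" for x
      unfolding D_def using derivative_zero_openin[OF A(4) G_smooth openK that, of l] G0 by simp
  qed
  have "(LINT x : A | lborel. D l x) = 0" if "l < mdim M" for l
    unfolding D_def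
    by (rule integral_directional_derivative_zero[OF A(2,3,4) G_smooth K(1,3) G0 G_front[OF _ that]])
  then have "(\<Sum>l<mdim M. LINT x : A | lborel. D l x) = 0" by simp
  moreover have "(\<Sum>l<mdim M. LINT x : A | lborel. D l x) = (\<integral>x. (\<Sum>l<mdim M. indicator A x *\<^sub>R D l x) \<partial>lborel)"
    using D_int unfolding set_lebesgue_integral_def set_integrable_def
    by (intro Bochner_Integration.integral_sum[symmetric]) auto
  moreover have "\<dots> = (\<integral>x. indicator (chart_image c) x *\<^sub>R (s x * (flux c r x + r (chart_inv c x) * time_deriv c x)) \<partial>lborel)"
  proof (rule integral_cong_AE)
    show "(\<lambda>x. \<Sum>l<mdim M. indicator A x *\<^sub>R D l x) \<in> borel_measurable lborel"
      using D_int unfolding set_integrable_def by (intro borel_measurable_sum) auto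
    have "set_integrable lborel (chart_image c) (\<lambda>x. s x * (flux c r x + r (chart_inv c x) * time_deriv c x))"
    proof (rule supported_in_chart_integrable[OF c supp])
      show "smooth_on (chart_image c) (\<lambda>x. s x * (flux c r x + r (chart_inv c x) * time_deriv c x))"
        unfolding s_def
        by (intro smooth_on_mult smooth_on_add orientation_smooth[OF c] flux_smooth[OF m c r] r_smooth
            time_deriv_smooth[OF m c])
      show "s x * (flux c r x + r (chart_inv c x) * time_deriv c x) = 0"
        if "x \<in> chart_image c" "chart_inv c x \<notin> supp r" for x
        using flux_zero_off_supp[OF m c r that] fun_zero_off_supp[OF c that] by simp
    qed
    then show "(\<lambda>x. indicator (chart_image c) x *\<^sub>R (s x * (flux c r x + r (chart_inv c x) * time_deriv c x))) \<in> borel_measurable lborel"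
      unfolding set_integrable_def by (rule borel_measurable_integrable)
    have "frontier A \<in> null_sets lebesgue"
      using negligible_convex_frontier[OF A(3)] negligible_iff_null_sets by blast
    then have "AE x in lebesgue. x \<notin> frontier A" by (rule AE_not_in)
    then have "AE x in lborel. x \<notin> frontier A" by (simp add: AE_completion_iff)
    then show "AE x in lborel. (\<Sum>l<mdim M. indicator A x *\<^sub>R D l x) =
        indicator (chart_image c) x *\<^sub>R (s x * (flux c r x + r (chart_inv c x) * time_deriv c x))"
    proof eventually_elim
      fix x assume x: "x \<notin> frontier A"
      show "(\<Sum>l<mdim M. indicator A x *\<^sub>R D l x) =
        indicator (chart_image c) x *\<^sub>R (s x * (flux c r x + r (chart_inv c x) * time_deriv c x))"
      proof (cases "x \<in> chart_image c")
        case True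
        then have xA: "x \<in> interior A" using x sub A(2) by (auto simp: frontier_def)
        obtain W where W: "open W" "chart_image c = A \<inter> W" using A(1) by (auto simp: openin_open)
        have "interior A \<inter> W \<subseteq> interior (chart_image c)"
          using W by (intro interior_maximal) (auto intro: interior_subset[THEN subsetD])
        then have xi: "x \<in> interior (chart_image c)" using xA True W by blast
        obtain B where B: "openin (top_of_set (chart_image c)) B" "x \<in> B" "\<And>y. y \<in> B \<Longrightarrow> s y = s x"
          using orientation_locally_constant[OF c True] unfolding s_def by blast
        obtain W' where W': "open W'" "B = chart_image c \<inter> W'" using B(1) by (auto simp: openin_open)
        define Y where "Y = interior (chart_image c) \<inter> W'"
        have Y: "open Y" "x \<in> Y" "Y \<subseteq> B" using W' B(2) xi interior_subset by (auto simp: Y_def)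
        have "D l x = s x * frechet_derivative (b l) (at x) (coord_vector l)" for l
        proof -
          have "(b l has_derivative frechet_derivative (b l) (at x)) (at x)"
            using smooth_on_has_derivative[OF b_smooth True, of l] at_within_interior[OF xi] by simp
          then have "((\<lambda>y. s x * b l y) has_derivative (\<lambda>u. s x * frechet_derivative (b l) (at x) u)) (at x)"
            by (rule has_derivative_mult_right)
          then have "(G l has_derivative (\<lambda>u. s x * frechet_derivative (b l) (at x) u)) (at x)"
          proof (rule has_derivative_transform_within_open[OF _ Y(1,2)])
            show "s x * b l y = G l y" if "y \<in> Y" for y
              using that Y(3) B(3)[of y] W'(2) by (auto simp: G_def)
          qed
          from fun_cong[OF frechet_derivative_at[OF this], of "coord_vector l"] show ?thesis
            unfolding D_def at_within_interior[OF xA] by simp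
        qed
        then have "(\<Sum>l<mdim M. D l x) = s x * (\<Sum>l<mdim M. frechet_derivative (b l) (at x) (coord_vector l))"
          by (simp add: sum_distrib_left)
        also have "\<dots> = s x * (flux c r x + r (chart_inv c x) * time_deriv c x)"
          using divergence_identity[OF m c r xi] unfolding b_def by simp
        moreover have "x \<in> A" using True sub by blast
        ultimately show ?thesis using True by simp
      next
        case False
        have "indicator A x *\<^sub>R D l x = 0" for l
        proof (cases "x \<in> A")
          case True
          then have "x \<in> A - K" using False K(2) by blast
          then show ?thesis
            unfolding D_def using derivative_zero_openin[OF A(4) G_smooth openK, of x l] G0 by simp
        qed simp
        then have "(\<Sum>l<mdim M. indicator A x *\<^sub>R D l x) = 0" by (intro sum.neutral) blast
        moreover have "indicator (chart_image c) x = (0 :: real)" using False by simp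
        ultimately show ?thesis by (simp only: scaleR_zero_left)
      qed
    qed
  qed
  ultimately show ?thesis by (simp add: set_lebesgue_integral_def s_def)
qed

text \<open>On the overlap of the charts the flux picks up the determinant of the transition map and the
  orientation its sign; together these are the absolute value in the change of variables formula.
  Outside the overlap one of the two functions vanishes on either side.\<close>

lemma flux_exchange:
  assumes m: "mdim M \<noteq> 0" and c: "c \<in> atlas M" "c' \<in> atlas M"
    and r: "smooth_fun r" "supp r \<subseteq> fst c" and q: "smooth_fun q" "supp q \<subseteq> fst c'"
  shows "(LINT x : chart_image c | lborel. \<sigma> c (chart_inv c x) * (q (chart_inv c x) * flux c r x)) =
    (LINT y : chart_image c' | lborel. \<sigma> c' (chart_inv c' y) * (q (chart_inv c' y) * flux c' r y))"
proof -
  note inv = chart_inv_left[OF M_chart[OF c(1)]] and inv' = chart_inv_left[OF M_chart[OF c(2)]]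
  let ?S = "overlap c c'" and ?S' = "overlap c' c" and ?T = "transition c c'"
  define g where "g = (\<lambda>d x. \<sigma> d (chart_inv d x) * (q (chart_inv d x) * flux d r x))"
  have g_smooth: "smooth_on (chart_image d) (g d)" if "d \<in> atlas M" for d
    unfolding g_def using q that unfolding smooth_fun_def
    by (intro smooth_on_mult orientation_smooth flux_smooth m r) auto
  have int: "set_integrable lborel (chart_image c) (g c)"
    by (rule supported_in_chart_integrable[OF c(1) r(2) g_smooth[OF c(1)]])
       (simp add: g_def flux_zero_off_supp[OF m c(1) r(1)])
  have int': "set_integrable lborel (chart_image c') (g c')"
    by (rule supported_in_chart_integrable[OF c(2) q(2) g_smooth[OF c(2)]])
       (simp add: g_def fun_zero_off_supp[OF c(2)])
  have sub: "?S \<subseteq> chart_image c" "?S' \<subseteq> chart_image c'" by (auto simp: overlap_def)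
  have borel: "?S \<in> sets borel" "?S' \<in> sets borel"
    using overlap_borel[OF M_chart M_chart] c by blast+
  have T: "?T (snd c p) = snd c' p" if "p \<in> fst c" for p using inv[OF that] by (simp add: transition_def)
  then have TS: "?T ` ?S = ?S'"
    unfolding overlap_def image_image by (force simp: image_iff)
  have "(LINT x : chart_image c | lborel. g c x) = (LINT x : ?S | lborel. g c x)"
  proof (rule set_integral_cong_support[OF sub(1)])
    fix x assume x: "x \<in> chart_image c - ?S"
    then have "chart_inv c x \<notin> fst c'"
      using overlap_eq[OF M_chart[OF c(1)], of c'] by blast
    then show "g c x = 0"
      using fun_zero_off_supp[OF c(1), of x q] q(2) x by (auto simp: g_def)
  qed
  also have "\<dots> = (LINT y : ?T ` ?S | lborel. g c' y)"
  proof (rule integral_change_of_variables_real)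
    show "?S \<in> sets borel" "?T ` ?S \<in> sets borel" using borel TS by auto
    show "(?T has_derivative transition_deriv c c' (chart_inv c x)) (at x within ?S)" if "x \<in> ?S" for x
    proof -
      have "smooth_on ?S ?T" using M c unfolding smooth_manifold_def by blast
      moreover have "snd c (chart_inv c x) = x"
        by (rule chart_inv_right) (use that sub(1) in blast)
      ultimately show ?thesis
        using smooth_on_has_derivative[of ?S ?T x] that by (simp add: transition_deriv_def)
    qed
    show "inj_on ?T ?S"
    proof (rule inj_onI)
      fix x y assume "x \<in> ?S" "y \<in> ?S" and eq: "?T x = ?T y"
      then obtain p p' where p: "x = snd c p" "p \<in> fst c" "p \<in> fst c'" "y = snd c p'" "p' \<in> fst c" "p' \<in> fst c'"
        unfolding overlap_def by blast
      then have "snd c' p = snd c' p'" using eq T[OF p(2)] T[OF p(5)] by simp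
      then have "p = p'" using inv'[OF p(3)] inv'[OF p(6)] by metis
      then show "x = y" using p by simp
    qed
    show "set_integrable lborel (?T ` ?S) (g c')"
      unfolding TS by (rule set_integrable_subset[OF int' _ sub(2)]) (use borel in simp)
    show "set_integrable lborel ?S (g c)"
      by (rule set_integrable_subset[OF int _ sub(1)]) (use borel in simp)
    fix x assume "x \<in> ?S"
    then obtain p where p: "x = snd c p" "p \<in> fst c" "p \<in> fst c'" by (auto simp: overlap_def)
    let ?d = "det (matrix (transition_deriv c c' p))"
    have "\<sigma> c p = sgn (coord_det (mdim M) (transition_deriv c c' p)) * \<sigma> c' p"
      using \<sigma> c p(2,3) unfolding orientation_def by blast
    then have "\<sigma> c p = sgn ?d * \<sigma> c' p" using m by (simp add: coord_det_def)
    moreover have "flux c r x = ?d * flux c' r (snd c' p)"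
      unfolding p(1) by (rule flux_change[OF m c r(1) p(2,3)])
    moreover have "sgn ?d * ?d = \<bar>?d\<bar>" by (simp add: sgn_mult_self_eq abs_sgn mult.commute)
    ultimately have "g c x = \<bar>?d\<bar> * g c' (snd c' p)"
      unfolding g_def using p by (simp add: inv inv' mult_ac)
    then show "g c x = \<bar>det (matrix (transition_deriv c c' (chart_inv c x)))\<bar> * g c' (?T x)"
      using p T by (simp add: inv)
  qed
  also have "\<dots> = (LINT y : chart_image c' | lborel. g c' y)"
    unfolding TS
  proof (rule set_integral_cong_support[OF sub(2), symmetric])
    fix y assume y: "y \<in> chart_image c' - ?S'"
    then have "chart_inv c' y \<notin> fst c"
      using overlap_eq[OF M_chart[OF c(2)], of c] by blast
    then show "g c' y = 0"
      using flux_zero_off_supp[OF m c(2) r(1), of y] r(2) y by (auto simp: g_def)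
  qed
  finally show ?thesis unfolding g_def .
qed

text \<open>The flux is linear in the function, and the derivative of the constant function \<open>1\<close> is \<open>0\<close>.\<close>

lemma flux_partition_zero:
  assumes m: "mdim M \<noteq> 0" and c: "c \<in> atlas M" and r: "\<And>i. i < k \<Longrightarrow> smooth_fun (\<rho> i)"
    and one: "\<And>p. p \<in> topspace (mtop M) \<Longrightarrow> (\<Sum>i<k. \<rho> i p) = 1" and x: "x \<in> chart_image c"
  shows "(\<Sum>i<k. flux c (\<rho> i) x) = 0"
proof -
  have "((\<lambda>y. \<Sum>i<k. \<rho> i (chart_inv c y)) has_derivative (\<lambda>u. \<Sum>i<k. fun_deriv c (\<rho> i) x u)) (at x within chart_image c)"
    using r c x unfolding smooth_fun_def by (intro has_derivative_sum smooth_on_has_derivative) auto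
  moreover have "((\<lambda>y. \<Sum>i<k. \<rho> i (chart_inv c y)) has_derivative (\<lambda>u. 0)) (at x within chart_image c)"
  proof (rule has_derivative_transform[OF x _ has_derivative_const[of 1]])
    show "(\<Sum>i<k. \<rho> i (chart_inv c y)) = 1" if "y \<in> chart_image c" for y
      using one chart_inv_in[OF that] chart_subset_topspace[OF M_chart[OF c]] by blast
  qed
  ultimately have "(\<Sum>i<k. fun_deriv c (\<rho> i) x u) = 0" for u
    using fat_derivative_unique[OF fat_chart_image[OF M_chart[OF c] m] x] by metis
  then show ?thesis
    unfolding flux_def by (subst sum.swap) (simp add: sum_distrib_right[symmetric])
qed

text \<open>Insert \<open>1 = (\<Sum>j. \<rho>\<^sub>j)\<close> and move the \<open>j\<close>-th summand to the \<open>j\<close>-th chart, where the sum over \<open>i\<close>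
  vanishes.\<close>

lemma total_flux_zero:
  assumes m: "mdim M \<noteq> 0" and \<rho>: "partition_of_unity M k c \<rho>"
  shows "(\<Sum>i<k. LINT x : chart_image (c i) | lborel. \<sigma> (c i) (chart_inv (c i) x) * flux (c i) (\<rho> i) x) = 0"
proof -
  have c: "c i \<in> atlas M" and r: "smooth_fun (\<rho> i)" "supp (\<rho> i) \<subseteq> fst (c i)" if "i < k" for i
    using \<rho> that unfolding partition_of_unity_def smooth_fun_def by (auto simp: o_def)
  have one: "(\<Sum>i<k. \<rho> i p) = 1" if "p \<in> topspace (mtop M)" for p
    using \<rho> that unfolding partition_of_unity_def by blast
  define g where "g = (\<lambda>d i j x. \<sigma> d (chart_inv d x) * (\<rho> j (chart_inv d x) * flux d (\<rho> i) x))"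
  have g_smooth: "smooth_on (chart_image d) (g d i j)" if "d \<in> atlas M" "i < k" "j < k" for d i j
    unfolding g_def using r(1)[OF that(3)] that unfolding smooth_fun_def
    by (intro smooth_on_mult orientation_smooth flux_smooth m r) auto
  have int: "set_integrable lborel (chart_image (c i)) (g (c i) i j)" if "i < k" "j < k" for i j
    by (rule supported_in_chart_integrable[OF c[OF that(1)] r(2)[OF that(1)] g_smooth[OF c[OF that(1)] that]])
       (simp add: g_def flux_zero_off_supp[OF m c[OF that(1)] r(1)[OF that(1)]])
  have int': "set_integrable lborel (chart_image (c j)) (g (c j) i j)" if "i < k" "j < k" for i j
    by (rule supported_in_chart_integrable[OF c[OF that(2)] r(2)[OF that(2)] g_smooth[OF c[OF that(2)] that]])
       (simp add: g_def fun_zero_off_supp[OF c[OF that(2)]])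
  have sum_int: "(LINT x : U | lborel. (\<Sum>j<k. f j x)) = (\<Sum>j<k. LINT x : U | lborel. f j x)"
    if "\<And>j. j < k \<Longrightarrow> set_integrable lborel U (f j)" for U :: "'m rn set" and f :: "nat \<Rightarrow> 'm rn \<Rightarrow> real"
    using that unfolding set_lebesgue_integral_def set_integrable_def scaleR_sum_right
    by (intro Bochner_Integration.integral_sum) auto
  have "(LINT x : chart_image (c i) | lborel. \<sigma> (c i) (chart_inv (c i) x) * flux (c i) (\<rho> i) x) =
      (\<Sum>j<k. LINT x : chart_image (c j) | lborel. g (c j) i j x)" if i: "i < k" for i
  proof -
    have "(\<Sum>j<k. g (c i) i j x) = \<sigma> (c i) (chart_inv (c i) x) * flux (c i) (\<rho> i) x" if x: "x \<in> chart_image (c i)" for x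
    proof -
      have "chart_inv (c i) x \<in> topspace (mtop M)"
        using chart_inv_in[OF x] chart_subset_topspace[OF M_chart[OF c[OF i]]] by blast
      then show ?thesis
        unfolding g_def by (simp add: sum_distrib_left[symmetric] sum_distrib_right[symmetric] one)
    qed
    then have "(LINT x : chart_image (c i) | lborel. \<sigma> (c i) (chart_inv (c i) x) * flux (c i) (\<rho> i) x) =
        (LINT x : chart_image (c i) | lborel. (\<Sum>j<k. g (c i) i j x))"
      unfolding set_lebesgue_integral_def
      by (intro Bochner_Integration.integral_cong) (auto simp: indicator_def)
    also have "\<dots> = (\<Sum>j<k. LINT x : chart_image (c i) | lborel. g (c i) i j x)"
      by (rule sum_int) (rule int[OF i])
    also have "\<dots> = (\<Sum>j<k. LINT x : chart_image (c j) | lborel. g (c j) i j x)"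
      unfolding g_def using c r i by (intro sum.cong refl flux_exchange[OF m]) auto
    finally show ?thesis .
  qed
  then have "(\<Sum>i<k. LINT x : chart_image (c i) | lborel. \<sigma> (c i) (chart_inv (c i) x) * flux (c i) (\<rho> i) x) =
      (\<Sum>j<k. \<Sum>i<k. LINT x : chart_image (c j) | lborel. g (c j) i j x)"
    by (subst sum.swap) simp
  also have "\<dots> = (\<Sum>j<k. LINT x : chart_image (c j) | lborel. (\<Sum>i<k. g (c j) i j x))"
    by (intro sum.cong refl sum_int[symmetric] int') auto
  also have "\<dots> = 0"
  proof (rule sum.neutral, rule ballI)
    fix j assume "j \<in> {..<k}"
    then have j: "j < k" by simp
    have "(\<Sum>i<k. g (c j) i j x) = 0" if "x \<in> chart_image (c j)" for x
      using flux_partition_zero[OF m c[OF j] r(1) one that]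
      by (simp add: g_def sum_distrib_left[symmetric])
    then have "(\<lambda>x. indicator (chart_image (c j)) x *\<^sub>R (\<Sum>i<k. g (c j) i j x)) = (\<lambda>x. 0)"
      by (auto simp: indicator_def)
    then show "(LINT x : chart_image (c j) | lborel. (\<Sum>i<k. g (c j) i j x)) = 0"
      unfolding set_lebesgue_integral_def by simp
  qed
  finally show ?thesis .
qed

text \<open>Differentiation under the integral produces \<open>time_deriv\<close>, which \<open>stokes_in_chart\<close> trades for the
  flux.\<close>

lemma chart_integral_derivative:
  assumes m: "mdim M \<noteq> 0" and c: "c \<in> atlas M" and r: "smooth_fun r" and supp: "supp r \<subseteq> fst c"
  shows "((\<lambda>t. LINT x : chart_image c | lborel. r (chart_inv c x) * \<sigma> c (chart_inv c x) * pulled c (t, x) space_vector)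
    has_real_derivative - (LINT x : chart_image c | lborel. \<sigma> c (chart_inv c x) * flux c r x)) (at 0)"
proof -
  let ?w = "\<lambda>x. r (chart_inv c x) * \<sigma> c (chart_inv c x)"
  have r_smooth: "smooth_on (chart_image c) (\<lambda>x. r (chart_inv c x))"
    using r c unfolding smooth_fun_def by blast
  have w_smooth: "smooth_on (chart_image c) ?w" by (intro smooth_on_mult r_smooth orientation_smooth[OF c])
  have K: "compact (snd c ` supp r)" "snd c ` supp r \<subseteq> chart_image c"
    using supp_image_compact[OF c supp] supp by auto
  have "((\<lambda>t. LINT x : chart_image c | lborel. ?w x * pulled c (t, x) space_vector) has_real_derivative
      (LINT x : chart_image c | lborel. ?w x * time_deriv c x)) (at 0)"
    unfolding time_deriv_def
  proof (rule has_derivative_integral_parameter[OF \<epsilon> fat_chart_image[OF M_chart[OF c] m] pulled_smooth[OF m c] K])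
    show "continuous_on (snd c ` supp r) ?w"
      using continuous_on_subset[OF smooth_on_imp_continuous_on[OF w_smooth] K(2)] .
    show "?w x = 0" if "x \<in> chart_image c - snd c ` supp r" for x
      using fun_zero_off_supp[OF c] in_supp_image[OF c _ supp] that by auto
  qed
  moreover have "(LINT x : chart_image c | lborel. ?w x * time_deriv c x) =
      - (LINT x : chart_image c | lborel. \<sigma> c (chart_inv c x) * flux c r x)"
  proof -
    have 1: "set_integrable lborel (chart_image c) (\<lambda>x. ?w x * time_deriv c x)"
      by (rule supported_in_chart_integrable[OF c supp smooth_on_mult[OF w_smooth time_deriv_smooth[OF m c]]])
         (simp add: fun_zero_off_supp[OF c])
    have 2: "set_integrable lborel (chart_image c) (\<lambda>x. \<sigma> c (chart_inv c x) * flux c r x)"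
      by (rule supported_in_chart_integrable[OF c supp smooth_on_mult[OF orientation_smooth[OF c] flux_smooth[OF m c r]]])
         (simp add: flux_zero_off_supp[OF m c r])
    have "(LINT x : chart_image c | lborel. \<sigma> c (chart_inv c x) * flux c r x + ?w x * time_deriv c x) = 0"
      using stokes_in_chart[OF m c r supp] by (simp add: algebra_simps)
    then show ?thesis using set_integral_add(2)[OF 2 1] by simp
  qed
  ultimately show ?thesis by simp
qed

lemma integral_pullback_derivative_zero:
  assumes m: "mdim M \<noteq> 0" and \<rho>: "partition_of_unity M k c \<rho>"
  shows "((\<lambda>t. \<Sum>i<k. LINT x : chart_image (c i) | lborel. \<rho> i (chart_inv (c i) x) * \<sigma> (c i) (chart_inv (c i) x) *
    pullback N (F t) \<omega> (c i) x coord_vector) has_real_derivative 0) (at 0)"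
proof -
  have c: "c i \<in> atlas M" and r: "smooth_fun (\<rho> i)" "supp (\<rho> i) \<subseteq> fst (c i)" if "i < k" for i
    using \<rho> that unfolding partition_of_unity_def smooth_fun_def by (auto simp: o_def)
  have "((\<lambda>t. \<Sum>i<k. LINT x : chart_image (c i) | lborel. \<rho> i (chart_inv (c i) x) * \<sigma> (c i) (chart_inv (c i) x) *
      pulled (c i) (t, x) space_vector) has_real_derivative
      (\<Sum>i<k. - (LINT x : chart_image (c i) | lborel. \<sigma> (c i) (chart_inv (c i) x) * flux (c i) (\<rho> i) x))) (at 0)"
    using c r by (intro DERIV_sum chart_integral_derivative[OF m]) auto
  then have "((\<lambda>t. \<Sum>i<k. LINT x : chart_image (c i) | lborel. \<rho> i (chart_inv (c i) x) * \<sigma> (c i) (chart_inv (c i) x) *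
      pulled (c i) (t, x) space_vector) has_real_derivative 0) (at 0)"
    using total_flux_zero[OF m \<rho>] by (simp add: sum_negf)
  then show ?thesis
  proof (rule has_field_derivative_transform_within_open[where S = times])
    fix t assume t: "t \<in> times"
    show "(\<Sum>i<k. LINT x : chart_image (c i) | lborel. \<rho> i (chart_inv (c i) x) * \<sigma> (c i) (chart_inv (c i) x) *
        pulled (c i) (t, x) space_vector) =
      (\<Sum>i<k. LINT x : chart_image (c i) | lborel. \<rho> i (chart_inv (c i) x) * \<sigma> (c i) (chart_inv (c i) x) *
        pullback N (F t) \<omega> (c i) x coord_vector)"
      unfolding set_lebesgue_integral_def
      by (intro sum.cong refl Bochner_Integration.integral_cong)
         (auto simp: indicator_def pulled_slice[OF m c t])
  qed (use \<epsilon> in auto)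
qed

end

section \<open>Dimension zero\<close>

text \<open>Closedness of a \<open>0\<close>-form means that its derivative vanishes, so the chain rule along the curve
  \<open>t \<mapsto> F t p\<close> gives \<open>0\<close>. The argument vectors do not influence a \<open>0\<close>-form; they are set to the
  velocity \<open>w\<close> of the curve, the form in which closedness is stated.\<close>

lemma (in closed_form_variation) point_pullback_derivative_zero:
  assumes m: "mdim M = 0" and c: "c \<in> atlas M" and x: "x \<in> chart_image c"
  shows "((\<lambda>t. pullback N (F t) \<omega> c x v) has_real_derivative 0) (at 0)"
proof -
  have 0: "0 \<in> times" using \<epsilon> by simp
  obtain d where d: "d \<in> atlas N" "(0, x) \<in> rep_dom c d"
    using rep_dom_covered[OF c, of "(0, x)"] 0 x by blast
  define Y where "Y = {t. (t, x) \<in> rep_dom c d}"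
  have "openin (top_of_set times) (times \<inter> (\<lambda>t. (t, x)) -` rep_dom c d)"
    by (rule continuous_openin_preimage[OF _ _ rep_dom_openin[OF c d(1)]])
       (use x in \<open>auto intro!: continuous_intros\<close>)
  moreover have "times \<inter> (\<lambda>t. (t, x)) -` rep_dom c d = Y"
    unfolding Y_def rep_dom_eq[OF c] by auto
  ultimately have Y: "open Y" "0 \<in> Y" using d(2) by (auto simp: openin_open_eq Y_def)
  have Y_times: "t \<in> times" if "t \<in> Y" for t using that unfolding Y_def rep_dom_eq[OF c] by auto
  define \<gamma> where "\<gamma> = (\<lambda>t. rep c d (t, x))"
  have \<gamma>_in: "\<gamma> t \<in> chart_image d" if "t \<in> Y" for t
    unfolding \<gamma>_def by (rule rep_in[OF c]) (use that in \<open>simp add: Y_def\<close>)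
  have "((\<lambda>t. (t, x)) has_derivative (\<lambda>h. (h, 0))) (at 0 within Y)"
    by (intro has_derivative_Pair has_derivative_const has_derivative_ident)
  moreover have "(rep c d has_derivative rep_deriv c d (0, x)) (at (0, x) within (\<lambda>t. (t, x)) ` Y)"
    by (rule has_derivative_subset[OF rep_has_derivative[OF c d]]) (auto simp: Y_def)
  ultimately have \<gamma>': "(\<gamma> has_derivative (\<lambda>h. rep_deriv c d (0, x) (h, 0))) (at 0 within Y)"
    unfolding \<gamma>_def by (rule has_derivative_in_compose)
  define w where "w = rep_deriv c d (0, x) (1, 0)"
  have w_in: "w \<in> coord_space (mdim N)"
    unfolding w_def by (rule derivative_in_coord_space[OF fat_open[OF Y(1)] Y(2) \<gamma>'])
      (use \<gamma>_in chart_image_subset_coord_space[OF N_chart[OF d(1)]] in blast)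
  let ?D = "frechet_derivative (\<lambda>y. \<omega> d y (\<lambda>_. w)) (at (\<gamma> 0) within chart_image d)"
  have D: "((\<lambda>y. \<omega> d y (\<lambda>_. w)) has_derivative ?D) (at (\<gamma> 0) within chart_image d)"
    by (rule smooth_on_has_derivative[OF \<omega>_smooth[OF d(1)] \<gamma>_in[OF Y(2)]]) (rule w_in)
  have "((\<lambda>y. \<omega> d y (\<lambda>_. w)) has_derivative ?D) (at (\<gamma> 0) within \<gamma> ` Y)"
    by (rule has_derivative_subset[OF D]) (use \<gamma>_in in blast)
  with \<gamma>' have "((\<lambda>t. \<omega> d (\<gamma> t) (\<lambda>_. w)) has_derivative (\<lambda>h. ?D (rep_deriv c d (0, x) (h, 0)))) (at 0 within Y)"
    by (rule has_derivative_in_compose)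
  moreover have "?D (rep_deriv c d (0, x) (h, 0)) = 0" for h
  proof -
    have "exterior_deriv 0 \<omega> d (\<gamma> 0) (\<lambda>_. w) = 0"
      using closed d(1) \<gamma>_in[OF Y(2)] w_in m unfolding closed_form_def by metis
    then have "?D w = 0" by (simp add: exterior_deriv_def)
    then show ?thesis
      using linear_scale[OF rep_deriv_linear[OF c d], of h "(1, 0)"] linear_scale[OF has_derivative_linear[OF D], of h w]
      by (simp add: w_def)
  qed
  ultimately have "((\<lambda>t. \<omega> d (\<gamma> t) (\<lambda>_. w)) has_derivative (\<lambda>h. 0)) (at 0)"
    using at_within_open[OF Y(2,1)] by simp
  then have "((\<lambda>t. \<omega> d (\<gamma> t) (\<lambda>_. w)) has_real_derivative 0) (at 0)"
    unfolding has_field_derivative_def mult_zero_left[abs_def] .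
  then show ?thesis
  proof (rule has_field_derivative_transform_within_open[OF _ Y])
    fix t assume t: "t \<in> Y"
    let ?p = "F t (chart_inv c x)"
    define d' where "d' = (SOME d. d \<in> atlas N \<and> ?p \<in> fst d)"
    have "d \<in> atlas N \<and> ?p \<in> fst d" using d(1) t unfolding Y_def rep_dom_eq[OF c] by simp
    then have d': "d' \<in> atlas N" "?p \<in> fst d'" and p: "?p \<in> fst d"
      unfolding d'_def by (metis (mono_tags, lifting) someI)+
    have alt: "alternating_form 0 (coord_space (mdim N)) (\<omega> d' (snd d' ?p))"
      using \<omega>_alternating[OF d'(1), of "snd d' ?p"] d'(2) m by simp
    have law: "\<forall>c\<in>atlas N. \<forall>d\<in>atlas N. \<forall>p\<in>fst c \<inter> fst d. \<forall>v. (\<forall>i. v i \<in> coord_space (mdim N)) \<longrightarrow>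
        \<omega> c (snd c p) v = \<omega> d (snd d p) (\<lambda>i. transition_deriv c d p (v i))"
      using \<omega> unfolding differential_form_def by (elim conjE)
    have "\<omega> d (snd d ?p) (\<lambda>_. w) = \<omega> d' (snd d' ?p) (\<lambda>i. transition_deriv d d' ?p w)"
      by (rule law[rule_format, OF d(1) d'(1)]) (use p d'(2) w_in in auto)
    also have "\<dots> = \<omega> d' (snd d' ?p) u" for u
      by (rule alternating_form_cong[OF alt]) simp
    finally have "\<omega> d (snd d ?p) (\<lambda>_. w) = \<omega> d' (snd d' ?p) u" for u .
    then show "\<omega> d (\<gamma> t) (\<lambda>_. w) = pullback N (F t) \<omega> c x v"
      unfolding pullback_def Let_def d'_def[symmetric] by (simp add: \<gamma>_def rep_def local_rep_def)
  qed
qed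

section \<open>Variations of the integral\<close>

theorem corollary4p7:
  fixes M\<^sub>1 :: "('p, 'm::{finite,wellorder}) manifold"
    and M\<^sub>2 :: "('q, 'n::{finite,wellorder}) manifold"
    and m\<^sub>1 m\<^sub>2 :: nat
    and \<sigma> :: "('p, 'm) chart \<Rightarrow> 'p \<Rightarrow> real"
    and \<omega> :: "('q, 'n) form"
    and E :: "('p \<Rightarrow> 'q) \<Rightarrow> real"
  assumes "smooth_manifold M\<^sub>1" and "mdim M\<^sub>1 = m\<^sub>1"
    and "smooth_manifold M\<^sub>2" and "mdim M\<^sub>2 = m\<^sub>2"
    and "compact_space (mtop M\<^sub>1)" and "orientation M\<^sub>1 \<sigma>"
    and "differential_form m\<^sub>1 M\<^sub>2 \<omega>" and "closed_form m\<^sub>1 M\<^sub>2 \<omega>"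
    and "\<And>f. f \<in> smooth_maps M\<^sub>1 M\<^sub>2 \<Longrightarrow> E f = form_integral M\<^sub>1 \<sigma> (pullback M\<^sub>2 f \<omega>)"
  shows "null_lagrangian M\<^sub>1 M\<^sub>2 E"
  unfolding null_lagrangian_def
proof (intro ballI allI impI, elim conjE)
  fix f \<epsilon> F
  assume \<epsilon>: "\<epsilon> > 0" and F: "smooth_variation M\<^sub>1 M\<^sub>2 \<epsilon> F" and F0: "F 0 = f"
    and bd: "\<forall>t\<in>{-\<epsilon><..<\<epsilon>}. \<forall>p\<in>mboundary M\<^sub>1. F t p = f p"
  interpret oriented_variation M\<^sub>1 M\<^sub>2 \<omega> \<epsilon> F \<sigma>
    by unfold_locales (use assms \<epsilon> F F0 bd in auto)
  obtain k c \<rho> where some: "(SOME (k, c, \<rho>). partition_of_unity M\<^sub>1 k c \<rho>) = (k, c, \<rho>)"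
    by (metis prod_cases3)
  obtain k' c' \<rho>' where "partition_of_unity M\<^sub>1 k' c' \<rho>'"
    using partition_of_unity_exists[OF assms(1,5)] by blast
  then have "case (SOME (k, c, \<rho>). partition_of_unity M\<^sub>1 k c \<rho>) of (k, c, \<rho>) \<Rightarrow> partition_of_unity M\<^sub>1 k c \<rho>"
    by (intro someI[of "\<lambda>(k, c, \<rho>). partition_of_unity M\<^sub>1 k c \<rho>" "(k', c', \<rho>')"]) simp
  then have \<rho>: "partition_of_unity M\<^sub>1 k c \<rho>" unfolding some by simp
  define I where "I = (\<lambda>t i. set_lebesgue_integral (coord_measure (mdim M\<^sub>1)) (chart_image (c i))
    (\<lambda>x. \<rho> i (chart_inv (c i) x) * \<sigma> (c i) (chart_inv (c i) x) * pullback M\<^sub>2 (F t) \<omega> (c i) x coord_vector))"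
  have "((\<lambda>t. \<Sum>i<k. I t i) has_real_derivative 0) (at 0)"
  proof (cases "mdim M\<^sub>1 = 0")
    case False
    then show ?thesis
      unfolding I_def using integral_pullback_derivative_zero[OF False \<rho>] by (simp add: coord_measure_def)
  next
    case True
    have "((\<lambda>t. I t i) has_real_derivative 0) (at 0)" if i: "i < k" for i
    proof -
      have c: "c i \<in> atlas M\<^sub>1" using \<rho> i unfolding partition_of_unity_def by blast
      have I_eq: "I t i = (if 0 \<in> chart_image (c i) then \<rho> i (chart_inv (c i) 0) * \<sigma> (c i) (chart_inv (c i) 0) *
          pullback M\<^sub>2 (F t) \<omega> (c i) 0 coord_vector else 0)" for t
        unfolding I_def set_lebesgue_integral_def coord_measure_def using True
        by (simp add: lebesgue_integral_count_space_finite indicator_def)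
      show ?thesis
      proof (cases "0 \<in> chart_image (c i)")
        case in_chart: True
        show ?thesis
          unfolding I_eq using in_chart DERIV_cmult[OF point_pullback_derivative_zero[OF True c in_chart]] by simp
      next
        case False
        then show ?thesis unfolding I_eq by simp
      qed
    qed
    then have "((\<lambda>t. \<Sum>i<k. I t i) has_real_derivative (\<Sum>i<k. 0)) (at 0)"
      by (intro DERIV_sum) auto
    then show ?thesis by simp
  qed
  then show "((\<lambda>t. E (F t)) has_real_derivative 0) (at 0)"
  proof (rule has_field_derivative_transform_within_open[where S = "{-\<epsilon><..<\<epsilon>}"])
    show "(\<Sum>i<k. I t i) = E (F t)" if "t \<in> {-\<epsilon><..<\<epsilon>}" for t
      unfolding assms(9)[OF F_maps[OF that]] form_integral_def some by (simp add: I_def)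
  qed (use \<epsilon> in auto)
qed

end
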